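(* Let $k$ be an algebraically closed field of characteristic $2$ and let $m\geq n\geq 4$ both be even. Then the $m$-linear $SO(n)$-invariant $f=f_{n\times m}$ is an indecomposable element of $R_{n\times m}^{SO(n)}$.
   Context: Write $n=2\nu$ and $m=2\mu$. **Groups.** Coordinates on $k^n$ are $x_1,y_1,\dots,x_\nu,y_\nu$, and $q=x_1y_1+\dots+x_\nu y_\nu$. $O(n)=O(n,k)$ is the group of linear automorphisms of $k^n$ preserving $q$, and $SO(n)$ is its (Zariski) connected component containing the identity (a subgroup of index 2, since $n$ is even). **Invariants.** $R=R_{n\times m}$ is the $k$-algebra of polynomials in the coordinates $x_r^{(i)},y_r^{(i)}$ of indeterminate $n$-dimensional vectors $v^{(1)},\dots,v^{(m)}$; for a group $G$ acting on $k^n$, $R^G$ is the subalgebra of polynomials invariant under the simultaneous action of $G$ on $m$-tuples of vectors. A polynomial is $m$-linear if it is multilinear in $v^{(1)},\dots,v^{(m)}$. An element of $R^G$ is indecomposable if it is not contained in the subalgebra of $R^G$ generated by the elements of $R^G$ of lower degree (i.e. of total degree strictly less than that of the given element). **The polynomial $f$.** Over $\mathbb Z$, let $B^{(ij)}=\sum_{r=1}^\nu(x_r^{(i)}y_r^{(j)}+y_r^{(i)}x_r^{(j)})$ for $1\le i,j\le m$; let $D^{(i_1,\dots,i_n)}=\det[v^{(i_1)},\dots,v^{(i_n)}]$ be the determinant of the matrix with the given columns (coordinates in the order $x_1,y_1,\dots,x_\nu,y_\nu$); and let $\mathrm{Pf}^{(i_1,\dots,i_{2\lambda})}$ be the Pfaffian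 of the $2\lambda\times2\lambda$ skew-symmetric matrix whose $(k,l)$ entry for $k<l$ is $B^{(i_ki_l)}$ (normalized so that the Pfaffian of $\begin{pmatrix}0&a\\-a&0\end{pmatrix}$ is $a$; the empty Pfaffian is $1$). Put $$\tilde f=\frac{1}{2^{\mu-\nu+1}}\left(\mathrm{Pf}^{(1,\dots,2\mu)}-\sum_\pi \mathrm{sgn}\,\pi\cdot D^{(\pi(1),\dots,\pi(n))}\mathrm{Pf}^{(\pi(n+1),\dots,\pi(m))}\right),$$ the sum being over permutations $\pi\in\mathfrak S_m$ with $\pi(1)<\dots<\pi(n)$ and $\pi(n+1)<\dots<\pi(m)$. It has integer coefficients, and $f=f_{n\times m}\in R$ is its reduction modulo 2 (coefficients in the prime field $\mathbb F_2\subset k$). The polynomial $f$ is $SO(n)$-invariant. *)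

theory Defs
  imports
    "HOL-Library.Poly_Mapping"
    "HOL-Combinatorics.Permutations"
    "HOL-Analysis.Abstract_Topology_2"
    "Jordan_Normal_Form.Determinant"
begin

section \<open>Multivariate polynomials\<close>

text \<open>Polynomials are finitely supported functions on monomials, and monomials are finitely
  supported exponent functions; the ring structure is the one of \<open>HOL-Library.Poly_Mapping\<close>.\<close>

type_synonym ('v, 'a) mpoly = "('v \<Rightarrow>\<^sub>0 nat) \<Rightarrow>\<^sub>0 'a"

definition Var :: "'v \<Rightarrow> ('v, 'a::comm_ring_1) mpoly" where
  "Var x = Poly_Mapping.single (Poly_Mapping.single x 1) 1"

definition Const :: "'a::comm_ring_1 \<Rightarrow> ('v, 'a) mpoly" where
  "Const c = Poly_Mapping.single 0 c"

definition mvars :: "('v, 'a::comm_ring_1) mpoly \<Rightarrow> 'v set" where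
  "mvars p = (\<Union>t\<in>Poly_Mapping.keys p. Poly_Mapping.keys t)"

definition total_degree :: "('v, 'a::comm_ring_1) mpoly \<Rightarrow> nat" where
  "total_degree p =
    Max (insert 0 ((\<lambda>t. \<Sum>x\<in>Poly_Mapping.keys t. Poly_Mapping.lookup t x) ` Poly_Mapping.keys p))"

text \<open>Evaluation at \<open>s\<close> in an algebra with structure map \<open>h\<close>: with \<open>h = id\<close> this is the value
  at a point, with \<open>h = Const\<close> it is substitution of polynomials for the variables.\<close>

definition insertion ::
    "('a::comm_ring_1 \<Rightarrow> 'b::comm_ring_1) \<Rightarrow> ('v \<Rightarrow> 'b) \<Rightarrow> ('v, 'a) mpoly \<Rightarrow> 'b" where
  "insertion h s p = (\<Sum>t\<in>Poly_Mapping.keys p.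
     h (Poly_Mapping.lookup p t) * (\<Prod>x\<in>Poly_Mapping.keys t. s x ^ Poly_Mapping.lookup t x))"

inductive_set subalgebra_generated ::
    "('v, 'a::comm_ring_1) mpoly set \<Rightarrow> ('v, 'a) mpoly set" for S where
  Const: "Const c \<in> subalgebra_generated S"
| gen: "p \<in> S \<Longrightarrow> p \<in> subalgebra_generated S"
| add: "p \<in> subalgebra_generated S \<Longrightarrow> r \<in> subalgebra_generated S \<Longrightarrow> p + r \<in> subalgebra_generated S"
| mult: "p \<in> subalgebra_generated S \<Longrightarrow> r \<in> subalgebra_generated S \<Longrightarrow> p * r \<in> subalgebra_generated S"

definition indecomposable_in ::
    "('v, 'a::comm_ring_1) mpoly set \<Rightarrow> ('v, 'a) mpoly \<Rightarrow> bool" where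
  "indecomposable_in A p \<longleftrightarrow>
     p \<in> A \<and> p \<notin> subalgebra_generated {r \<in> A. total_degree r < total_degree p}"


section \<open>The groups\<close>

text \<open>Everything is indexed from 0. The coordinates \<open>x\<^sub>1, y\<^sub>1, \<dots>, x\<^sub>\<nu>, y\<^sub>\<nu>\<close> of \<open>k\<^sup>n\<close>, \<open>n = 2 \<nu>\<close>,
  have the indices \<open>0, 1, \<dots>, n - 2, n - 1\<close>, so \<open>x\<close>-coordinates are the even ones.\<close>

definition quad_form :: "nat \<Rightarrow> 'a::comm_ring_1 vec \<Rightarrow> 'a" where
  "quad_form n v = (\<Sum>r<n div 2. v $ (2 * r) * v $ (2 * r + 1))"

definition orthogonal_group :: "nat \<Rightarrow> 'a::field mat set" where
  "orthogonal_group n = {g \<in> carrier_mat n n. invertible_mat g \<and>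
     (\<forall>v\<in>carrier_vec n. quad_form n (g *\<^sub>v v) = quad_form n v)}"

text \<open>The Zariski topology on the affine space of \<open>n \<times> n\<close> matrices; the generating sets
  (complements of hypersurfaces) are closed under finite intersections.\<close>

definition zariski_mat :: "nat \<Rightarrow> 'a::field mat topology" where
  "zariski_mat n = topology_generated_by
     {{A \<in> carrier_mat n n. insertion id (\<lambda>ij. A $$ ij) p \<noteq> 0} | p.
        mvars p \<subseteq> {..<n} \<times> {..<n}}"

lemma topspace_zariski_mat: "topspace (zariski_mat n :: 'a::field mat topology) = carrier_mat n n"
proof -
  have one: "mvars (1 :: (nat \<times> nat, 'a) mpoly) \<subseteq> {..<n} \<times> {..<n}"
    "insertion id s (1 :: (nat \<times> nat, 'a) mpoly) = (1 :: 'a)" for s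
    by (simp_all add: mvars_def insertion_def)
  have "A \<in> topspace (zariski_mat n)" if "A \<in> carrier_mat n n" for A :: "'a mat"
    unfolding zariski_mat_def topology_generated_by_topspace using that one
    by (auto intro!: exI[of _ "carrier_mat n n"] exI[of _ "1 :: (nat \<times> nat, 'a) mpoly"])
  then show ?thesis
    unfolding zariski_mat_def topology_generated_by_topspace by auto
qed

definition special_orthogonal_group :: "nat \<Rightarrow> 'a::field mat set" where
  "special_orthogonal_group n =
     connected_component_of_set (subtopology (zariski_mat n) (orthogonal_group n)) (1\<^sub>m n)"


section \<open>Invariants of tuples of vectors\<close>

text \<open>The variable \<open>(i, c)\<close> is coordinate \<open>c < n\<close> of the vector \<open>v\<^sup>(\<^sup>i\<^sup>)\<close>, \<open>i < m\<close>.\<close>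

type_synonym 'a vpoly = "(nat \<times> nat, 'a) mpoly"

definition vpoly_ring :: "nat \<Rightarrow> nat \<Rightarrow> 'a::comm_ring_1 vpoly set" where
  "vpoly_ring n m = {p. mvars p \<subseteq> {..<m} \<times> {..<n}}"

definition act :: "nat \<Rightarrow> 'a::comm_ring_1 mat \<Rightarrow> 'a vpoly \<Rightarrow> 'a vpoly" where
  "act n g = insertion Const (\<lambda>(i, c). \<Sum>d<n. Const (g $$ (c, d)) * Var (i, d))"

definition invariants :: "nat \<Rightarrow> nat \<Rightarrow> 'a::comm_ring_1 mat set \<Rightarrow> 'a vpoly set" where
  "invariants n m G = {p \<in> vpoly_ring n m. \<forall>g\<in>G. act n g p = p}"

definition multilinear :: "nat \<Rightarrow> nat \<Rightarrow> 'a::comm_ring_1 vpoly \<Rightarrow> bool" where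
  "multilinear n m p \<longleftrightarrow> p \<in> vpoly_ring n m \<and>
     (\<forall>t\<in>Poly_Mapping.keys p. \<forall>i<m. (\<Sum>c<n. Poly_Mapping.lookup t (i, c)) = 1)"


section \<open>The polynomial \<open>f\<close>\<close>

text \<open>The sum over perfect matchings, each written as the unique permutation listing its pairs in
  increasing order of their first elements.\<close>

definition pfaffian :: "'a::comm_ring_1 mat \<Rightarrow> 'a" where
  "pfaffian A = (let l = dim_row A div 2 in
     \<Sum>\<sigma> | \<sigma> permutes {..<2 * l} \<and> (\<forall>i<l. \<sigma> (2 * i) < \<sigma> (2 * i + 1)) \<and>
           (\<forall>j<l. \<forall>i<j. \<sigma> (2 * i) < \<sigma> (2 * j)).
       of_int (sign \<sigma>) * (\<Prod>i<l. A $$ (\<sigma> (2 * i), \<sigma> (2 * i + 1))))"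

lemma pfaffian_empty: "pfaffian (mat 0 0 a) = (1 :: 'a::comm_ring_1)"
  by (simp add: pfaffian_def)

lemma pfaffian_2: "dim_row A = 2 \<Longrightarrow> pfaffian A = (A $$ (0, 1) :: 'a::comm_ring_1)"
proof -
  assume A: "dim_row A = 2"
  have "{\<sigma>. \<sigma> permutes {..<2::nat} \<and> \<sigma> 0 < \<sigma> 1} = {id}"
  proof (intro equalityI subsetI)
    fix \<sigma> :: "nat \<Rightarrow> nat" assume "\<sigma> \<in> {\<sigma>. \<sigma> permutes {..<2} \<and> \<sigma> 0 < \<sigma> 1}"
    then have \<sigma>: "\<sigma> permutes {..<2}" "\<sigma> 0 < \<sigma> 1" by auto
    have "\<sigma> 1 < 2" using permutes_in_image[OF \<sigma>(1), of 1] by simp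
    with \<sigma>(2) have "\<sigma> 0 = 0" "\<sigma> 1 = 1" by auto
    moreover have "\<sigma> x = x" if "x \<ge> 2" for x using \<sigma>(1) that by (simp add: permutes_def)
    ultimately have "\<sigma> x = x" for x
      by (cases "x = 0 \<or> x = 1") (auto simp: not_less)
    then show "\<sigma> \<in> {id}" by (auto simp: fun_eq_iff)
  qed (auto simp: permutes_id)
  then show ?thesis by (simp add: pfaffian_def A sign_id)
qed

definition B_poly :: "nat \<Rightarrow> nat \<Rightarrow> nat \<Rightarrow> 'a::comm_ring_1 vpoly" where
  "B_poly n i j = (\<Sum>r<n div 2. Var (i, 2 * r) * Var (j, 2 * r + 1)
                             + Var (i, 2 * r + 1) * Var (j, 2 * r))"

definition D_poly :: "nat \<Rightarrow> nat list \<Rightarrow> 'a::comm_ring_1 vpoly" where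
  "D_poly n is = det (mat n n (\<lambda>(c, j). Var (is ! j, c)))"

definition Pf_poly :: "nat \<Rightarrow> nat list \<Rightarrow> 'a::comm_ring_1 vpoly" where
  "Pf_poly n is = pfaffian (mat (length is) (length is) (\<lambda>(k, l).
     if k < l then B_poly n (is ! k) (is ! l)
     else if l < k then - B_poly n (is ! k) (is ! l)
     else 0))"

definition f_tilde :: "nat \<Rightarrow> nat \<Rightarrow> rat vpoly" where
  "f_tilde n m = Const (1 / 2 ^ (m div 2 - n div 2 + 1)) *
     (Pf_poly n [0..<m] -
      (\<Sum>\<pi> | \<pi> permutes {..<m} \<and> strict_mono_on {..<n} \<pi> \<and> strict_mono_on {n..<m} \<pi>.
         of_int (sign \<pi>) * D_poly n (map \<pi> [0..<n]) * Pf_poly n (map \<pi> [n..<m])))"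

text \<open>\<open>f_tilde\<close> has integer coefficients; \<open>f_int\<close> is the same polynomial over \<open>int\<close>, and \<open>f_poly\<close>
  is its image in characteristic 2. The coefficientwise map \<open>Poly_Mapping.map\<close> applies its function
  to the nonzero coefficients only, which is harmless as \<open>of_int 0 = 0\<close>.\<close>

definition f_int :: "nat \<Rightarrow> nat \<Rightarrow> int vpoly" where
  "f_int n m = (THE F. Poly_Mapping.map of_int F = f_tilde n m)"

definition f_poly :: "nat \<Rightarrow> nat \<Rightarrow> 'a::comm_ring_1 vpoly" where
  "f_poly n m = Poly_Mapping.map of_int (f_int n m)"

end

theory Submission
  imports Defs
begin

text \<open>Write \<open>n = 2 k\<close>. The polynomial \<open>f\<close> is a half-spin trace, and this explains all of its properties.
Vectors of the hyperbolic quadratic space act on the spinor space of dimension \<open>2 ^ k\<close> by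
matrices that satisfy the Clifford relation \<open>v v = q(v)\<close>, and these matrices have entries in
the ring generated by the coordinates of \<open>v\<close>. Let \<open>E\<close> be the projection to one of the two half-spin
spaces. Over a ring with \<open>1/2\<close>, Wick's theorem says that the trace of a product of \<open>m\<close> vectors is
\<open>Pf / 2 ^ (m/2 - k)\<close> (\<open>wick\<close>), and its super version says that the trace twisted by
\<open>1 - 2 E\<close> is the shuffle sum of \<open>D * Pf\<close> divided by the same power of 2
(\<open>shuffle_sum_eq_supertrace\<close>). Half the difference of the two is the trace of
\<open>E v\<^sub>1 \<dots> v\<^sub>m\<close>, so that \<open>f_tilde\<close> is this trace for generic vectors
(\<open>f_tilde_half_spin_trace\<close>). This proves that \<open>f_tilde\<close> is integral and gives \<open>f\<close> over every
ring (\<open>f_poly_half_spin_trace\<close>).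

In characteristic 2 the projection \<open>E\<close> is itself an element of the Clifford algebra,
\<open>E = y\<^sub>1 x\<^sub>1 + \<dots> + y\<^sub>k x\<^sub>k\<close>. An isometry \<open>g\<close> preserves the full trace, and it maps \<open>E\<close> to
\<open>E + \<delta>(g)\<close> where \<open>\<delta>\<close> is the Dickson invariant, a polynomial in the entries of \<open>g\<close>. On isometries
\<open>\<delta>\<close> takes only the values 0 and 1 (\<open>dickson_idem\<close>), hence it vanishes on the Zariski
identity component, and \<open>f\<close> is invariant there (\<open>half_spin_trace_invariant\<close>).

For indecomposability let \<open>p\<close> be the following tuple of vectors. The last \<open>n - 4\<close> vectors
are the basis vectors of the planes from the third on; among the remaining \<open>h = m - n + 4\<close>
vectors the first is \<open>x\<^sub>2\<close>, and all others are \<open>z = x\<^sub>2 + y\<^sub>2\<close>. The first plane is left empty. Since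
\<open>z z = q(z) = 1\<close>, the trace formula gives \<open>f(p) = 1\<close> (\<open>half_spin_trace_witness\<close>). On the
other hand let \<open>a\<close> and \<open>b\<close> be invariants, multilinear in complementary nonempty sets of
vectors; then \<open>a(p) b(p) = 0\<close> (\<open>product_vanishes\<close>). The three reasons for this use only
the root subgroups of the orthogonal group, which are polynomially parametrized lines through 1 and thus
lie in the identity component:

\<^item> If an invariant depends on exactly one of the two basis vectors of some plane, then a torus
  that scales this plane makes it vanish at \<open>p\<close>.

\<^item> If \<open>b\<close> depends on some \<open>z\<close> but not on the first vector, then \<open>b(.., z, ..)\<close> is
  \<open>b(.., x\<^sub>2, ..) + b(.., y\<^sub>2, ..)\<close>, and the two summands agree because the simultaneous swap
  of the coordinates in the first two planes is in the group. In characteristic 2 the sum is 0.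

\<^item> Otherwise \<open>a\<close> contains all of the first \<open>h\<close> vectors and misses some plane. Now the swap of
  the first plane together with the missed plane shows that each \<open>z\<close> may be replaced by
  \<open>w = z + x\<^sub>1 + y\<^sub>1\<close> without changing \<open>a\<close>. A unipotent element maps \<open>(x\<^sub>2, y\<^sub>2)\<close> to
  \<open>(x\<^sub>2, w)\<close>, and so \<open>a(p)\<close> is the value of \<open>a\<close> at \<open>(x\<^sub>2, y\<^sub>2, .., y\<^sub>2, ..)\<close>. This
  tuple has a nonzero weight for the torus, because \<open>h \<ge> 4\<close>.

If \<open>f\<close> were a polynomial in invariants of lower degree, its multilinear component would be
a sum of such products. So \<open>f(p)\<close> would be 0.\<close>

section \<open>The spin representation\<close>

definition mtrace :: "'a::comm_ring_1 mat \<Rightarrow> 'a" where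
  "mtrace A = (\<Sum>i<dim_row A. A $$ (i, i))"

lemma mtrace_mult:
  assumes "A \<in> carrier_mat N N" "B \<in> carrier_mat N N"
  shows "mtrace (A * B) = (\<Sum>i<N. \<Sum>j<N. A $$ (i, j) * B $$ (j, i))"
  using assms by (auto simp: mtrace_def scalar_prod_def atLeast0LessThan intro!: sum.cong)

lemma mtrace_comm:
  assumes "A \<in> carrier_mat N N" "B \<in> carrier_mat N N"
  shows "mtrace (A * B) = mtrace (B * A)"
  unfolding mtrace_mult[OF assms] mtrace_mult[OF assms(2,1)]
  by (subst sum.swap) (simp add: mult.commute)

lemma mtrace_add:
  assumes "A \<in> carrier_mat N N" "B \<in> carrier_mat N N"
  shows "mtrace (A + B) = mtrace A + mtrace B"
  using assms by (auto simp: mtrace_def sum.distrib)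

lemma mtrace_diff:
  assumes "A \<in> carrier_mat N N" "B \<in> carrier_mat N N"
  shows "mtrace (A - B) = mtrace A - mtrace B"
  using assms by (auto simp: mtrace_def sum_subtractf)

lemma mtrace_smult: "A \<in> carrier_mat N N \<Longrightarrow> mtrace (c \<cdot>\<^sub>m A) = c * mtrace A"
  by (auto simp: mtrace_def sum_distrib_left)

lemma mtrace_four_block:
  assumes "A \<in> carrier_mat N N" "D \<in> carrier_mat M M"
  shows "mtrace (four_block_mat A B C D) = mtrace A + mtrace D"
proof -
  have "mtrace (four_block_mat A B C D) = (\<Sum>i<N + M. four_block_mat A B C D $$ (i, i))"
    using assms by (simp add: mtrace_def)
  also have "\<dots> = (\<Sum>i<N. four_block_mat A B C D $$ (i, i)) + (\<Sum>i<M. four_block_mat A B C D $$ (N + i, N + i))"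
  proof -
    have "(\<Sum>i<N + M. g i) = (\<Sum>i<N. g i) + (\<Sum>i<M. g (N + i))" for g :: "nat \<Rightarrow> 'a"
      by (induction M) (simp_all add: add.assoc)
    then show ?thesis .
  qed
  also have "\<dots> = mtrace A + mtrace D"
    using assms by (auto simp: mtrace_def)
  finally show ?thesis .
qed

text \<open>The last hyperbolic plane is split off: its isotropic basis vectors exchange the two halves of the spinor space,
and all earlier vectors act on the halves with opposite signs, so that they anticommute with the last plane.\<close>

primrec spin :: "nat \<Rightarrow> (nat \<Rightarrow> 'a::comm_ring_1) \<Rightarrow> 'a mat" where
  "spin 0 v = 0\<^sub>m 1 1"
| "spin (Suc k) v = four_block_mat (spin k v) (v (2 * k) \<cdot>\<^sub>m 1\<^sub>m (2 ^ k))
     (v (2 * k + 1) \<cdot>\<^sub>m 1\<^sub>m (2 ^ k)) (- spin k v)"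

text \<open>The projection to a half-spin space. The choice of the half is the one for which the trace of
\<open>1 - 2 half_proj\<close> times \<open>x\<^sub>1 y\<^sub>1 \<dots> x\<^sub>k y\<^sub>k\<close> is \<open>1\<close> and not \<open>-1\<close>; it decides the sign of the
determinant terms in \<open>f_tilde\<close>.\<close>

primrec half_proj :: "nat \<Rightarrow> 'a::comm_ring_1 mat" where
  "half_proj 0 = 0\<^sub>m 1 1"
| "half_proj (Suc k) = four_block_mat (half_proj k) (0\<^sub>m (2 ^ k) (2 ^ k)) (0\<^sub>m (2 ^ k) (2 ^ k)) (1\<^sub>m (2 ^ k) - half_proj k)"

text \<open>Vectors are functions on all of \<open>nat\<close>, of which only the first \<open>2 k\<close> values matter; this lets vectors of
different dimensions be compared without coercions.\<close>

definition qform :: "nat \<Rightarrow> (nat \<Rightarrow> 'a::comm_ring_1) \<Rightarrow> 'a" where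
  "qform k v = (\<Sum>r<k. v (2 * r) * v (2 * r + 1))"

definition bform :: "nat \<Rightarrow> (nat \<Rightarrow> 'a::comm_ring_1) \<Rightarrow> (nat \<Rightarrow> 'a) \<Rightarrow> 'a" where
  "bform k v w = (\<Sum>r<k. v (2 * r) * w (2 * r + 1) + v (2 * r + 1) * w (2 * r))"

definition basis_vec :: "nat \<Rightarrow> nat \<Rightarrow> 'a::comm_ring_1" where
  "basis_vec c d = (if d = c then 1 else 0)"

lemma spin_dims [simp]: "dim_row (spin k v) = 2 ^ k" "dim_col (spin k v) = 2 ^ k"
  by (induction k) auto

lemma spin_carrier [simp]: "spin k v \<in> carrier_mat (2 ^ k) (2 ^ k)"
  by (rule carrier_matI) auto

lemma half_proj_dims [simp]: "dim_row (half_proj k) = 2 ^ k" "dim_col (half_proj k) = 2 ^ k"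
  by (induction k) auto

lemma half_proj_carrier [simp]: "half_proj k \<in> carrier_mat (2 ^ k) (2 ^ k)"
  by (rule carrier_matI) auto

lemma qform_add: "qform k (\<lambda>c. v c + w c) = qform k v + qform k w + bform k v w"
  by (simp add: qform_def bform_def sum.distrib algebra_simps)

lemma bform_sym: "bform k v w = bform k w v"
  unfolding bform_def by (rule sum.cong) (auto simp: algebra_simps)

lemma smult_one_mult [simp]:
  assumes "(A :: 'a::comm_ring_1 mat) \<in> carrier_mat N M"
  shows "c \<cdot>\<^sub>m 1\<^sub>m N * A = c \<cdot>\<^sub>m A" "A * (c \<cdot>\<^sub>m 1\<^sub>m M) = c \<cdot>\<^sub>m A"
  using assms by (auto simp: mult_smult_distrib[of A N M])

lemma spin_sq: "spin k v * spin k v = qform k v \<cdot>\<^sub>m 1\<^sub>m (2 ^ k)"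
proof (induction k)
  case 0
  show ?case by (rule eq_matI) (auto simp: qform_def)
next
  case (Suc k)
  let ?S = "spin k v" and ?N = "2 ^ k :: nat" and ?x = "v (2 * k)" and ?y = "v (Suc (2 * k))"
  have c: "?S \<in> carrier_mat ?N ?N" "- ?S \<in> carrier_mat ?N ?N" by auto
  have "spin (Suc k) v * spin (Suc k) v = four_block_mat
     (?S * ?S + (?x \<cdot>\<^sub>m 1\<^sub>m ?N) * (?y \<cdot>\<^sub>m 1\<^sub>m ?N)) (?S * (?x \<cdot>\<^sub>m 1\<^sub>m ?N) + (?x \<cdot>\<^sub>m 1\<^sub>m ?N) * (- ?S))
     ((?y \<cdot>\<^sub>m 1\<^sub>m ?N) * ?S + (- ?S) * (?y \<cdot>\<^sub>m 1\<^sub>m ?N)) ((?y \<cdot>\<^sub>m 1\<^sub>m ?N) * (?x \<cdot>\<^sub>m 1\<^sub>m ?N) + (- ?S) * (- ?S))"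
    using c by (simp add: mult_four_block_mat[of _ ?N ?N _ ?N _ ?N _ _ ?N _ ?N])
  also have "(- ?S) * (- ?S) = ?S * ?S"
    using c by (metis uminus_mult_left_mat uminus_mult_right_mat uminus_uminus_mat spin_dims carrier_matD index_uminus_mat(2,3))
  also have "(?x \<cdot>\<^sub>m 1\<^sub>m ?N) * (- ?S) = ?x \<cdot>\<^sub>m (- ?S)" using smult_one_mult(1)[OF c(2)] .
  also have "(- ?S) * (?y \<cdot>\<^sub>m 1\<^sub>m ?N) = ?y \<cdot>\<^sub>m (- ?S)" using smult_one_mult(2)[OF c(2)] .
  also have "four_block_mat (?S * ?S + (?x \<cdot>\<^sub>m 1\<^sub>m ?N) * (?y \<cdot>\<^sub>m 1\<^sub>m ?N)) (?S * (?x \<cdot>\<^sub>m 1\<^sub>m ?N) + ?x \<cdot>\<^sub>m (- ?S))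
     ((?y \<cdot>\<^sub>m 1\<^sub>m ?N) * ?S + ?y \<cdot>\<^sub>m (- ?S)) ((?y \<cdot>\<^sub>m 1\<^sub>m ?N) * (?x \<cdot>\<^sub>m 1\<^sub>m ?N) + ?S * ?S)
    = qform (Suc k) v \<cdot>\<^sub>m 1\<^sub>m (2 ^ Suc k)"
    unfolding Suc using smult_one_mult[OF c(1)]
    by (intro eq_matI) (auto simp: qform_def algebra_simps)
  finally show ?case .
qed

lemma spin_Suc_index:
  assumes "i < 2 ^ Suc k" "j < 2 ^ Suc k"
  shows "spin (Suc k) v $$ (i, j) =
    (if i < 2 ^ k then if j < 2 ^ k then spin k v $$ (i, j) else v (2 * k) * (if i = j - 2 ^ k then 1 else 0)
     else if j < 2 ^ k then v (2 * k + 1) * (if i - 2 ^ k = j then 1 else 0) else - spin k v $$ (i - 2 ^ k, j - 2 ^ k))"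
proof -
  have "i - 2 ^ k < 2 ^ k" if "\<not> i < 2 ^ k" using assms that by auto
  moreover have "j - 2 ^ k < 2 ^ k" if "\<not> j < 2 ^ k" using assms that by auto
  ultimately show ?thesis using assms by simp
qed

text \<open>Linearity in coordinates. In particular a vector without components in the first \<open>k\<close> planes acts by 0.\<close>

lemma spin_expand:
  assumes "i < 2 ^ k" "j < 2 ^ k"
  shows "spin k v $$ (i, j) = (\<Sum>c<2 * k. v c * spin k (basis_vec c) $$ (i, j))"
  using assms
proof (induction k arbitrary: i j v)
  case 0
  then show ?case by simp
next
  case (Suc k)
  have *: "(\<Sum>c<2 * Suc k. g c) = (\<Sum>c<2 * k. g c) + g (2 * k) + g (Suc (2 * k))" for g :: "nat \<Rightarrow> 'a"
    by simp
  have z: "spin k (basis_vec (2 * k)) $$ (i, j) = (0::'a)" "spin k (basis_vec (Suc (2 * k))) $$ (i, j) = (0::'a)"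
    if "i < 2 ^ k" "j < 2 ^ k" for i j
  proof -
    have "(\<Sum>c<2 * k. basis_vec d c * spin k (basis_vec c) $$ (i, j)) = (0::'a)" if "d \<ge> 2 * k" for d
      using that by (intro sum.neutral) (auto simp: basis_vec_def)
    then show "spin k (basis_vec (2 * k)) $$ (i, j) = (0::'a)" "spin k (basis_vec (Suc (2 * k))) $$ (i, j) = (0::'a)"
      using Suc.IH[OF that, of "basis_vec (2 * k)"] Suc.IH[OF that, of "basis_vec (Suc (2 * k))"]
      by simp_all
  qed
  have u: "basis_vec c (2 * k) = (0::'a)" "basis_vec c (Suc (2 * k)) = (0::'a)" if "c < 2 * k" for c
    using that by (auto simp: basis_vec_def)
  have u': "basis_vec (2 * k) (2 * k) = (1::'a)" "basis_vec (Suc (2 * k)) (Suc (2 * k)) = (1::'a)"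
     "basis_vec (2 * k) (Suc (2 * k)) = (0::'a)" "basis_vec (Suc (2 * k)) (2 * k) = (0::'a)"
    by (auto simp: basis_vec_def)
  note ix = spin_Suc_index[OF Suc.prems]
  consider "i < 2 ^ k" "j < 2 ^ k" | "i < 2 ^ k" "\<not> j < 2 ^ k"
    | "\<not> i < 2 ^ k" "j < 2 ^ k" | "\<not> i < 2 ^ k" "\<not> j < 2 ^ k" by blast
  then show ?case
  proof cases
    case 1
    then show ?thesis unfolding * ix by (simp add: z Suc.IH[OF 1, of v])
  next
    case 2
    then show ?thesis unfolding * ix by (simp add: u u')
  next
    case 3
    then show ?thesis unfolding * ix by (simp add: u u')
  next
    case 4
    then have l: "i - 2 ^ k < 2 ^ k" "j - 2 ^ k < 2 ^ k" using Suc.prems by auto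
    then show ?thesis unfolding * ix using 4
      by (simp add: z[OF l] Suc.IH[OF l, of v] sum_negf)
  qed
qed

lemma spin_add: "spin k (\<lambda>c. v c + w c) = spin k v + spin k w"
proof (rule eq_matI)
  fix i j assume "i < dim_row (spin k v + spin k w)" "j < dim_col (spin k v + spin k w)"
  then have "i < 2 ^ k" "j < 2 ^ k" by auto
  then show "spin k (\<lambda>c. v c + w c) $$ (i, j) = (spin k v + spin k w) $$ (i, j)"
    by (simp add: spin_expand[of _ _ _ "\<lambda>c. v c + w c"] spin_expand[of _ _ _ v] spin_expand[of _ _ _ w]
       sum.distrib distrib_right)
qed auto

lemma spin_anticomm: "spin k v * spin k w + spin k w * spin k v = bform k v w \<cdot>\<^sub>m 1\<^sub>m (2 ^ k)"
proof -
  let ?N = "2 ^ k :: nat" and ?v = "spin k v" and ?w = "spin k w"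
  have "(?v + ?w) * (?v + ?w) = (qform k v + qform k w + bform k v w) \<cdot>\<^sub>m 1\<^sub>m ?N"
    using spin_sq[of k "\<lambda>c. v c + w c"] by (simp add: spin_add qform_add)
  moreover have "(?v + ?w) * (?v + ?w) = (?v * ?v + ?w * ?v) + (?v * ?w + ?w * ?w)"
    by (simp add: mult_add_distrib_mat[of _ ?N ?N _ ?N] add_mult_distrib_mat[of _ ?N ?N _ _ ?N])
  ultimately have e: "(qform k v \<cdot>\<^sub>m 1\<^sub>m ?N + ?w * ?v) + (?v * ?w + qform k w \<cdot>\<^sub>m 1\<^sub>m ?N)
      = (qform k v + qform k w + bform k v w) \<cdot>\<^sub>m 1\<^sub>m ?N"
    by (simp add: spin_sq)
  show ?thesis
  proof (rule eq_matI)
    fix i j assume ij: "i < dim_row (bform k v w \<cdot>\<^sub>m 1\<^sub>m (2 ^ k))" "j < dim_col (bform k v w \<cdot>\<^sub>m 1\<^sub>m (2 ^ k))"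
    have "((qform k v \<cdot>\<^sub>m 1\<^sub>m ?N + ?w * ?v) + (?v * ?w + qform k w \<cdot>\<^sub>m 1\<^sub>m ?N)) $$ (i, j)
      = ((qform k v + qform k w + bform k v w) \<cdot>\<^sub>m 1\<^sub>m ?N) $$ (i, j)" using e by simp
    then have "(?w * ?v) $$ (i, j) + (?v * ?w) $$ (i, j) = (bform k v w \<cdot>\<^sub>m 1\<^sub>m ?N) $$ (i, j)"
      using ij by (simp add: algebra_simps split: if_splits)
    then show "(?v * ?w + ?w * ?v) $$ (i, j) = (bform k v w \<cdot>\<^sub>m 1\<^sub>m (2 ^ k)) $$ (i, j)"
      using ij by (simp add: algebra_simps)
  qed auto
qed

text \<open>Vectors are odd: they map each half-spin space into the other one.\<close>

lemma half_proj_spin: "half_proj k * spin k v = spin k v - spin k v * half_proj k"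
proof (induction k)
  case 0
  show ?case by (rule eq_matI) (auto)
next
  case (Suc k)
  let ?S = "spin k v" and ?N = "2 ^ k :: nat" and ?x = "v (2 * k)" and ?y = "v (Suc (2 * k))"
  let ?E = "half_proj k :: 'a mat" and ?O = "0\<^sub>m (2 ^ k) (2 ^ k) :: 'a mat" and ?I = "1\<^sub>m (2 ^ k) :: 'a mat"
  have c: "- ?S \<in> carrier_mat ?N ?N" "?I - ?E \<in> carrier_mat ?N ?N" by auto
  have 1: "half_proj (Suc k) * spin (Suc k) v = four_block_mat (?E * ?S) (?x \<cdot>\<^sub>m ?E)
      (?y \<cdot>\<^sub>m (?I - ?E)) (- (?S - ?E * ?S))"
    using c by (simp add: mult_four_block_mat[of _ ?N ?N _ ?N _ ?N _ _ ?N _ ?N]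
       minus_mult_distrib_mat[of _ ?N ?N _ _ ?N] uminus_mult_right_mat smult_one_mult[OF half_proj_carrier])
      (intro cong_four_block_mat eq_matI; auto)
  have 2: "spin (Suc k) v * half_proj (Suc k) = four_block_mat (?S * ?E) (?x \<cdot>\<^sub>m (?I - ?E))
      (?y \<cdot>\<^sub>m ?E) (- (?S - ?S * ?E))"
    using c by (simp add: mult_four_block_mat[of _ ?N ?N _ ?N _ ?N _ _ ?N _ ?N]
       mult_minus_distrib_mat[of _ ?N ?N _ ?N] uminus_mult_left_mat smult_one_mult[OF half_proj_carrier])
      (intro cong_four_block_mat eq_matI; auto simp: algebra_simps)
  show ?case unfolding 1 2 Suc
    by (intro eq_matI) (auto simp: algebra_simps)
qed

definition clifford_word :: "nat \<Rightarrow> (nat \<Rightarrow> 'a::comm_ring_1) list \<Rightarrow> 'a mat" where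
  "clifford_word k vs = foldr (\<lambda>v M. spin k v * M) vs (1\<^sub>m (2 ^ k))"

lemma clifford_word_simps [simp]: "clifford_word k [] = 1\<^sub>m (2 ^ k)" "clifford_word k (v # vs) = spin k v * clifford_word k vs"
  by (simp_all add: clifford_word_def)

lemma clifford_word_dims [simp]: "dim_row (clifford_word k vs) = 2 ^ k" "dim_col (clifford_word k vs) = 2 ^ k"
  by (induction vs) auto

lemma clifford_word_carrier [simp]: "clifford_word k vs \<in> carrier_mat (2 ^ k) (2 ^ k)"
  by (rule carrier_matI) auto

lemma clifford_word_append: "clifford_word k (as @ bs) = clifford_word k as * clifford_word k bs"
  by (induction as) (simp_all add: assoc_mult_mat[of _ "2 ^ k" "2 ^ k" _ "2 ^ k" _ "2 ^ k"])

definition word_trace :: "nat \<Rightarrow> 'a::comm_ring_1 mat \<Rightarrow> (nat \<Rightarrow> 'a) list \<Rightarrow> 'a" where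
  "word_trace k X vs = mtrace (X * clifford_word k vs)"

abbreviation "spin_trace k \<equiv> word_trace k (1\<^sub>m (2 ^ k))"
abbreviation "half_spin_trace k \<equiv> word_trace k (half_proj k)"
definition "supertrace k vs = spin_trace k vs - 2 * half_spin_trace k vs"

lemma sq_mult_carrier:
  "A \<in> carrier_mat N N \<Longrightarrow> B \<in> carrier_mat N N \<Longrightarrow> A * B \<in> carrier_mat N N"
  by simp

text \<open>Cyclicity of the trace isolates any segment of a word, so identities between matrices of segments turn into
identities between traces of words.\<close>

lemma word_trace_mid:
  assumes "X \<in> carrier_mat (2 ^ k) (2 ^ k)"
  shows "word_trace k X (as @ us @ bs) = mtrace ((clifford_word k bs * (X * clifford_word k as)) * clifford_word k us)"
proof -
  let ?N = "2 ^ k :: nat"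
  have c: "X * clifford_word k as \<in> carrier_mat ?N ?N" "(X * clifford_word k as) * clifford_word k us \<in> carrier_mat ?N ?N"
    using assms by (intro sq_mult_carrier; simp)+
  have "X * clifford_word k (as @ us @ bs) = (X * clifford_word k as) * (clifford_word k us * clifford_word k bs)"
    unfolding clifford_word_append
    by (rule assoc_mult_mat[OF assms clifford_word_carrier sq_mult_carrier, symmetric]) auto
  also have "\<dots> = ((X * clifford_word k as) * clifford_word k us) * clifford_word k bs"
    using c(1) by (intro assoc_mult_mat[symmetric, of _ ?N ?N _ ?N _ ?N]) simp_all
  finally have "word_trace k X (as @ us @ bs) = mtrace (clifford_word k bs * ((X * clifford_word k as) * clifford_word k us))"
    unfolding word_trace_def using mtrace_comm[OF clifford_word_carrier c(2)] by simp
  also have "clifford_word k bs * ((X * clifford_word k as) * clifford_word k us) = (clifford_word k bs * (X * clifford_word k as)) * clifford_word k us"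
    using c(1) by (intro assoc_mult_mat[symmetric, of _ ?N ?N _ ?N _ ?N]) simp_all
  finally show ?thesis .
qed

lemma word_trace_expand:
  assumes "X \<in> carrier_mat (2 ^ k) (2 ^ k)"
  shows "word_trace k X (as @ [v] @ bs) = (\<Sum>c<2 * k. v c * word_trace k X (as @ [basis_vec c] @ bs))"
proof -
  let ?N = "2 ^ k :: nat"
  define M where "M = clifford_word k bs * (X * clifford_word k as)"
  have M: "M \<in> carrier_mat ?N ?N" unfolding M_def using assms by (intro sq_mult_carrier; simp)
  have *: "word_trace k X (as @ [v] @ bs) = (\<Sum>i<?N. \<Sum>j<?N. M $$ (i, j) * spin k v $$ (j, i))" for v
    unfolding word_trace_mid[OF assms] M_def[symmetric] using mtrace_mult[OF M, of "spin k v"] by simp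
  have "word_trace k X (as @ [v] @ bs) = (\<Sum>i<?N. \<Sum>j<?N. \<Sum>c<2*k. M $$ (i, j) * (v c * spin k (basis_vec c) $$ (j, i)))"
    unfolding * by (intro sum.cong refl) (simp add: spin_expand[of _ _ _ v] sum_distrib_left)
  also have "\<dots> = (\<Sum>i<?N. \<Sum>c<2*k. \<Sum>j<?N. M $$ (i, j) * (v c * spin k (basis_vec c) $$ (j, i)))"
    by (intro sum.cong refl sum.swap)
  also have "\<dots> = (\<Sum>c<2*k. \<Sum>i<?N. \<Sum>j<?N. M $$ (i, j) * (v c * spin k (basis_vec c) $$ (j, i)))"
    by (rule sum.swap)
  also have "\<dots> = (\<Sum>c<2 * k. v c * word_trace k X (as @ [basis_vec c] @ bs))"
    unfolding * by (simp add: sum_distrib_left mult_ac)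
  finally show ?thesis .
qed

lemma word_trace_sq:
  assumes "X \<in> carrier_mat (2 ^ k) (2 ^ k)"
  shows "word_trace k X (as @ [v, v] @ bs) = qform k v * word_trace k X (as @ bs)"
proof -
  let ?N = "2 ^ k :: nat"
  define M where "M = clifford_word k bs * (X * clifford_word k as)"
  have M: "M \<in> carrier_mat ?N ?N" unfolding M_def using assms by (intro sq_mult_carrier; simp)
  have "word_trace k X (as @ [v, v] @ bs) = mtrace (qform k v \<cdot>\<^sub>m M)"
    unfolding word_trace_mid[OF assms] M_def[symmetric] using M by (simp add: spin_sq)
  also have "\<dots> = qform k v * word_trace k X (as @ [] @ bs)"
    unfolding word_trace_mid[OF assms] M_def[symmetric] using M by (simp add: mtrace_smult)
  finally show ?thesis by simp
qed

lemma word_trace_exchange: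
  assumes "X \<in> carrier_mat (2 ^ k) (2 ^ k)"
  shows "word_trace k X (as @ [v, w] @ bs) + word_trace k X (as @ [w, v] @ bs) = bform k v w * word_trace k X (as @ bs)"
proof -
  let ?N = "2 ^ k :: nat"
  define M where "M = clifford_word k bs * (X * clifford_word k as)"
  have M: "M \<in> carrier_mat ?N ?N" unfolding M_def using assms by (intro sq_mult_carrier; simp)
  have "word_trace k X (as @ [v, w] @ bs) + word_trace k X (as @ [w, v] @ bs)
      = mtrace (M * (spin k v * spin k w + spin k w * spin k v))"
    unfolding word_trace_mid[OF assms] M_def[symmetric] using M
    by (simp add: mult_add_distrib_mat[OF M sq_mult_carrier sq_mult_carrier]
        mtrace_add[OF sq_mult_carrier[OF M sq_mult_carrier] sq_mult_carrier[OF M sq_mult_carrier]])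
  also have "\<dots> = mtrace (bform k v w \<cdot>\<^sub>m M)"
    using M by (simp add: spin_anticomm)
  also have "\<dots> = bform k v w * word_trace k X (as @ [] @ bs)"
    unfolding word_trace_mid[OF assms] M_def[symmetric] using M by (simp add: mtrace_smult)
  finally show ?thesis by simp
qed

lemma spin_trace_rotate: "spin_trace k (v # vs) = spin_trace k (vs @ [v])"
  by (simp add: word_trace_def clifford_word_append mtrace_comm[of "spin k v" "2 ^ k"])

lemma half_spin_trace_rotate: "half_spin_trace k (v # vs) = spin_trace k (vs @ [v]) - half_spin_trace k (vs @ [v])"
proof -
  let ?N = "2 ^ k :: nat" and ?E = "half_proj k :: 'a mat" and ?W = "clifford_word k vs" and ?S = "spin k v"
  have c: "?S * ?W \<in> carrier_mat ?N ?N" "?E * ?W \<in> carrier_mat ?N ?N" "?S * ?E \<in> carrier_mat ?N ?N"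
    "?S * (?E * ?W) \<in> carrier_mat ?N ?N"
    by (intro sq_mult_carrier; simp)+
  have "?E * (?S * ?W) = (?E * ?S) * ?W"
    by (rule assoc_mult_mat[symmetric, OF half_proj_carrier spin_carrier clifford_word_carrier])
  also have "\<dots> = ?S * ?W - (?S * ?E) * ?W"
    unfolding half_proj_spin by (rule minus_mult_distrib_mat[OF spin_carrier c(3) clifford_word_carrier])
  also have "(?S * ?E) * ?W = ?S * (?E * ?W)"
    by (rule assoc_mult_mat[OF spin_carrier half_proj_carrier clifford_word_carrier])
  finally have "half_spin_trace k (v # vs) = mtrace (?S * ?W) - mtrace (?S * (?E * ?W))"
    by (simp add: word_trace_def mtrace_diff[OF c(1,4)])
  also have "mtrace (?S * (?E * ?W)) = mtrace ((?E * ?W) * ?S)"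
    by (rule mtrace_comm[OF spin_carrier c(2)])
  also have "(?E * ?W) * ?S = ?E * clifford_word k (vs @ [v])"
    unfolding clifford_word_append by (simp add: assoc_mult_mat[OF half_proj_carrier clifford_word_carrier spin_carrier])
  also have "mtrace (?S * ?W) = spin_trace k (vs @ [v])"
    unfolding spin_trace_rotate[symmetric] by (simp add: word_trace_def left_mult_one_mat[OF c(1)])
  finally show ?thesis by (simp add: word_trace_def)
qed

text \<open>The matrix \<open>1 - 2 half_proj\<close> anticommutes with vectors, whence the sign.\<close>

lemma supertrace_rotate: "supertrace k (v # vs) = - supertrace k (vs @ [v])"
  by (simp add: supertrace_def spin_trace_rotate half_spin_trace_rotate)

lemma spin_trace_Nil: "spin_trace k [] = 2 ^ k"
  by (simp add: word_trace_def mtrace_def)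

lemma supertrace_expand: "supertrace k (as @ [v] @ bs) = (\<Sum>c<2 * k. v c * supertrace k (as @ [basis_vec c] @ bs))"
  using word_trace_expand[OF one_carrier_mat, of k as v bs] word_trace_expand[OF half_proj_carrier, of k as v bs]
  unfolding supertrace_def by (simp only: right_diff_distrib sum_subtractf sum_distrib_left mult.left_commute[of 2])

lemma supertrace_exchange: "supertrace k (as @ [v, w] @ bs) + supertrace k (as @ [w, v] @ bs) = bform k v w * supertrace k (as @ bs)"
proof -
  have "supertrace k (as @ [v, w] @ bs) + supertrace k (as @ [w, v] @ bs) =
     (spin_trace k (as @ [v, w] @ bs) + spin_trace k (as @ [w, v] @ bs)) - 2 * (half_spin_trace k (as @ [v, w] @ bs) + half_spin_trace k (as @ [w, v] @ bs))"
    unfolding supertrace_def by (simp only: algebra_simps)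
  then show ?thesis
    unfolding word_trace_exchange[OF one_carrier_mat] word_trace_exchange[OF half_proj_carrier]
    unfolding supertrace_def by (simp only: algebra_simps)
qed

lemma supertrace_sq: "supertrace k (as @ [v, v] @ bs) = qform k v * supertrace k (as @ bs)"
  unfolding supertrace_def word_trace_sq[OF one_carrier_mat] word_trace_sq[OF half_proj_carrier] by (simp add: algebra_simps)

context comm_ring_hom begin

lemma hom_mtrace: "dim_col A = dim_row A \<Longrightarrow> hom (mtrace A) = mtrace (map_mat hom A)"
  by (simp add: mtrace_def hom_sum)

lemma hom_spin: "map_mat hom (spin k v) = spin k (\<lambda>c. hom (v c))"
proof (induction k)
  case (Suc k)
  have "map_mat hom (a \<cdot>\<^sub>m 1\<^sub>m N) = hom a \<cdot>\<^sub>m 1\<^sub>m N" for a and N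
    by (rule eq_matI) (auto simp: hom_mult)
  moreover have "map_mat hom (- spin k v) = - map_mat hom (spin k v)"
    by (rule eq_matI) (auto simp: hom_uminus)
  ultimately show ?case
    by (simp add: map_four_block_mat[of _ "2^k" "2^k" _ "2^k" _ "2^k"] Suc)
qed auto

lemma hom_half_proj: "map_mat hom (half_proj k) = half_proj k"
proof (induction k)
  case (Suc k)
  have "map_mat hom (0\<^sub>m N N) = 0\<^sub>m N N" for N
    by (rule eq_matI) auto
  moreover have "map_mat hom (1\<^sub>m (2 ^ k) - half_proj k) = 1\<^sub>m (2 ^ k) - map_mat hom (half_proj k)"
    by (rule eq_matI) (auto simp: hom_minus)
  moreover have "1\<^sub>m (2 ^ k) - (half_proj k :: 'a mat) \<in> carrier_mat (2^k) (2^k)" by auto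
  ultimately show ?case
    by (simp add: map_four_block_mat[of _ "2^k" "2^k" _ "2^k" _ "2^k"] Suc)
qed auto

lemma hom_clifford_word: "map_mat hom (clifford_word k vs) = clifford_word k (map (\<lambda>v c. hom (v c)) vs)"
proof (induction vs)
  case Nil
  show ?case by (rule eq_matI) auto
next
  case (Cons v vs)
  then show ?case by (simp add: mat_hom_mult[of _ "2^k" "2^k" _ "2^k"] hom_spin)
qed

lemma hom_half_spin_trace: "hom (half_spin_trace k vs) = half_spin_trace k (map (\<lambda>v c. hom (v c)) vs)"
  unfolding word_trace_def
  by (subst hom_mtrace) (simp_all add: mat_hom_mult[of _ "2^k" "2^k" _ "2^k"] hom_clifford_word hom_half_proj)

end

lemma diag_block_mult:
  assumes "A \<in> carrier_mat N N" "B \<in> carrier_mat N N" "C \<in> carrier_mat N N" "D \<in> carrier_mat N N"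
  shows "four_block_mat A (0\<^sub>m N N) (0\<^sub>m N N) B * four_block_mat C (0\<^sub>m N N) (0\<^sub>m N N) D
    = four_block_mat (A * C) (0\<^sub>m N N) (0\<^sub>m N N) (B * D)"
proof -
  have "A * C \<in> carrier_mat N N" "B * D \<in> carrier_mat N N"
    using assms by (intro sq_mult_carrier; simp)+
  then show ?thesis
    using assms by (simp add: mult_four_block_mat[of _ N N _ N _ N _ _ N _ N])
qed

text \<open>Words in vectors of the lower planes are block diagonal; the sign of the second block is the parity of the word.\<close>

lemma clifford_word_block:
  assumes "\<forall>v\<in>set vs. v (2 * k) = 0 \<and> v (Suc (2 * k)) = 0"
  shows "clifford_word (Suc k) vs = four_block_mat (clifford_word k vs) (0\<^sub>m (2^k) (2^k)) (0\<^sub>m (2^k) (2^k)) ((-1) ^ length vs \<cdot>\<^sub>m clifford_word k vs)"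
  using assms
proof (induction vs)
  case Nil
  show ?case by (rule eq_matI) auto
next
  case (Cons v vs)
  let ?N = "2 ^ k :: nat"
  have z: "0 \<cdot>\<^sub>m 1\<^sub>m ?N = (0\<^sub>m ?N ?N :: 'a mat)" by (rule eq_matI) auto
  have c: "- spin k v \<in> carrier_mat ?N ?N" "(- 1) ^ length vs \<cdot>\<^sub>m clifford_word k vs \<in> carrier_mat ?N ?N"
     "spin k v * clifford_word k vs \<in> carrier_mat ?N ?N" "- spin k v * ((- 1) ^ length vs \<cdot>\<^sub>m clifford_word k vs) \<in> carrier_mat ?N ?N"
    by (auto intro!: sq_mult_carrier)
  have e: "- spin k v * ((- 1) ^ length vs \<cdot>\<^sub>m clifford_word k vs) = (- 1) ^ Suc (length vs) \<cdot>\<^sub>m (spin k v * clifford_word k vs)"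
    by (simp add: mult_smult_distrib[OF c(1) clifford_word_carrier] uminus_mult_left_mat) (rule eq_matI; auto)
  have "clifford_word (Suc k) (v # vs) = four_block_mat (spin k v) (0\<^sub>m ?N ?N) (0\<^sub>m ?N ?N) (- spin k v)
     * four_block_mat (clifford_word k vs) (0\<^sub>m ?N ?N) (0\<^sub>m ?N ?N) ((-1) ^ length vs \<cdot>\<^sub>m clifford_word k vs)"
    using Cons by (simp add: z)
  also have "\<dots> = four_block_mat (spin k v * clifford_word k vs) (0\<^sub>m ?N ?N) (0\<^sub>m ?N ?N) (- spin k v * ((-1) ^ length vs \<cdot>\<^sub>m clifford_word k vs))"
    using c by (subst mult_four_block_mat[of _ ?N ?N _ ?N _ ?N _ _ ?N _ ?N])
       (simp_all add: left_mult_zero_mat[of _ ?N ?N] right_mult_zero_mat[of _ ?N ?N])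
  finally show ?case unfolding e by simp
qed

lemma spin_pair:
  "spin (Suc k) (basis_vec (2 * k)) * spin (Suc k) (basis_vec (Suc (2 * k))) =
     four_block_mat (1\<^sub>m (2^k)) (0\<^sub>m (2^k) (2^k)) (0\<^sub>m (2^k) (2^k)) (0\<^sub>m (2^k) (2^k))"
proof -
  let ?N = "2 ^ k :: nat"
  have s: "spin k (basis_vec (2 * k)) = (0\<^sub>m ?N ?N :: 'a mat)" "spin k (basis_vec (Suc (2 * k))) = (0\<^sub>m ?N ?N :: 'a mat)"
    by (rule eq_matI; simp add: spin_expand[of _ k _ "basis_vec _"]; intro sum.neutral; simp add: basis_vec_def)+
  have "(- 0\<^sub>m ?N ?N) = (0\<^sub>m ?N ?N :: 'a mat)" "0 \<cdot>\<^sub>m 1\<^sub>m ?N = (0\<^sub>m ?N ?N :: 'a mat)" "1 \<cdot>\<^sub>m 1\<^sub>m ?N = (1\<^sub>m ?N :: 'a mat)"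
    by (rule eq_matI; simp)+
  then show ?thesis
    by (simp add: s) (simp add: basis_vec_def mult_four_block_mat[of _ ?N ?N _ ?N _ ?N _ _ ?N _ ?N])
qed

text \<open>The product of the two basis vectors of the last plane is the projection to the first half of the spinor space, so it
removes this plane from every trace.\<close>

lemma last_pair:
  assumes lo: "\<forall>v\<in>set vs. v (2 * k) = 0 \<and> v (Suc (2 * k)) = 0" and even_len: "even (length vs)"
  shows "spin_trace (Suc k) (vs @ [basis_vec (2 * k), basis_vec (Suc (2 * k))]) = spin_trace k vs"
    and "half_spin_trace (Suc k) (vs @ [basis_vec (2 * k), basis_vec (Suc (2 * k))]) = half_spin_trace k vs"
proof -
  let ?N = "2 ^ k :: nat" and ?O = "0\<^sub>m (2^k) (2^k) :: 'a mat" and ?W = "clifford_word k vs"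
  have "clifford_word (Suc k) [basis_vec (2 * k), basis_vec (Suc (2 * k))] =
      spin (Suc k) (basis_vec (2 * k)) * (spin (Suc k) (basis_vec (Suc (2 * k))) :: 'a mat)"
    unfolding clifford_word_simps by (simp only: right_mult_one_mat[OF spin_carrier])
  then have w: "clifford_word (Suc k) (vs @ [basis_vec (2 * k), basis_vec (Suc (2 * k))])
     = four_block_mat ?W ?O ?O ((-1) ^ length vs \<cdot>\<^sub>m ?W) * four_block_mat (1\<^sub>m ?N) ?O ?O ?O"
    unfolding clifford_word_append clifford_word_block[OF lo] by (simp only: spin_pair)
  also have "\<dots> = four_block_mat ?W ?O ?O ?O"
    using even_len by (simp add: mult_four_block_mat[of _ ?N ?N _ ?N _ ?N _ _ ?N _ ?N])
  finally have w: "clifford_word (Suc k) (vs @ [basis_vec (2 * k), basis_vec (Suc (2 * k))]) = four_block_mat ?W ?O ?O ?O" .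
  have O: "mtrace ?O = 0" by (simp add: mtrace_def)
  have c: "half_proj k * ?W \<in> carrier_mat ?N ?N" by (intro sq_mult_carrier) auto
  have cI: "1\<^sub>m ?N - half_proj k \<in> carrier_mat ?N ?N" by auto
  have "four_block_mat ?W ?O ?O ?O \<in> carrier_mat (2 ^ Suc k) (2 ^ Suc k)" by (rule carrier_matI) auto
  then show "spin_trace (Suc k) (vs @ [basis_vec (2 * k), basis_vec (Suc (2 * k))]) = spin_trace k vs"
    unfolding word_trace_def w by (simp only: left_mult_one_mat clifford_word_carrier) (simp add: mtrace_four_block[of _ ?N _ ?N] O)
  have "half_proj (Suc k) * four_block_mat ?W ?O ?O ?O = four_block_mat (half_proj k * ?W) ?O ?O ?O"
    unfolding half_proj.simps diag_block_mult[OF half_proj_carrier cI clifford_word_carrier zero_carrier_mat]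
    using cI by (simp add: right_mult_zero_mat[OF cI])
  then show "half_spin_trace (Suc k) (vs @ [basis_vec (2 * k), basis_vec (Suc (2 * k))]) = half_spin_trace k vs"
    unfolding word_trace_def w using c by (simp add: mtrace_four_block[of _ ?N _ ?N] O del: half_proj.simps)
qed

lemma supertrace_canonical: "supertrace k (map basis_vec [0..<2 * k]) = 1"
proof (induction k)
  case 0
  show ?case by (simp add: supertrace_def word_trace_def mtrace_def)
next
  case (Suc k)
  have "map basis_vec [0..<2 * Suc k] = map basis_vec [0..<2 * k] @ [basis_vec (2 * k), basis_vec (Suc (2 * k))]"
    by simp
  moreover have lo: "\<forall>v\<in>set (map basis_vec [0..<2 * k]). v (2 * k) = (0::'a) \<and> v (Suc (2 * k)) = 0"
    by (auto simp: basis_vec_def)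
  ultimately show ?case
    using last_pair[OF lo] Suc by (simp add: supertrace_def del: half_proj.simps power_Suc)
qed

text \<open>In characteristic 2 the projection is the number operator \<open>\<Sum>r. y\<^sub>r x\<^sub>r\<close> of the Fock space: on a basis
spinor it counts the occupied planes modulo 2. Induction on the planes, with the block of the last one. The statement is
in terms of traces to avoid sums of matrices.\<close>

lemma mtrace_half_proj_mult:
  assumes two: "(2::'a::comm_ring_1) = 0" and X: "X \<in> carrier_mat (2 ^ k) (2 ^ k)"
  shows "mtrace (half_proj k * X) =
    (\<Sum>r<k. mtrace ((spin k (basis_vec (Suc (2 * r))) * spin k (basis_vec (2 * r))) * (X :: 'a mat)))"
  using X
proof (induction k arbitrary: X)
  case 0
  then show ?case by (simp add: mtrace_def)
next
  case (Suc k)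
  let ?N = "2 ^ k :: nat" and ?O = "0\<^sub>m (2^k) (2^k) :: 'a mat" and ?I = "1\<^sub>m (2^k) :: 'a mat"
  obtain A B C D where sb: "split_block X ?N ?N = (A, B, C, D)" by (metis prod_cases4)
  have X: "X = four_block_mat A B C D" and c: "A \<in> carrier_mat ?N ?N" "B \<in> carrier_mat ?N ?N"
     "C \<in> carrier_mat ?N ?N" "D \<in> carrier_mat ?N ?N"
    using split_block[OF sb, of ?N ?N] Suc.prems by auto
  have neg: "a = - a" for a :: 'a using two by (metis add.inverse_unique mult_2 mult_zero_left)
  have tr: "mtrace (four_block_mat P ?O ?O Q * X) = mtrace (P * A) + mtrace (Q * D)"
    if "P \<in> carrier_mat ?N ?N" "Q \<in> carrier_mat ?N ?N" for P Q
  proof -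
    have "P * A \<in> carrier_mat ?N ?N" "Q * D \<in> carrier_mat ?N ?N" "P * B \<in> carrier_mat ?N ?N"
       "Q * C \<in> carrier_mat ?N ?N"
      using that c by (intro sq_mult_carrier; simp)+
    then show ?thesis
      unfolding X using c that by (simp add: mult_four_block_mat[of _ ?N ?N _ ?N _ ?N _ _ ?N _ ?N] mtrace_four_block[of _ ?N _ ?N])
  qed
  have cI: "?I - half_proj k \<in> carrier_mat ?N ?N" by auto
  have cc: "half_proj k * D \<in> carrier_mat ?N ?N" using c by (intro sq_mult_carrier; simp)
  have "mtrace (half_proj (Suc k) * X) = mtrace (half_proj k * A) + mtrace ((?I - half_proj k) * D)"
    using tr[OF half_proj_carrier cI] by simp
  also have "mtrace ((?I - half_proj k) * D) = mtrace D - mtrace (half_proj k * D)"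
    using c by (simp add: minus_mult_distrib_mat[OF one_carrier_mat half_proj_carrier] mtrace_diff[OF _ cc])
  also have "\<dots> = mtrace D + mtrace (half_proj k * D)"
    using neg[of "mtrace (half_proj k * D)"] by simp
  finally have 1: "mtrace (half_proj (Suc k) * X) = mtrace (half_proj k * A) + (mtrace D + mtrace (half_proj k * D))" .
  have one_sm: "1 \<cdot>\<^sub>m M = M" for M :: "'a mat" by (rule eq_matI) auto
  have 2: "spin (Suc k) (basis_vec (Suc (2 * r))) * spin (Suc k) (basis_vec (2 * r)) =
     four_block_mat (spin k (basis_vec (Suc (2 * r))) * spin k (basis_vec (2 * r))) ?O ?O
       (spin k (basis_vec (Suc (2 * r))) * (spin k (basis_vec (2 * r)) :: 'a mat))" if "r < k" for r
    using that clifford_word_block[of "[basis_vec (Suc (2 * r)), basis_vec (2 * r) :: nat \<Rightarrow> 'a]" k]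
    by (simp add: basis_vec_def right_mult_one_mat[OF spin_carrier] one_sm del: spin.simps)
  have s: "spin k (basis_vec (2 * k)) = ?O" "spin k (basis_vec (Suc (2 * k))) = ?O"
    by (rule eq_matI; simp add: spin_expand[of _ k _ "basis_vec _"]; intro sum.neutral; simp add: basis_vec_def)+
  have "(- ?O) = ?O" "0 \<cdot>\<^sub>m ?I = ?O" "1 \<cdot>\<^sub>m ?I = ?I"
    by (rule eq_matI; simp)+
  then have 3: "spin (Suc k) (basis_vec (Suc (2 * k))) * spin (Suc k) (basis_vec (2 * k)) = four_block_mat ?O ?O ?O ?I"
    by (simp add: s) (simp add: basis_vec_def mult_four_block_mat[of _ ?N ?N _ ?N _ ?N _ _ ?N _ ?N])
  have "mtrace (?O * A) = 0" using c by (simp add: mtrace_def)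
  then have "(\<Sum>r<Suc k. mtrace ((spin (Suc k) (basis_vec (Suc (2 * r))) * spin (Suc k) (basis_vec (2 * r))) * X))
    = (\<Sum>r<k. mtrace ((spin k (basis_vec (Suc (2 * r))) * spin k (basis_vec (2 * r))) * A)
         + mtrace ((spin k (basis_vec (Suc (2 * r))) * spin k (basis_vec (2 * r))) * D)) + mtrace D"
    using c by (simp add: 2 3 tr sq_mult_carrier del: spin.simps)
  then show ?case
    unfolding 1 Suc.IH[OF c(1)] Suc.IH[OF c(4)] by (simp add: sum.distrib algebra_simps)
qed

lemma half_spin_trace_char2:
  assumes two: "(2::'a::comm_ring_1) = 0"
  shows "half_spin_trace k vs = (\<Sum>r<k. spin_trace k (basis_vec (Suc (2 * r)) # basis_vec (2 * r) # vs :: (nat \<Rightarrow> 'a) list))"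
proof -
  have "mtrace ((spin k u * spin k w) * clifford_word k vs) = spin_trace k (u # w # vs)" for u w
  proof -
    have "spin k u * (spin k w * clifford_word k vs) \<in> carrier_mat (2^k) (2^k)"
      by (intro sq_mult_carrier) auto
    then show ?thesis by (simp add: word_trace_def assoc_mult_mat[OF spin_carrier spin_carrier clifford_word_carrier])
  qed
  then show ?thesis unfolding word_trace_def[of k "half_proj k"] mtrace_half_proj_mult[OF two clifford_word_carrier] by simp
qed

section \<open>Functionals on words with the Clifford relation\<close>

lemma adjacent_swaps_perm:
  assumes "\<And>as c d bs. P (as @ [c, d] @ bs) \<Longrightarrow> P (as @ [d, c] @ bs)"
    and "P xs" "mset xs = mset ys"
  shows "P ys"
  using assms
proof (induction ys arbitrary: xs P)
  case Nil
  then show ?case by simp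
next
  case (Cons y ys)
  from Cons.prems(3) have "y \<in> set xs" by (metis list.set_intros(1) set_mset_mset)
  then obtain a b where xs: "xs = a @ y # b" by (meson split_list)
  have "P (a @ y # b) \<Longrightarrow> P (y # a @ b)" for a b
  proof (induction a arbitrary: b rule: rev_induct)
    case (snoc x a)
    have "P (a @ [x, y] @ b)" using snoc.prems by simp
    then have "P (a @ [y, x] @ b)" by (rule Cons.prems(1))
    then show ?case using snoc.IH[of "x # b"] by simp
  qed simp
  then have "P (y # (a @ b))" using Cons.prems(2) xs by simp
  moreover have "mset (a @ b) = mset ys" using Cons.prems(3) xs by simp
  moreover have "P (y # (as @ [d, c] @ bs))" if "P (y # (as @ [c, d] @ bs))" for as c d bs
    using Cons.prems(1)[of "y # as" c d bs] that by simp
  ultimately show ?case using Cons.IH[of "\<lambda>zs. P (y # zs)" "a @ b"] by blast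
qed

text \<open>Modulo shorter words the Clifford relation makes a functional alternating. By induction on the length its value
on a word of basis vectors depends up to sign only on the multiset of letters, and the value is 0 if a
letter is repeated. So only short words without repetition and the word that lists the whole basis have to be checked.
The bound \<open>M\<close> on the length is needed for functionals like the determinant, which
satisfy the relation in bounded length only.\<close>

lemma clifford_functional_zero:
  fixes \<phi> :: "nat list \<Rightarrow> 'a::comm_ring_1"
  assumes sq: "\<And>as c bs. set (as @ [c] @ bs) \<subseteq> {..<n} \<Longrightarrow> length (as @ [c, c] @ bs) \<le> M \<Longrightarrow> \<phi> (as @ [c, c] @ bs) = 0"
    and exchange: "\<And>as c d bs. set (as @ [c, d] @ bs) \<subseteq> {..<n} \<Longrightarrow> length (as @ [c, d] @ bs) \<le> M \<Longrightarrow>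
      \<phi> (as @ [c, d] @ bs) + \<phi> (as @ [d, c] @ bs) = \<kappa> c d * \<phi> (as @ bs)"
    and short: "\<And>cs. distinct cs \<Longrightarrow> set cs \<subseteq> {..<n} \<Longrightarrow> length cs < n \<Longrightarrow> length cs \<le> M \<Longrightarrow> \<phi> cs = 0"
    and canonical: "n \<le> M \<Longrightarrow> \<phi> [0..<n] = 0"
    and "set cs \<subseteq> {..<n}" "length cs \<le> M"
  shows "\<phi> cs = 0"
  using assms(5,6)
proof (induction cs rule: length_induct)
  case (1 cs)
  define P where "P zs \<longleftrightarrow> mset zs = mset cs \<and> \<phi> zs = 0" for zs
  have set_eq: "set zs = set cs \<and> length zs = length cs" if "mset zs = mset cs" for zs
    using that by (metis mset_eq_length mset_eq_setD)
  have swap: "P (as @ [d, c] @ bs)" if "P (as @ [c, d] @ bs)" for as c d bs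
  proof -
    from that have m: "mset (as @ [c, d] @ bs) = mset cs" and z: "\<phi> (as @ [c, d] @ bs) = 0"
      by (auto simp: P_def)
    note s = set_eq[OF m]
    have "\<phi> (as @ bs) = 0"
      by (rule "1.IH"[rule_format]) (use s 1 in auto)
    then have "\<phi> (as @ [d, c] @ bs) = 0"
      using exchange[of as c d bs] s 1 z by auto
    then show ?thesis using m by (auto simp: P_def add_mset_commute)
  qed
  have "\<exists>zs. P zs"
  proof (cases "distinct cs")
    case False
    then obtain xs ys zs y where cs: "cs = xs @ [y] @ ys @ [y] @ zs"
      using not_distinct_decomp by blast
    have "P (xs @ [y, y] @ ys @ zs)"
      unfolding P_def using sq[of xs y "ys @ zs"] 1 cs by auto
    then show ?thesis ..
  next
    case True
    have "card (set cs) \<le> n" using 1 card_mono[of "{..<n}" "set cs"] by auto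
    then have le: "length cs \<le> n" using True by (simp add: distinct_card)
    show ?thesis
    proof (cases "length cs < n")
      case t: True
      then have "P cs" unfolding P_def using short[of cs] True 1 by auto
      then show ?thesis ..
    next
      case False
      with le have n: "length cs = n" by simp
      then have "set cs = {..<n}"
        using 1 True by (intro card_subset_eq) (auto simp: distinct_card)
      then have "mset [0..<n] = mset cs"
        using True by (intro set_eq_iff_mset_eq_distinct[THEN iffD1]) (auto simp: atLeast0LessThan)
      then have "P [0..<n]" unfolding P_def using canonical n 1 by auto
      then show ?thesis ..
    qed
  qed
  then obtain zs where zs: "P zs" ..
  then have "mset zs = mset cs" by (simp add: P_def)
  from adjacent_swaps_perm[of P, OF swap zs this] show ?case by (simp add: P_def)
qed

text \<open>Multilinearity in coordinates: it also says that only the first \<open>n\<close> coordinates of each vector matter.\<close>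

definition slotwise :: "nat \<Rightarrow> ((nat \<Rightarrow> 'a::comm_ring_1) list \<Rightarrow> 'a) \<Rightarrow> bool" where
  "slotwise n F \<longleftrightarrow> (\<forall>as v bs. F (as @ [v] @ bs) = (\<Sum>c<n. v c * F (as @ [basis_vec c] @ bs)))"

lemma slotwiseD: "slotwise n F \<Longrightarrow> F (as @ [v] @ bs) = (\<Sum>c<n. v c * F (as @ [basis_vec c] @ bs))"
  unfolding slotwise_def by blast

lemma slotwise_zero:
  assumes "slotwise n F"
    and "\<And>cs. set cs \<subseteq> {..<n} \<Longrightarrow> length cs = length vs \<Longrightarrow> F (map basis_vec cs) = 0"
  shows "F vs = 0"
proof -
  have "F (map basis_vec cs @ vs') = 0"
    if "set cs \<subseteq> {..<n}" "length cs + length vs' = length vs" for cs vs'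
    using that
  proof (induction vs' arbitrary: cs)
    case Nil
    then show ?case using assms(2) by simp
  next
    case (Cons v vs')
    have "F (map basis_vec cs @ [v] @ vs') = (\<Sum>c<n. v c * F (map basis_vec cs @ [basis_vec c] @ vs'))"
      by (rule slotwiseD[OF assms(1)])
    also have "\<dots> = 0"
    proof (intro sum.neutral ballI)
      fix c assume "c \<in> {..<n}"
      then have "F (map basis_vec (cs @ [c]) @ vs') = 0"
        using Cons.prems by (intro Cons.IH) auto
      then show "v c * F (map basis_vec cs @ [basis_vec c] @ vs') = 0" by simp
    qed
    finally show ?case by simp
  qed
  from this[of "[]" vs] show ?thesis by simp
qed

lemma slotwise_add:
  assumes "slotwise n F"
  shows "F (as @ [\<lambda>c. v c + w c] @ bs) = F (as @ [v] @ bs) + F (as @ [w] @ bs)"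
  using slotwiseD[OF assms, of as v bs] slotwiseD[OF assms, of as w bs]
     slotwiseD[OF assms, of as "\<lambda>c. v c + w c" bs]
  by (simp add: distrib_right sum.distrib)

text \<open>The relation for squares at \<open>v + w\<close> gives the exchange relation.\<close>

lemma polarize:
  assumes "slotwise n F"
    and sq: "\<And>v. F (as @ [v, v] @ bs) = \<kappa> * qform k v * F (as @ bs)"
  shows "F (as @ [v, w] @ bs) + F (as @ [w, v] @ bs) = \<kappa> * bform k v w * F (as @ bs)"
proof -
  let ?s = "\<lambda>c. v c + w c"
  have "F (as @ [?s, ?s] @ bs) = F (as @ [v, ?s] @ bs) + F (as @ [w, ?s] @ bs)"
    using slotwise_add[OF assms(1), of as v w "?s # bs"] by simp
  also have "F (as @ [v, ?s] @ bs) = F (as @ [v, v] @ bs) + F (as @ [v, w] @ bs)"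
    using slotwise_add[OF assms(1), of "as @ [v]" v w "bs"] by simp
  also have "F (as @ [w, ?s] @ bs) = F (as @ [w, v] @ bs) + F (as @ [w, w] @ bs)"
    using slotwise_add[OF assms(1), of "as @ [w]" v w "bs"] by simp
  finally show ?thesis unfolding sq qform_add by (simp add: algebra_simps)
qed

lemma slotwise_supertrace: "slotwise (2 * k) (supertrace k)"
  unfolding slotwise_def using supertrace_expand by blast

lemma slotwise_spin_trace: "slotwise (2 * k) (spin_trace k)"
  unfolding slotwise_def using word_trace_expand[OF one_carrier_mat] by blast

lemma supertrace_move:
  assumes "\<forall>w\<in>set ws. bform k x w = 0"
  shows "supertrace k (as @ x # ws @ bs) = (-1) ^ length ws * supertrace k (as @ ws @ x # bs)"
  using assms
proof (induction ws arbitrary: as)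
  case (Cons w ws)
  have "supertrace k (as @ x # w # ws @ bs) = - supertrace k (as @ w # x # ws @ bs)"
    using supertrace_exchange[of k as x w "ws @ bs"] Cons.prems by (simp add: eq_neg_iff_add_eq_0)
  also have "\<dots> = - ((-1) ^ length ws * supertrace k (as @ w # ws @ x # bs))"
    using Cons.IH[of "as @ [w]"] Cons.prems by simp
  finally show ?case by simp
qed simp

text \<open>Insert \<open>1 = x y + y x\<close> at the end of the word. Since \<open>x\<close> anticommutes with all letters it can be moved
from one end to the other, which shows that the two summands cancel.\<close>

lemma supertrace_perp:
  fixes x :: "nat \<Rightarrow> 'a::comm_ring_1"
  assumes "bform k x y = 1" "\<forall>w\<in>set ws. bform k x w = 0" "even (length ws) \<or> (2::'a) = 0"
  shows "supertrace k ws = 0"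
proof -
  have one: "(-1) ^ length ws = (1::'a)"
  proof -
    have "(-1) ^ l = (1::'a)" if "(2::'a) = 0" for l
    proof -
      have "-1 = (1::'a)" using that by (metis add.inverse_unique one_add_one)
      then show ?thesis by (metis power_one)
    qed
    then show ?thesis using assms(3) by auto
  qed
  have "supertrace k (ws @ [y] @ [x]) = - supertrace k (x # ws @ [y])"
    using supertrace_rotate[of k x "ws @ [y]"] by simp
  also have "supertrace k (x # ws @ [y]) = supertrace k (ws @ [x, y])"
    using supertrace_move[OF assms(2), of "[]" "[y]"] one by simp
  finally show ?thesis
    using supertrace_exchange[of k ws x y "[]"] assms(1) by simp
qed

lemma supertrace_odd:
  assumes "2 * (hf :: 'a::comm_ring_1) = 1" "odd (length vs)"
  shows "supertrace k vs = (0 :: 'a)"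
proof -
  have "supertrace k (as @ bs) = (-1) ^ length as * supertrace k (bs @ as)" for as bs :: "(nat \<Rightarrow> 'a) list"
  proof (induction as arbitrary: bs)
    case (Cons a as)
    show ?case using supertrace_rotate[of k a "as @ bs"] Cons.IH[of "bs @ [a]"] by simp
  qed simp
  from this[of vs "[]"] have "supertrace k vs = - supertrace k vs" using assms(2) by simp
  then have "2 * supertrace k vs = 0" by (metis add.left_inverse mult_2)
  then have "hf * (2 * supertrace k vs) = 0" by simp
  then show ?thesis using assms(1) by (metis mult.assoc mult.commute mult_1)
qed

section \<open>Pfaffians as spin traces\<close>

lemma spin_trace_pass:
  "spin_trace k (as @ v # bs) = (\<Sum>j<length bs. (-1) ^ j * bform k v (bs ! j) * spin_trace k (as @ take j bs @ drop (Suc j) bs))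
     + (-1) ^ length bs * spin_trace k (as @ bs @ [v])"
proof (induction bs arbitrary: as)
  case Nil
  show ?case by simp
next
  case (Cons b bs)
  have "spin_trace k (as @ v # b # bs) = bform k v b * spin_trace k (as @ bs) - spin_trace k ((as @ [b]) @ v # bs)"
    using word_trace_exchange[OF one_carrier_mat, of k as v b bs] by (simp add: algebra_simps)
  then show ?case unfolding Cons.IH[of "as @ [b]"]
    by (simp add: sum.lessThan_Suc_shift sum_negf del: sum.lessThan_Suc)
qed

text \<open>Expansion of the Pfaffian along its first row.\<close>

fun pf_list :: "('v \<Rightarrow> 'v \<Rightarrow> 'a::comm_ring_1) \<Rightarrow> 'v list \<Rightarrow> 'a" where
  "pf_list b [] = 1"
| "pf_list b (v # vs) = (\<Sum>j<length vs. (-1) ^ j * b v (vs ! j) * pf_list b (take j vs @ drop (Suc j) vs))"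

lemma pf_list_odd: "odd (length vs) \<Longrightarrow> pf_list b vs = 0"
proof (induction b vs rule: pf_list.induct)
  case (2 b v vs)
  have "pf_list b (take j vs @ drop (Suc j) vs) = 0" if "j < length vs" for j
    using 2(1)[of j] that 2(2) by (cases vs) auto
  then show ?case by (simp add: sum.neutral)
qed simp

lemma double_eqI: "a = s - b \<Longrightarrow> b = a \<Longrightarrow> 2 * a = (s::'a::comm_ring_1)"
proof -
  assume a: "a = s - b" and b: "b = a"
  have "2 * a = a + b" unfolding b by (rule mult_2)
  also have "\<dots> = s" by (subst a) simp
  finally show ?thesis .
qed

text \<open>Wick's theorem. Moving the first letter through the word of odd length to its end produces the contraction terms and a
sign \<open>-1\<close>, and the trace is cyclic; so twice the trace satisfies the expansion of the Pfaffian along the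
first row.\<close>

lemma wick: "even (length vs) \<Longrightarrow> 2 ^ (length vs div 2) * spin_trace k vs = 2 ^ k * pf_list (bform k) vs"
proof (induction vs rule: length_induct)
  case (1 vs)
  show ?case
  proof (cases vs)
    case Nil
    then show ?thesis by (simp add: spin_trace_Nil)
  next
    case (Cons v us)
    with 1 have odd: "odd (length us)" by simp
    then obtain l where l: "length us = Suc (2 * l)" by (auto elim: oddE)
    have IH: "2 ^ l * spin_trace k (take j us @ drop (Suc j) us) = 2 ^ k * pf_list (bform k) (take j us @ drop (Suc j) us)"
      if "j < length us" for j
      using "1.IH"[rule_format, of "take j us @ drop (Suc j) us"] that Cons l by simp
    have "spin_trace k vs = (\<Sum>j<length us. (-1) ^ j * bform k v (us ! j) * spin_trace k (take j us @ drop (Suc j) us)) - spin_trace k (us @ [v])"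
      using spin_trace_pass[of k "[]" v us] odd Cons by simp
    moreover have "spin_trace k (us @ [v]) = spin_trace k vs" unfolding Cons by (rule spin_trace_rotate[symmetric])
    ultimately have "2 * spin_trace k vs = (\<Sum>j<length us. (-1) ^ j * bform k v (us ! j) * spin_trace k (take j us @ drop (Suc j) us))"
      by (rule double_eqI)
    then have "2 ^ l * (2 * spin_trace k vs) = (\<Sum>j<length us. (-1) ^ j * bform k v (us ! j) * (2 ^ l * spin_trace k (take j us @ drop (Suc j) us)))"
      by (simp add: sum_distrib_left mult_ac)
    also have "\<dots> = (\<Sum>j<length us. (-1) ^ j * bform k v (us ! j) * (2 ^ k * pf_list (bform k) (take j us @ drop (Suc j) us)))"
      by (intro sum.cong) (auto simp: IH)
    also have "\<dots> = 2 ^ k * pf_list (bform k) vs"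
      by (simp add: Cons sum_distrib_left mult_ac)
    finally show ?thesis using l Cons by (simp add: mult_ac)
  qed
qed

lemma half_power: "2 * (hf :: 'a::comm_ring_1) = 1 \<Longrightarrow> 2 ^ l * hf ^ l = 1"
  by (metis power_mult_distrib power_one)

lemma pf_list_eq:
  assumes "2 * (hf :: 'a::comm_ring_1) = 1" "even (length vs)"
  shows "pf_list (bform k) vs = 2 ^ (length vs div 2) * hf ^ k * spin_trace k vs"
proof -
  have "2 ^ (length vs div 2) * hf ^ k * spin_trace k vs = (2 ^ k * hf ^ k) * pf_list (bform k) vs"
    using wick[OF assms(2), of k] by (simp add: mult_ac)
  then show ?thesis using half_power[OF assms(1)] by simp
qed

text \<open>Inherited from the Clifford relation for traces. The factor 2 comes from the entries \<open>B(v, v) = 2 q(v)\<close>.\<close>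

lemma pf_list_sq:
  assumes "2 * (hf :: 'a::comm_ring_1) = 1"
  shows "pf_list (bform k) (as @ [v, v] @ bs) = 2 * qform k v * (pf_list (bform k) (as @ bs) :: 'a)"
proof (cases "even (length (as @ bs))")
  case True
  then show ?thesis
    using pf_list_eq[OF assms, of "as @ [v, v] @ bs" k] pf_list_eq[OF assms, of "as @ bs" k]
      word_trace_sq[OF one_carrier_mat, of k as v bs] by (simp add: mult_ac)
next
  case False
  then show ?thesis using pf_list_odd[of "as @ [v, v] @ bs" "bform k"] pf_list_odd[of "as @ bs" "bform k"] by simp
qed

lemma slotwise_pf_list:
  assumes "2 * (hf :: 'a::comm_ring_1) = 1"
  shows "slotwise (2 * k) (pf_list (bform k) :: _ \<Rightarrow> 'a)"
  unfolding slotwise_def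
proof (intro allI)
  fix as bs and v :: "nat \<Rightarrow> 'a"
  show "pf_list (bform k) (as @ [v] @ bs) = (\<Sum>c<2 * k. v c * pf_list (bform k) (as @ [basis_vec c] @ bs))"
  proof (cases "even (length (as @ [v] @ bs))")
    case True
    have "pf_list (bform k) (as @ [v] @ bs) = 2 ^ (length (as @ [v] @ bs) div 2) * hf ^ k * spin_trace k (as @ [v] @ bs)" for v :: "nat \<Rightarrow> 'a"
      using True by (intro pf_list_eq[OF assms]) auto
    then show ?thesis
      using slotwiseD[OF slotwise_spin_trace, of k as v bs] by (simp add: sum_distrib_left mult_ac)
  next
    case False
    then show ?thesis using pf_list_odd[of "as @ [_] @ bs" "bform k"] by simp
  qed
qed

section \<open>Shuffle sums as supertraces\<close>

text \<open>The signed sum of \<open>G us ps\<close> over all ways to split a list into a subsequence \<open>us\<close> of length \<open>n\<close> and its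
complement \<open>ps\<close>. The first letter either starts \<open>us\<close>, or it starts \<open>ps\<close> and has to pass all \<open>n\<close> letters of
\<open>us\<close>.\<close>

fun shuffle_sum :: "nat \<Rightarrow> ('v list \<Rightarrow> 'v list \<Rightarrow> 'a::comm_ring_1) \<Rightarrow> 'v list \<Rightarrow> 'a" where
  "shuffle_sum 0 G xs = G [] xs"
| "shuffle_sum (Suc n) G [] = 0"
| "shuffle_sum (Suc n) G (x # xs) = shuffle_sum n (\<lambda>us. G (x # us)) xs + (-1) ^ Suc n * shuffle_sum (Suc n) (\<lambda>us ps. G us (x # ps)) xs"

lemma shuffle_sum_sum: "finite C \<Longrightarrow> shuffle_sum n (\<lambda>us ps. \<Sum>c\<in>C. a c * G c us ps) xs = (\<Sum>c\<in>C. a c * shuffle_sum n (G c) xs)"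
proof (induction xs arbitrary: n G)
  case Nil
  then show ?case by (cases n) simp_all
next
  case (Cons x xs)
  show ?case
  proof (cases n)
    case (Suc m)
    show ?thesis using Cons unfolding Suc shuffle_sum.simps
      by (simp add: sum_distrib_left algebra_simps sum.distrib sum_negf sum_subtractf)
  qed simp
qed

lemma shuffle_sum_scale: "shuffle_sum n (\<lambda>us ps. a * G us ps) xs = a * shuffle_sum n G xs"
  using shuffle_sum_sum[of "{()}" n "\<lambda>_. a" "\<lambda>_. G" xs] by simp

lemma shuffle_sum_zero: "shuffle_sum n (\<lambda>us ps. 0) xs = 0"
  using shuffle_sum_sum[of "{}" n _ _ xs] by simp

lemma shuffle_sum_short: "length xs < n \<Longrightarrow> shuffle_sum n G xs = 0"
proof (induction xs arbitrary: n G)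
  case Nil
  then show ?case by (cases n) simp_all
next
  case (Cons x xs)
  then obtain m where "n = Suc m" by (cases n) auto
  then show ?case using Cons by simp
qed

lemma shuffle_sum_full: "length xs = n \<Longrightarrow> shuffle_sum n G xs = G xs []"
proof (induction xs arbitrary: n G)
  case (Cons x xs)
  then obtain m where "n = Suc m" by (cases n) auto
  then show ?case using Cons by (simp add: shuffle_sum_short)
qed simp

text \<open>For a repeated letter the terms with both copies in the alternating part vanish, those with one copy in each part
cancel in pairs, and those with both copies in the second part give the relation for \<open>G us\<close>.\<close>

lemma shuffle_sum_sq:
  fixes \<kappa> :: "'a::comm_ring_1"
  assumes "\<And>as bs ps. G (as @ [v, v] @ bs) ps = 0"
    and "\<And>us as bs. G us (as @ [v, v] @ bs) = \<kappa> * G us (as @ bs)"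
  shows "shuffle_sum n G (as @ [v, v] @ bs) = \<kappa> * shuffle_sum n G (as @ bs)"
  using assms
proof (induction as arbitrary: n G)
  case Nil
  have 1: "(\<lambda>us. G (v # v # us)) = (\<lambda>us ps. 0)" using Nil(1)[of "[]"] by (intro ext) simp
  have 2: "(\<lambda>us ps. G us (v # v # ps)) = (\<lambda>us ps. \<kappa> * G us ps)" using Nil(2)[of _ "[]"] by (intro ext) simp
  consider "n = 0" | "n = Suc 0" | m where "n = Suc (Suc m)" by (metis not0_implies_Suc)
  then show ?case
  proof cases
    case 1
    then show ?thesis using Nil(2)[of "[]" "[]"] by simp
  next
    case c: 2
    then show ?thesis using fun_cong[OF fun_cong[OF 1]] by (simp add: 2 shuffle_sum_scale)
  next
    case 3
    have "(-1::'a) ^ m * (-1) ^ m = 1" by (metis power_mult_distrib mult_minus_left mult_minus_right minus_minus mult_1 power_one)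
    then have *: "(-1::'a) ^ m * ((-1) ^ m * a) = a" for a by (simp add: mult.assoc[symmetric])
    show ?thesis unfolding 3 by (simp add: 1 2 shuffle_sum_zero shuffle_sum_scale algebra_simps *)
  qed
next
  case (Cons a as)
  show ?case
  proof (cases n)
    case 0
    then show ?thesis using Cons.prems(2)[of "[]" "a # as"] by simp
  next
    case (Suc m)
    have "shuffle_sum m (\<lambda>us. G (a # us)) (as @ [v, v] @ bs) = \<kappa> * shuffle_sum m (\<lambda>us. G (a # us)) (as @ bs)"
      using Cons.prems(1)[of "a # _"] Cons.prems(2) by (intro Cons.IH) simp_all
    moreover have "shuffle_sum (Suc m) (\<lambda>us ps. G us (a # ps)) (as @ [v, v] @ bs) = \<kappa> * shuffle_sum (Suc m) (\<lambda>us ps. G us (a # ps)) (as @ bs)"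
      using Cons.prems(1) Cons.prems(2)[of _ "a # _"] by (intro Cons.IH) simp_all
    ultimately show ?thesis unfolding Suc by (simp add: algebra_simps)
  qed
qed

lemma shuffle_sum_slotwise:
  assumes "\<And>ps. slotwise N (\<lambda>us. G us ps)" "\<And>us. slotwise N (G us)"
  shows "slotwise N (shuffle_sum n G)"
proof -
  have "shuffle_sum n G (as @ [v] @ bs) = (\<Sum>c<N. v c * shuffle_sum n G (as @ [basis_vec c] @ bs))" for as v bs
    using assms
  proof (induction as arbitrary: n G)
    case Nil
    show ?case
    proof (cases n)
      case 0
      then show ?thesis using slotwiseD[OF Nil(2), of "[]" "[]" v bs] by simp
    next
      case (Suc m)
      have "(\<lambda>us. G (v # us)) = (\<lambda>us ps. \<Sum>c<N. v c * G (basis_vec c # us) ps)"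
        using slotwiseD[OF Nil(1), of "[]" v] by (intro ext) simp
      moreover have "(\<lambda>us ps. G us (v # ps)) = (\<lambda>us ps. \<Sum>c<N. v c * G us (basis_vec c # ps))"
        using slotwiseD[OF Nil(2), of _ "[]" v] by (intro ext) simp
      ultimately show ?thesis
        by (simp add: Suc shuffle_sum_sum sum_distrib_left sum.distrib algebra_simps sum_negf sum_subtractf)
    qed
  next
    case (Cons a as)
    show ?case
    proof (cases n)
      case 0
      then show ?thesis using slotwiseD[OF Cons.prems(2), of "[]" "a # as" v bs] by simp
    next
      case (Suc m)
      have s: "slotwise N (\<lambda>us. F (a # us))" if "slotwise N F" for F :: "(nat \<Rightarrow> 'a) list \<Rightarrow> 'a"
        unfolding slotwise_def
      proof (intro allI)
        fix as bs and w :: "nat \<Rightarrow> 'a"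
        show "F (a # as @ [w] @ bs) = (\<Sum>c<N. w c * F (a # as @ [basis_vec c] @ bs))"
          using slotwiseD[OF that, of "a # as" w bs] by simp
      qed
      have "shuffle_sum m (\<lambda>us. G (a # us)) (as @ [v] @ bs) = (\<Sum>c<N. v c * shuffle_sum m (\<lambda>us. G (a # us)) (as @ [basis_vec c] @ bs))"
        using Cons.prems by (intro Cons.IH s)
      moreover have "shuffle_sum (Suc m) (\<lambda>us ps. G us (a # ps)) (as @ [v] @ bs)
         = (\<Sum>c<N. v c * shuffle_sum (Suc m) (\<lambda>us ps. G us (a # ps)) (as @ [basis_vec c] @ bs))"
        using Cons.prems by (intro Cons.IH s)
      ultimately show ?thesis unfolding Suc
        by (simp add: sum_distrib_left sum.distrib algebra_simps sum_negf sum_subtractf)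
    qed
  qed
  then show ?thesis unfolding slotwise_def by blast
qed

text \<open>The value 0 for lists of the wrong length makes the function alternating and multilinear on lists of every length.\<close>

definition det_list :: "nat \<Rightarrow> (nat \<Rightarrow> 'a::comm_ring_1) list \<Rightarrow> 'a" where
  "det_list n us = (if length us = n then det (mat n n (\<lambda>(c, j). (us ! j) c)) else 0)"

lemma det_list_sq: "det_list n (as @ [v, v] @ bs) = 0"
proof (cases "length (as @ [v, v] @ bs) = n")
  case True
  let ?A = "mat n n (\<lambda>(c, j). ((as @ [v, v] @ bs) ! j) c)"
  have "col ?A (length as) = col ?A (Suc (length as))"
    using True by (intro eq_vecI) (auto simp: nth_append)
  then have "det ?A = 0"
    using True by (intro det_identical_columns[of _ n "length as" "Suc (length as)"]) auto
  then show ?thesis by (simp add: det_list_def)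
qed (simp add: det_list_def)

lemma slotwise_det_list: "slotwise n (det_list n)"
  unfolding slotwise_def
proof (intro allI)
  fix as bs and v :: "nat \<Rightarrow> 'a"
  show "det_list n (as @ [v] @ bs) = (\<Sum>c<n. v c * det_list n (as @ [basis_vec c] @ bs))"
  proof (cases "length (as @ [v] @ bs) = n")
    case True
    let ?A = "\<lambda>v. mat n n (\<lambda>(c, j). ((as @ [v] @ bs) ! j) c)"
    let ?l = "length as"
    have l: "?l < n" using True by simp
    have cof: "cofactor (?A w) i ?l = cofactor (?A v) i ?l" if "i < n" for w i
    proof -
      have "mat_delete (?A w) i ?l = mat_delete (?A v) i ?l"
        using l that by (intro eq_matI) (auto simp: mat_delete_def nth_append)
      then show ?thesis by (simp add: cofactor_def)
    qed
    have lap: "det (?A w) = (\<Sum>i<n. w i * cofactor (?A v) i ?l)" for w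
    proof -
      have "det (?A w) = (\<Sum>i<n. ?A w $$ (i, ?l) * cofactor (?A w) i ?l)"
        by (rule laplace_expansion_column[OF _ l]) simp
      also have "\<dots> = (\<Sum>i<n. w i * cofactor (?A v) i ?l)"
      proof (intro sum.cong refl)
        fix i assume "i \<in> {..<n}"
        then have i: "i < n" by simp
        then have "?A w $$ (i, ?l) = w i" using l by simp
        then show "?A w $$ (i, ?l) * cofactor (?A w) i ?l = w i * cofactor (?A v) i ?l"
          unfolding cof[OF i, of w] by simp
      qed
      finally show ?thesis .
    qed
    have "det (?A (basis_vec c)) = cofactor (?A v) c ?l" if "c < n" for c
      using that unfolding lap[of "basis_vec c"]
      by (simp add: basis_vec_def if_distrib[of "\<lambda>x. x * _"] sum.delta cong: if_cong)
    then show ?thesis using True by (simp add: det_list_def lap[of v] del: append.simps append_Cons)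
  next
    case False
    then show ?thesis by (simp add: det_list_def)
  qed
qed

lemma qform_unit: "qform k (basis_vec c) = 0"
  unfolding qform_def basis_vec_def by (intro sum.neutral) (auto; presburger)

text \<open>The other isotropic basis vector of the same hyperbolic plane.\<close>

definition partner :: "nat \<Rightarrow> nat" where
  "partner c = (if even c then Suc c else c - 1)"

lemma bform_unit_left: "c < 2 * k \<Longrightarrow> bform k (basis_vec c) v = v (partner c)"
proof -
  assume c: "c < 2 * k"
  have "bform k (basis_vec c) v = (\<Sum>r<k. if r = c div 2 then v (partner c) else 0)"
    unfolding bform_def
  proof (intro sum.cong refl)
    fix r
    show "basis_vec c (2 * r) * v (2 * r + 1) + basis_vec c (2 * r + 1) * v (2 * r) = (if r = c div 2 then v (partner c) else 0)"
      by (cases "even c") (auto simp: basis_vec_def partner_def elim!: evenE oddE)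
  qed
  then show ?thesis using c by (simp add: sum.delta)
qed

lemma partner_partner [simp]: "partner (partner c) = c"
  by (auto simp: partner_def)

lemma partner_less: "c < 2 * k \<Longrightarrow> partner c < 2 * k"
  by (auto simp: partner_def elim!: evenE)

lemma partner_inj: "partner c = partner d \<longleftrightarrow> c = d"
  by (metis partner_partner)

lemma bform_unit: "c < 2 * k \<Longrightarrow> bform k (basis_vec c) (basis_vec d) = (if d = partner c then 1 else 0)"
  by (auto simp: bform_unit_left basis_vec_def)

lemma missing_partner:
  assumes "distinct cs" "set cs \<subseteq> {..<2 * k}" "length cs < 2 * k"
  obtains x where "x < 2 * k" "\<forall>c\<in>set cs. c \<noteq> partner x"
proof -
  have "card (set cs) < card {..<2 * k}" using assms by (simp add: distinct_card)
  then obtain y where "y < 2 * k" "y \<notin> set cs"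
    using assms(2) by (metis lessThan_iff psubset_card_mono finite_set less_irrefl subset_antisym subsetI)
  then show ?thesis using that[of "partner y"] by (metis partner_less partner_partner)
qed

text \<open>A word that omits a basis vector is orthogonal to the partner of this vector.\<close>

lemma supertrace_short:
  assumes "distinct cs" "set cs \<subseteq> {..<2 * k}" "length cs < 2 * k" "even (length cs) \<or> (2::'a::comm_ring_1) = 0"
  shows "supertrace k (map basis_vec cs) = (0::'a)"
proof -
  obtain x where x: "x < 2 * k" "\<forall>c\<in>set cs. c \<noteq> partner x"
    using missing_partner[OF assms(1-3)] .
  show ?thesis
    by (rule supertrace_perp[of k "basis_vec x" "basis_vec (partner x)"]) (use x assms(4) in \<open>auto simp: bform_unit\<close>)
qed

lemma det_list_canonical: "det_list n (map basis_vec [0..<n]) = (1 :: 'a::comm_ring_1)"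
proof -
  have "mat n n (\<lambda>(c, j). (map basis_vec [0..<n] ! j) c) = (1\<^sub>m n :: 'a mat)"
    by (rule eq_matI) (auto simp: basis_vec_def)
  then show ?thesis by (simp add: det_list_def)
qed

text \<open>Both sides satisfy the same Clifford relation, with the factor 2 for each removed pair, and both vanish on
short words of basis vectors and agree on the word that lists the basis.\<close>

lemma shuffle_sum_eq_supertrace:
  fixes vs :: "(nat \<Rightarrow> 'a::comm_ring_1) list"
  assumes hf: "2 * (hf :: 'a) = 1"
  shows "shuffle_sum (2 * k) (\<lambda>us ps. det_list (2 * k) us * pf_list (bform k) ps) vs = 2 ^ (length vs div 2) * hf ^ k * supertrace k vs"
proof -
  let ?G = "\<lambda>us ps. det_list (2 * k) us * pf_list (bform k) ps :: 'a"
  define F where "F vs = shuffle_sum (2 * k) ?G vs - 2 ^ (length vs div 2) * hf ^ k * supertrace k vs" for vs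
  have slotG: "slotwise (2 * k) (\<lambda>us. ?G us ps)" for ps
    unfolding slotwise_def
  proof (intro allI)
    fix as v bs
    show "?G (as @ [v] @ bs) ps = (\<Sum>c<2 * k. v c * ?G (as @ [basis_vec c] @ bs) ps)"
      unfolding slotwiseD[OF slotwise_det_list, of "2 * k" as v bs] by (simp add: sum_distrib_right sum_distrib_left mult_ac)
  qed
  have slotG': "slotwise (2 * k) (?G us)" for us
    unfolding slotwise_def
  proof (intro allI)
    fix as v bs
    show "?G us (as @ [v] @ bs) = (\<Sum>c<2 * k. v c * ?G us (as @ [basis_vec c] @ bs))"
      unfolding slotwiseD[OF slotwise_pf_list[OF hf], of k as v bs] by (simp add: sum_distrib_left mult_ac)
  qed
  have slot_sh: "slotwise (2 * k) (shuffle_sum (2 * k) ?G)"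
    by (rule shuffle_sum_slotwise[OF slotG slotG'])
  have slot: "slotwise (2 * k) F"
    unfolding slotwise_def
  proof (intro allI)
    fix as v bs
    show "F (as @ [v] @ bs) = (\<Sum>c<2 * k. v c * F (as @ [basis_vec c] @ bs))"
      using slotwiseD[OF slot_sh, of as v bs] slotwiseD[OF slotwise_supertrace, of k as v bs]
      by (simp add: F_def right_diff_distrib sum_subtractf sum_distrib_left mult_ac)
  qed
  have "shuffle_sum (2 * k) ?G (as @ [v, v] @ bs) = (2 * qform k v) * shuffle_sum (2 * k) ?G (as @ bs)" for as v bs
    using det_list_sq[of "2 * k" _ v] pf_list_sq[OF hf, of k _ v] by (intro shuffle_sum_sq) (simp_all add: mult_ac)
  moreover have "(length (as @ [v, v] @ bs)) div 2 = Suc (length (as @ bs) div 2)" for as bs and v :: "nat \<Rightarrow> 'a"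
    by simp
  ultimately have sq: "F (as @ [v, v] @ bs) = 2 * qform k v * F (as @ bs)" for as v bs
    unfolding F_def using supertrace_sq[of k as v bs] by (simp add: algebra_simps del: append_Cons)
  have "F vs = 0"
  proof (rule slotwise_zero[OF slot])
    fix cs :: "nat list" assume cs: "set cs \<subseteq> {..<2 * k}" "length cs = length vs"
    show "F (map basis_vec cs) = 0"
    proof (rule clifford_functional_zero[where n = "2 * k" and M = "length cs" and \<phi> = "\<lambda>cs. F (map basis_vec cs)"
          and \<kappa> = "\<lambda>c d. 2 * bform k (basis_vec c) (basis_vec d)"])
      fix as bs c
      show "F (map basis_vec (as @ [c, c] @ bs)) = 0"
        using sq[of "map basis_vec as" "basis_vec c" "map basis_vec bs"] by (simp add: qform_unit)
    next
      fix as bs c d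
      show "F (map basis_vec (as @ [c, d] @ bs)) + F (map basis_vec (as @ [d, c] @ bs)) =
          2 * bform k (basis_vec c) (basis_vec d) * F (map basis_vec (as @ bs))"
        using polarize[OF slot, of "map basis_vec as" "map basis_vec bs" 2 k, OF sq] by simp
    next
      fix ds :: "nat list"
      assume ds: "distinct ds" "set ds \<subseteq> {..<2 * k}" "length ds < 2 * k"
      have "supertrace k (map basis_vec ds) = (0::'a)"
        using supertrace_short[OF ds] supertrace_odd[OF hf, of "map basis_vec ds" k] by (cases "even (length ds)") auto
      then show "F (map basis_vec ds) = 0" using ds by (simp add: F_def shuffle_sum_short)
    next
      have "2 ^ k * hf ^ k = 1" by (rule half_power[OF hf])
      then show "F (map basis_vec [0..<2 * k]) = 0"
        using supertrace_canonical[of k, where 'a = 'a] by (simp add: F_def shuffle_sum_full det_list_canonical)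
    qed (use cs in auto)
  qed
  then show ?thesis by (simp add: F_def)
qed

section \<open>Permutations and expansions along the first entry\<close>

definition matchings :: "nat \<Rightarrow> (nat \<Rightarrow> nat) set" where
  "matchings l = {\<sigma>. \<sigma> permutes {..<2 * l} \<and> (\<forall>i<l. \<sigma> (2 * i) < \<sigma> (2 * i + 1)) \<and>
           (\<forall>j<l. \<forall>i<j. \<sigma> (2 * i) < \<sigma> (2 * j))}"

text \<open>The matching in which 0 is paired with \<open>j + 1\<close> and the other points are matched as \<open>\<sigma>\<close> prescribes.\<close>

definition cons_matching :: "nat \<times> (nat \<Rightarrow> nat) \<Rightarrow> nat \<Rightarrow> nat" where
  "cons_matching p = permutation_insert 0 0 (permutation_insert 0 (fst p) (snd p))"

lemma insert_index_less_iff: "insert_index j a < insert_index j b \<longleftrightarrow> a < b"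
  by (auto simp: insert_index_def)

lemma insert_index_inj: "insert_index j a = insert_index j b \<longleftrightarrow> a = b"
  by (auto simp: insert_index_def)

lemma permutation_insert_apply:
  "permutation_insert i j p x = (if x < i then insert_index j (p x) else if x = i then j else insert_index j (p (x - 1)))"
  by (simp add: permutation_insert_def insert_dom_def insert_ran_def)

lemma cons_matching_simps:
  "cons_matching (j, \<sigma>) 0 = 0" "cons_matching (j, \<sigma>) (Suc 0) = Suc j"
  "cons_matching (j, \<sigma>) (Suc (Suc i)) = Suc (insert_index j (\<sigma> i))"
  by (simp_all add: cons_matching_def permutation_insert_apply insert_index_def)

lemma cons_matching_permutes:
  assumes "\<sigma> permutes {..<n}" "j < Suc n"
  shows "cons_matching (j, \<sigma>) permutes {..<Suc (Suc n)}"
    and "sign (cons_matching (j, \<sigma>)) = (-1) ^ j * sign \<sigma>"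
proof -
  have p: "\<sigma> permutes {0..<n}" using assms(1) by (simp add: atLeast0LessThan)
  note q = permutation_insert_permutes[OF p, of 0 j]
  show "cons_matching (j, \<sigma>) permutes {..<Suc (Suc n)}"
    using permutation_insert_permutes[OF q, of 0 0] assms(2) by (simp add: cons_matching_def atLeast0LessThan)
  show "sign (cons_matching (j, \<sigma>)) = (-1) ^ j * sign \<sigma>"
    using signof_permutation_insert[OF q, of 0 0, where 'a = int]
      signof_permutation_insert[OF p, of 0 j, where 'a = int] assms(2)
    by (simp add: cons_matching_def)
qed

text \<open>The normal form puts the point 0 first, so a matching is determined by the partner of 0 and the rest.\<close>

lemma matchings_Suc: "matchings (Suc l) = cons_matching ` ({..<Suc (2 * l)} \<times> matchings l)"
proof (intro equalityI subsetI)
  fix \<sigma> assume "\<sigma> \<in> matchings (Suc l)"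
  then have \<sigma>: "\<sigma> permutes {..<Suc (Suc (2 * l))}"
    and pair: "\<And>i. i < Suc l \<Longrightarrow> \<sigma> (2 * i) < \<sigma> (2 * i + 1)"
    and ord: "\<And>i j. j < Suc l \<Longrightarrow> i < j \<Longrightarrow> \<sigma> (2 * i) < \<sigma> (2 * j)"
    by (auto simp: matchings_def)
  have "\<sigma> 0 = 0"
  proof -
    obtain i where i: "i < Suc (Suc (2 * l))" "\<sigma> i = 0"
      using permutes_image[OF \<sigma>] by (metis (no_types, lifting) imageE lessThan_iff zero_less_Suc)
    have "i = 0"
    proof (cases "even i")
      case True
      then obtain t where t: "i = 2 * t" ..
      show ?thesis using ord[of t 0] i t by (cases "t = 0") auto
    next
      case False
      then obtain t where t: "i = 2 * t + 1" ..
      show ?thesis using pair[of t] i t by auto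
    qed
    then show ?thesis using i by simp
  qed
  then obtain p where p: "p permutes {0..<Suc (2 * l)}" and \<sigma>p: "\<sigma> = permutation_insert 0 0 p"
    using permutation_fix[of 0 "Suc (2 * l)" 0] \<sigma> by (auto simp: atLeast0LessThan set_eq_iff)
  have j: "p 0 < Suc (2 * l)" using permutes_in_image[OF p, of 0] by simp
  obtain \<sigma>' where \<sigma>': "\<sigma>' permutes {0..<2 * l}" and pj: "p = permutation_insert 0 (p 0) \<sigma>'"
    using permutation_fix[of 0 "2 * l" "p 0"] p j by (auto simp: set_eq_iff)
  have eq: "\<sigma> = cons_matching (p 0, \<sigma>')"
    unfolding cons_matching_def fst_conv snd_conv pj[symmetric] by (rule \<sigma>p)
  have "\<sigma>' (2 * i) < \<sigma>' (2 * i + 1)" if "i < l" for i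
    using pair[of "Suc i"] that by (simp add: eq cons_matching_simps insert_index_less_iff)
  moreover have "\<sigma>' (2 * i) < \<sigma>' (2 * j)" if "j < l" "i < j" for i j
    using ord[of "Suc j" "Suc i"] that by (simp add: eq cons_matching_simps insert_index_less_iff)
  ultimately have "\<sigma>' \<in> matchings l"
    using \<sigma>' by (auto simp: matchings_def atLeast0LessThan)
  then show "\<sigma> \<in> cons_matching ` ({..<Suc (2 * l)} \<times> matchings l)"
    using eq j by auto
next
  fix \<sigma> assume "\<sigma> \<in> cons_matching ` ({..<Suc (2 * l)} \<times> matchings l)"
  then obtain j \<sigma>' where eq: "\<sigma> = cons_matching (j, \<sigma>')" and j: "j < Suc (2 * l)" and \<sigma>': "\<sigma>' \<in> matchings l"
    by auto
  have "\<sigma> permutes {..<2 * Suc l}"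
    using cons_matching_permutes(1)[of \<sigma>' "2 * l" j] \<sigma>' j eq by (simp add: matchings_def)
  moreover have "\<sigma> (2 * i) < \<sigma> (2 * i + 1)" if "i < Suc l" for i
    using that \<sigma>' by (cases i) (auto simp: matchings_def eq cons_matching_simps insert_index_less_iff)
  moreover have "\<sigma> (2 * i) < \<sigma> (2 * j)" if jl: "j < Suc l" and ij: "i < j" for i j
  proof -
    obtain j' where j': "j = Suc j'" using ij by (cases j) auto
    show ?thesis using jl ij \<sigma>' unfolding j'
      by (cases i) (auto simp: matchings_def eq cons_matching_simps insert_index_less_iff)
  qed
  ultimately show "\<sigma> \<in> matchings (Suc l)" by (simp add: matchings_def)
qed

lemma cons_matching_inj: "inj_on cons_matching (A \<times> B)"
proof (rule inj_onI)
  fix p q assume "p \<in> A \<times> B" "q \<in> A \<times> B" and eq: "cons_matching p = cons_matching q"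
  obtain j \<sigma> j' \<sigma>' where iso: "p = (j, \<sigma>)" "q = (j', \<sigma>')" by (metis surj_pair)
  have "j = j'" using fun_cong[OF eq, of "Suc 0"] by (simp add: iso cons_matching_simps)
  moreover have "\<sigma> i = \<sigma>' i" for i
    using fun_cong[OF eq, of "Suc (Suc i)"] \<open>j = j'\<close> by (simp add: iso cons_matching_simps insert_index_inj)
  ultimately show "p = q" by (auto simp: iso)
qed

lemma nth_take_drop:
  "i < length vs - 1 \<Longrightarrow> j < length vs \<Longrightarrow> (take j vs @ drop (Suc j) vs) ! i = vs ! insert_index j i"
  by (auto simp: nth_append insert_index_def min_def)

lemma pf_list_matchings:
  "length xs = 2 * l \<Longrightarrow>
    pf_list b xs = (\<Sum>\<sigma>\<in>matchings l. of_int (sign \<sigma>) * (\<Prod>i<l. b (xs ! \<sigma> (2 * i)) (xs ! \<sigma> (2 * i + 1))))"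
proof (induction l arbitrary: xs)
  case 0
  have "matchings 0 = {id}" by (auto simp: matchings_def)
  then show ?case using 0 by (simp add: sign_id)
next
  case (Suc l)
  obtain v vs where xs: "xs = v # vs" using Suc.prems by (cases xs) auto
  with Suc.prems have len: "length vs = Suc (2 * l)" by simp
  let ?t = "\<lambda>xs l \<sigma>. of_int (sign \<sigma>) * (\<Prod>i<l. b (xs ! \<sigma> (2 * i)) (xs ! \<sigma> (2 * i + 1)))"
  have "(\<Sum>\<sigma>\<in>matchings (Suc l). ?t xs (Suc l) \<sigma>) = (\<Sum>(j, \<sigma>)\<in>{..<Suc (2 * l)} \<times> matchings l. ?t xs (Suc l) (cons_matching (j, \<sigma>)))"
    unfolding matchings_Suc by (subst sum.reindex[OF cons_matching_inj]) (simp add: case_prod_unfold)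
  also have "\<dots> = (\<Sum>j<Suc (2 * l). \<Sum>\<sigma>\<in>matchings l. ?t xs (Suc l) (cons_matching (j, \<sigma>)))"
    by (rule sum.cartesian_product[symmetric])
  also have "\<dots> = (\<Sum>j<length vs. (-1) ^ j * b v (vs ! j) * (\<Sum>\<sigma>\<in>matchings l. ?t (take j vs @ drop (Suc j) vs) l \<sigma>))"
    unfolding len sum_distrib_left
  proof (intro sum.cong refl)
    fix j \<sigma> assume j: "j \<in> {..<Suc (2 * l)}" and \<sigma>: "\<sigma> \<in> matchings l"
    have sg: "sign (cons_matching (j, \<sigma>)) = (-1) ^ j * sign \<sigma>"
      using cons_matching_permutes(2)[of \<sigma> "2 * l" j] j \<sigma> by (simp add: matchings_def)
    have lt: "\<sigma> i < 2 * l" if "i < 2 * l" for i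
      using \<sigma> that permutes_in_image[of \<sigma> "{..<2 * l}" i] by (simp add: matchings_def)
    have nth: "xs ! cons_matching (j, \<sigma>) (Suc (Suc i)) = (take j vs @ drop (Suc j) vs) ! \<sigma> i" if "i < 2 * l" for i
      using nth_take_drop[of "\<sigma> i" vs j] lt[OF that] j len by (simp add: xs cons_matching_simps)
    have "(\<Prod>i<Suc l. b (xs ! cons_matching (j, \<sigma>) (2 * i)) (xs ! cons_matching (j, \<sigma>) (2 * i + 1)))
       = b v (vs ! j) * (\<Prod>i<l. b (xs ! cons_matching (j, \<sigma>) (Suc (Suc (2 * i)))) (xs ! cons_matching (j, \<sigma>) (Suc (Suc (2 * i + 1)))))"
      by (subst prod.lessThan_Suc_shift) (simp add: xs cons_matching_simps)
    also have "(\<Prod>i<l. b (xs ! cons_matching (j, \<sigma>) (Suc (Suc (2 * i)))) (xs ! cons_matching (j, \<sigma>) (Suc (Suc (2 * i + 1)))))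
       = (\<Prod>i<l. b ((take j vs @ drop (Suc j) vs) ! \<sigma> (2 * i)) ((take j vs @ drop (Suc j) vs) ! \<sigma> (2 * i + 1)))"
      by (intro prod.cong refl) (simp add: nth)
    finally show "?t xs (Suc l) (cons_matching (j, \<sigma>)) = (-1) ^ j * b v (vs ! j) * ?t (take j vs @ drop (Suc j) vs) l \<sigma>"
      unfolding sg by (simp add: mult_ac)
  qed
  also have "\<dots> = pf_list b xs"
    unfolding xs pf_list.simps using len by (intro sum.cong refl) (simp add: Suc.IH)
  finally show ?case by simp
qed

definition shuffle_perms :: "nat \<Rightarrow> nat \<Rightarrow> (nat \<Rightarrow> nat) set" where
  "shuffle_perms n m = {\<pi>. \<pi> permutes {..<m} \<and> strict_mono_on {..<n} \<pi> \<and> strict_mono_on {n..<m} \<pi>}"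

lemma strict_mono_permutes_id:
  assumes "\<pi> permutes {..<m}" "strict_mono_on {..<m} \<pi>"
  shows "\<pi> = (id :: nat \<Rightarrow> nat)"
proof -
  have ge: "i \<le> \<pi> i" if "i < m" for i
    using that
  proof (induction i)
    case (Suc i)
    then have "\<pi> i < \<pi> (Suc i)" using strict_mono_onD[OF assms(2), of i "Suc i"] by auto
    then show ?case using Suc by simp
  qed simp
  have "\<pi> i = i" if "i < m" for i
    using that
  proof (induction "m - i" arbitrary: i rule: less_induct)
    case less
    have "\<pi> i < m" using permutes_in_image[OF assms(1), of i] less.prems by simp
    moreover have "\<pi> (\<pi> i) = \<pi> i" if "i < \<pi> i"
      using less.hyps[of "\<pi> i"] that less.prems \<open>\<pi> i < m\<close> by auto
    ultimately show ?case using ge[OF less.prems] permutes_inj[OF assms(1)]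
      by (metis injD le_neq_implies_less)
  qed
  then show ?thesis using assms(1) by (auto simp: fun_eq_iff permutes_def)
qed

text \<open>A shuffle takes the value 0 at the first place of one of its two increasing blocks. This lemma and the next one
describe the two cases by deletion of this place.\<close>

lemma shuffles_first:
  "{\<pi> \<in> shuffle_perms (Suc n) (Suc m). \<pi> 0 = 0} = permutation_insert 0 0 ` shuffle_perms n m"
proof (intro equalityI subsetI)
  fix \<pi> assume "\<pi> \<in> {\<pi> \<in> shuffle_perms (Suc n) (Suc m). \<pi> 0 = 0}"
  then have \<pi>: "\<pi> permutes {0..<Suc m}" "\<pi> 0 = 0" "strict_mono_on {..<Suc n} \<pi>" "strict_mono_on {Suc n..<Suc m} \<pi>"
    by (auto simp: shuffle_perms_def atLeast0LessThan)
  obtain p where p: "p permutes {0..<m}" and eq: "\<pi> = permutation_insert 0 0 p"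
    using permutation_fix[of 0 m 0] \<pi>(1,2) by (auto simp: set_eq_iff)
  have ps: "\<pi> (Suc i) = Suc (p i)" for i by (simp add: eq permutation_insert_apply insert_index_def)
  have "strict_mono_on {..<n} p"
    using strict_mono_onD[OF \<pi>(3), of "Suc _" "Suc _"] by (auto simp: strict_mono_on_def ps)
  moreover have "strict_mono_on {n..<m} p"
    using strict_mono_onD[OF \<pi>(4), of "Suc _" "Suc _"] by (auto simp: strict_mono_on_def ps)
  ultimately show "\<pi> \<in> permutation_insert 0 0 ` shuffle_perms n m"
    using p eq by (auto simp: shuffle_perms_def atLeast0LessThan)
next
  fix \<pi> assume "\<pi> \<in> permutation_insert 0 0 ` shuffle_perms n m"
  then obtain p where p: "p permutes {0..<m}" "strict_mono_on {..<n} p" "strict_mono_on {n..<m} p"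
    and eq: "\<pi> = permutation_insert 0 0 p"
    by (auto simp: shuffle_perms_def atLeast0LessThan)
  have ps: "\<pi> i = (if i = 0 then 0 else Suc (p (i - 1)))" for i by (simp add: eq permutation_insert_apply insert_index_def)
  have "\<pi> permutes {0..<Suc m}" unfolding eq by (rule permutation_insert_permutes[OF p(1)]) auto
  moreover have "\<pi> a < \<pi> b" if "a < b" "b < Suc n" for a b
    using that strict_mono_onD[OF p(2), of "a - 1" "b - 1"] unfolding ps by (auto simp: ps)
  moreover have "\<pi> a < \<pi> b" if "a < b" "Suc n \<le> a" "b < Suc m" for a b
    using that strict_mono_onD[OF p(3), of "a - 1" "b - 1"] unfolding ps by (auto simp: ps)
  ultimately show "\<pi> \<in> {\<pi> \<in> shuffle_perms (Suc n) (Suc m). \<pi> 0 = 0}"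
    by (auto simp: shuffle_perms_def atLeast0LessThan strict_mono_on_def ps)
qed

lemma shuffles_second:
  assumes "n \<le> m"
  shows "{\<pi> \<in> shuffle_perms n (Suc m). \<pi> n = 0} = permutation_insert n 0 ` shuffle_perms n m"
proof (intro equalityI subsetI)
  fix \<pi> assume "\<pi> \<in> {\<pi> \<in> shuffle_perms n (Suc m). \<pi> n = 0}"
  then have \<pi>: "\<pi> permutes {0..<Suc m}" "\<pi> n = 0" "strict_mono_on {..<n} \<pi>" "strict_mono_on {n..<Suc m} \<pi>"
    by (auto simp: shuffle_perms_def atLeast0LessThan)
  obtain p where p: "p permutes {0..<m}" and eq: "\<pi> = permutation_insert n 0 p"
    using permutation_fix[of n m 0] \<pi>(1,2) assms by (auto simp: set_eq_iff)
  have ps: "\<pi> i = Suc (p i)" if "i < n" for i using that by (simp add: eq permutation_insert_apply insert_index_def)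
  have ps': "\<pi> (Suc i) = Suc (p i)" if "n \<le> i" for i using that by (simp add: eq permutation_insert_apply insert_index_def)
  have "p a < p b" if "a < b" "b < n" for a b
    using strict_mono_onD[OF \<pi>(3), of a b] that by (auto simp: ps)
  moreover have "p a < p b" if "a < b" "n \<le> a" "b < m" for a b
    using strict_mono_onD[OF \<pi>(4), of "Suc a" "Suc b"] that by (auto simp: ps')
  ultimately have "p \<in> shuffle_perms n m"
    using p by (auto simp: shuffle_perms_def atLeast0LessThan strict_mono_on_def)
  then show "\<pi> \<in> permutation_insert n 0 ` shuffle_perms n m"
    using eq by auto
next
  fix \<pi> assume "\<pi> \<in> permutation_insert n 0 ` shuffle_perms n m"
  then obtain p where p: "p permutes {0..<m}" "strict_mono_on {..<n} p" "strict_mono_on {n..<m} p"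
    and eq: "\<pi> = permutation_insert n 0 p"
    by (auto simp: shuffle_perms_def atLeast0LessThan)
  have ps: "\<pi> i = (if i < n then Suc (p i) else if i = n then 0 else Suc (p (i - 1)))" for i
    by (simp add: eq permutation_insert_apply insert_index_def)
  have "\<pi> permutes {0..<Suc m}" unfolding eq by (rule permutation_insert_permutes[OF p(1)]) (use assms in auto)
  moreover have "\<pi> a < \<pi> b" if "a < b" "b < n" for a b
    using that strict_mono_onD[OF p(2), of a b] by (auto simp: ps)
  moreover have "\<pi> a < \<pi> b" if "a < b" "n \<le> a" "b < Suc m" for a b
    using that strict_mono_onD[OF p(3), of "a - 1" "b - 1"] by (auto simp: ps)
  ultimately show "\<pi> \<in> {\<pi> \<in> shuffle_perms n (Suc m). \<pi> n = 0}"
    by (auto simp: shuffle_perms_def atLeast0LessThan strict_mono_on_def ps)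
qed

lemma permutation_insert_inj: "inj_on (permutation_insert i j) (A :: (nat \<Rightarrow> nat) set)"
proof (rule inj_onI)
  fix p q :: "nat \<Rightarrow> nat" assume eq: "permutation_insert i j p = permutation_insert i j q"
  show "p = q"
  proof
    fix x
    show "p x = q x"
      using fun_cong[OF eq, of x] fun_cong[OF eq, of "Suc x"]
      by (cases "x < i") (auto simp: permutation_insert_apply insert_index_inj)
  qed
qed

lemma shuffle_sum_shuffles:
  "n \<le> length xs \<Longrightarrow> shuffle_sum n G xs = (\<Sum>\<pi>\<in>shuffle_perms n (length xs).
     of_int (sign \<pi>) * G (map (\<lambda>i. xs ! \<pi> i) [0..<n]) (map (\<lambda>i. xs ! \<pi> i) [n..<length xs]))"
proof (induction xs arbitrary: n G)
  case Nil
  have "shuffle_perms 0 0 = {id}" by (auto simp: shuffle_perms_def strict_mono_on_def)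
  then show ?case using Nil by (simp add: sign_id)
next
  case (Cons x xs)
  let ?m = "length xs"
  let ?t = "\<lambda>n G xs \<pi>. of_int (sign \<pi>) * G (map (\<lambda>i. xs ! \<pi> i) [0..<n]) (map (\<lambda>i. xs ! \<pi> i) [n..<length xs])"
  show ?case
  proof (cases n)
    case 0
    have "shuffle_perms 0 (Suc ?m) = {id}"
      using strict_mono_permutes_id[of _ "Suc ?m"]
      by (auto simp: shuffle_perms_def atLeast0LessThan permutes_id strict_mono_on_def)
    moreover have "map (\<lambda>i. (x # xs) ! i) [0..<Suc ?m] = x # xs"
      using map_nth[of "x # xs"] by simp
    ultimately show ?thesis by (simp add: 0 sign_id del: upt_Suc)
  next
    case (Suc k)
    have fin: "finite (shuffle_perms a b)" for a b
      unfolding shuffle_perms_def by (rule finite_subset[OF _ finite_permutations[of "{..<b}"]]) auto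
    have dec: "\<pi> 0 = 0 \<or> \<pi> n = 0 \<and> n \<le> ?m" if "\<pi> \<in> shuffle_perms n (Suc ?m)" for \<pi>
    proof -
      from that have \<pi>: "\<pi> permutes {..<Suc ?m}" "strict_mono_on {..<n} \<pi>" "strict_mono_on {n..<Suc ?m} \<pi>"
        by (auto simp: shuffle_perms_def)
      obtain i where i: "i < Suc ?m" "\<pi> i = 0"
        using permutes_image[OF \<pi>(1)] by (metis (no_types, lifting) imageE lessThan_iff zero_less_Suc)
      show ?thesis
      proof (cases "i < n")
        case True
        then have "i = 0" using strict_mono_onD[OF \<pi>(2), of 0 i] i by (cases "i = 0") auto
        then show ?thesis using i by simp
      next
        case False
        then have "i = n" using strict_mono_onD[OF \<pi>(3), of n i] i by (cases "i = n") auto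
        then show ?thesis using i by simp
      qed
    qed
    have disj: "\<not> (\<pi> 0 = 0 \<and> \<pi> n = 0)" if "\<pi> \<in> shuffle_perms n (Suc ?m)" for \<pi>
    proof
      assume "\<pi> 0 = 0 \<and> \<pi> n = 0"
      moreover have "inj \<pi>" using that permutes_inj by (auto simp: shuffle_perms_def)
      ultimately have "n = 0" by (metis injD)
      then show False using Suc by simp
    qed
    let ?A = "{\<pi> \<in> shuffle_perms n (Suc ?m). \<pi> 0 = 0}" and ?B = "{\<pi> \<in> shuffle_perms n (Suc ?m). \<pi> n = 0 \<and> n \<le> ?m}"
    have "shuffle_perms n (Suc ?m) = ?A \<union> ?B" using dec by blast
    moreover have "?A \<inter> ?B = {}" using disj by blast
    moreover have "finite ?A" "finite ?B" using fin[of n "Suc ?m"] by auto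
    ultimately have "(\<Sum>\<pi>\<in>shuffle_perms n (Suc ?m). ?t n G (x # xs) \<pi>) = (\<Sum>\<pi>\<in>?A. ?t n G (x # xs) \<pi>) + (\<Sum>\<pi>\<in>?B. ?t n G (x # xs) \<pi>)"
      by (metis (no_types, lifting) sum.union_disjoint)
    also have "(\<Sum>\<pi>\<in>?A. ?t n G (x # xs) \<pi>) = shuffle_sum k (\<lambda>us. G (x # us)) xs"
    proof -
      have "(\<Sum>\<pi>\<in>?A. ?t n G (x # xs) \<pi>) = (\<Sum>p\<in>shuffle_perms k ?m. ?t n G (x # xs) (permutation_insert 0 0 p))"
        unfolding Suc shuffles_first by (subst sum.reindex[OF permutation_insert_inj]) simp
      also have "\<dots> = (\<Sum>p\<in>shuffle_perms k ?m. ?t k (\<lambda>us. G (x # us)) xs p)"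
      proof (intro sum.cong refl)
        fix p assume "p \<in> shuffle_perms k ?m"
        then have p: "p permutes {0..<?m}" by (simp add: shuffle_perms_def atLeast0LessThan)
        have sg: "sign (permutation_insert 0 0 p) = sign p"
          using signof_permutation_insert[OF p, of 0 0, where 'a = int] by simp
        have ps: "permutation_insert 0 0 p 0 = 0" "permutation_insert 0 0 p (Suc i) = Suc (p i)" for i
          by (simp_all add: permutation_insert_apply insert_index_def)
        have "map (\<lambda>i. (x # xs) ! permutation_insert 0 0 p i) [0..<n] = x # map (\<lambda>i. xs ! p i) [0..<k]"
          unfolding Suc upt_conv_Cons[OF zero_less_Suc] map_Suc_upt[symmetric] by (simp add: ps comp_def del: upt_Suc)
        moreover have "map (\<lambda>i. (x # xs) ! permutation_insert 0 0 p i) [n..<length (x # xs)] = map (\<lambda>i. xs ! p i) [k..<?m]"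
          unfolding Suc length_Cons map_Suc_upt[symmetric] by (simp add: ps comp_def del: upt_Suc)
        ultimately show "?t n G (x # xs) (permutation_insert 0 0 p) = ?t k (\<lambda>us. G (x # us)) xs p"
          unfolding sg by simp
      qed
      also have "\<dots> = shuffle_sum k (\<lambda>us. G (x # us)) xs"
        using Cons.prems Suc by (subst Cons.IH) auto
      finally show ?thesis .
    qed
    also have "(\<Sum>\<pi>\<in>?B. ?t n G (x # xs) \<pi>) = (-1) ^ n * shuffle_sum n (\<lambda>us ps. G us (x # ps)) xs"
    proof (cases "n \<le> ?m")
      case True
      have "(\<Sum>\<pi>\<in>?B. ?t n G (x # xs) \<pi>) = (\<Sum>\<pi>\<in>permutation_insert n 0 ` shuffle_perms n ?m. ?t n G (x # xs) \<pi>)"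
        using True shuffles_second[OF True] by (intro sum.cong) auto
      also have "\<dots> = (\<Sum>p\<in>shuffle_perms n ?m. ?t n G (x # xs) (permutation_insert n 0 p))"
        by (subst sum.reindex[OF permutation_insert_inj]) simp
      also have "\<dots> = (\<Sum>p\<in>shuffle_perms n ?m. (-1) ^ n * ?t n (\<lambda>us ps. G us (x # ps)) xs p)"
      proof (intro sum.cong refl)
        fix p assume "p \<in> shuffle_perms n ?m"
        then have p: "p permutes {0..<?m}" by (simp add: shuffle_perms_def atLeast0LessThan)
        have sg: "sign (permutation_insert n 0 p) = (-1) ^ n * sign p"
          using signof_permutation_insert[OF p, of n 0, where 'a = int] True by simp
        have ps: "i < n \<Longrightarrow> permutation_insert n 0 p i = Suc (p i)" "permutation_insert n 0 p n = 0"
          "n \<le> i \<Longrightarrow> permutation_insert n 0 p (Suc i) = Suc (p i)" for i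
          by (simp_all add: permutation_insert_apply insert_index_def)
        have e1: "map (\<lambda>i. (x # xs) ! permutation_insert n 0 p i) [0..<n] = map (\<lambda>i. xs ! p i) [0..<n]"
          by (simp add: ps)
        have e2: "map (\<lambda>i. (x # xs) ! permutation_insert n 0 p i) [n..<length (x # xs)] = x # map (\<lambda>i. xs ! p i) [n..<?m]"
        proof -
          have "n < length (x # xs)" using True by simp
          from upt_conv_Cons[OF this] show ?thesis
            unfolding length_Cons map_Suc_upt[symmetric] by (simp add: ps comp_def del: upt_Suc)
        qed
        show "?t n G (x # xs) (permutation_insert n 0 p) = (-1) ^ n * ?t n (\<lambda>us ps. G us (x # ps)) xs p"
          unfolding e1 e2 sg by (simp add: mult_ac)
      qed
      also have "\<dots> = (-1) ^ n * shuffle_sum n (\<lambda>us ps. G us (x # ps)) xs"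
        using True by (subst Cons.IH) (auto simp: sum_distrib_left)
      finally show ?thesis .
    next
      case False
      then show ?thesis by (simp add: shuffle_sum_short)
    qed
    finally show ?thesis by (simp add: Suc)
  qed
qed

section \<open>The polynomial as a half-spin trace\<close>

definition generic_vectors :: "nat \<Rightarrow> (nat \<Rightarrow> 'a::comm_ring_1 vpoly) list" where
  "generic_vectors m = map (\<lambda>i c. Var (i, c)) [0..<m]"

lemma length_generic_vectors [simp]: "length (generic_vectors m) = m" by (simp add: generic_vectors_def)

lemma nth_generic_vectors [simp]: "i < m \<Longrightarrow> generic_vectors m ! i = (\<lambda>c. Var (i, c))" by (simp add: generic_vectors_def)

lemma B_poly_bform: "B_poly (2 * k) i j = bform k (\<lambda>c. Var (i, c)) (\<lambda>c. Var (j, c))"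
  by (simp add: B_poly_def bform_def)

lemma Pf_poly_pf_list:
  assumes "even (length is)"
  shows "Pf_poly (2 * k) is = pf_list (bform k) (map (\<lambda>i c. Var (i, c)) is)"
proof -
  obtain l where l: "length is = 2 * l" using assms by (auto elim: evenE)
  let ?xs = "map (\<lambda>i c. Var (i, c)) is :: (nat \<Rightarrow> 'a vpoly) list"
  define A :: "'a vpoly mat" where "A = mat (length is) (length is) (\<lambda>(k', l).
     if k' < l then B_poly (2 * k) (is ! k') (is ! l)
     else if l < k' then - B_poly (2 * k) (is ! k') (is ! l) else 0)"
  have d: "dim_row A div 2 = l" by (simp add: A_def l)
  have "pfaffian A = (\<Sum>\<sigma>\<in>matchings l. of_int (sign \<sigma>) * (\<Prod>i<l. A $$ (\<sigma> (2 * i), \<sigma> (2 * i + 1))))"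
    unfolding pfaffian_def Let_def d matchings_def ..
  also have "\<dots> = (\<Sum>\<sigma>\<in>matchings l. of_int (sign \<sigma>) * (\<Prod>i<l. bform k (?xs ! \<sigma> (2 * i)) (?xs ! \<sigma> (2 * i + 1))))"
  proof (intro sum.cong refl arg_cong2[where f = "(*)"] prod.cong)
    fix \<sigma> i assume \<sigma>: "\<sigma> \<in> matchings l" and i: "i \<in> {..<l}"
    then have "\<sigma> (2 * i) < 2 * l" "\<sigma> (2 * i + 1) < 2 * l" "\<sigma> (2 * i) < \<sigma> (2 * i + 1)"
      using permutes_in_image[of \<sigma> "{..<2 * l}" "2 * i"] permutes_in_image[of \<sigma> "{..<2 * l}" "2 * i + 1"]
      by (auto simp: matchings_def)
    then show "A $$ (\<sigma> (2 * i), \<sigma> (2 * i + 1)) = bform k (?xs ! \<sigma> (2 * i)) (?xs ! \<sigma> (2 * i + 1))"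
      by (simp add: A_def l B_poly_bform)
  qed
  also have "\<dots> = pf_list (bform k) ?xs" using l by (subst pf_list_matchings) auto
  finally show ?thesis by (simp add: Pf_poly_def A_def)
qed

lemma D_poly_det_list: "length is = n \<Longrightarrow> D_poly n is = det_list n (map (\<lambda>i c. Var (i, c)) is)"
  unfolding D_poly_def det_list_def by (auto intro!: arg_cong[where f = det] eq_matI)

lemma Const_mult: "Const a * Const b = Const (a * b)"
  by (simp add: Const_def mult_single)

lemma Const_one: "Const 1 = 1"
  by (simp add: Const_def)

lemma Const_numeral: "Const (numeral w) = numeral w"
  by (simp add: Const_def)

lemma Const_power: "Const a ^ l = Const (a ^ l)"
  by (induction l) (simp_all add: Const_mult Const_one)

text \<open>The half-spin trace is half the difference of the full trace and the supertrace, and these are the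
Pfaffian and the shuffle sum up to the same power of 2.\<close>

lemma f_tilde_half_spin_trace:
  assumes "k \<le> l"
  shows "f_tilde (2 * k) (2 * l) = half_spin_trace k (generic_vectors (2 * l))"
proof -
  let ?n = "2 * k" and ?m = "2 * l" and ?V = "generic_vectors (2 * l) :: (nat \<Rightarrow> rat vpoly) list"
  define hf :: "rat vpoly" where "hf = Const (1 / 2)"
  have two: "(2 :: rat vpoly) = Const 2" by (simp add: Const_numeral)
  have hf: "2 * hf = 1" unfolding two hf_def Const_mult by (simp add: Const_one)
  have pf: "Pf_poly ?n [0..<?m] = pf_list (bform k) ?V"
    unfolding generic_vectors_def by (rule Pf_poly_pf_list) simp
  have "(\<Sum>\<pi> | \<pi> permutes {..<?m} \<and> strict_mono_on {..<?n} \<pi> \<and> strict_mono_on {?n..<?m} \<pi>.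
         of_int (sign \<pi>) * D_poly ?n (map \<pi> [0..<?n]) * Pf_poly ?n (map \<pi> [?n..<?m]))
     = (\<Sum>\<pi>\<in>shuffle_perms ?n (length ?V). of_int (sign \<pi>) *
        (det_list ?n (map (\<lambda>i. ?V ! \<pi> i) [0..<?n]) * pf_list (bform k) (map (\<lambda>i. ?V ! \<pi> i) [?n..<length ?V])))"
  proof (rule sum.cong)
    fix \<pi> assume "\<pi> \<in> shuffle_perms ?n (length ?V)"
    then have "\<pi> permutes {..<?m}" by (simp add: shuffle_perms_def)
    then have lt: "\<pi> i < ?m" if "i < ?m" for i using permutes_in_image[of \<pi> "{..<?m}" i] that by simp
    have "map (\<lambda>i. ?V ! \<pi> i) [0..<?n] = map (\<lambda>i c. Var (i, c)) (map \<pi> [0..<?n])"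
      using lt assms by simp
    moreover have "map (\<lambda>i. ?V ! \<pi> i) [?n..<?m] = map (\<lambda>i c. Var (i, c)) (map \<pi> [?n..<?m])"
      using lt assms by simp
    moreover have "even (length (map \<pi> [?n..<?m]))" using assms by simp
    ultimately show "of_int (sign \<pi>) * D_poly ?n (map \<pi> [0..<?n]) * Pf_poly ?n (map \<pi> [?n..<?m]) =
       of_int (sign \<pi>) * (det_list ?n (map (\<lambda>i. ?V ! \<pi> i) [0..<?n]) * pf_list (bform k) (map (\<lambda>i. ?V ! \<pi> i) [?n..<length ?V]))"
      by (simp only: length_generic_vectors D_poly_det_list[of "map \<pi> [0..<?n]" ?n] length_map length_upt Pf_poly_pf_list mult.assoc minus_nat.diff_0)
  qed (simp add: shuffle_perms_def)
  also have "\<dots> = shuffle_sum ?n (\<lambda>us ps. det_list ?n us * pf_list (bform k) ps) ?V"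
    using assms by (intro shuffle_sum_shuffles[symmetric]) simp
  also have "\<dots> = 2 ^ l * hf ^ k * supertrace k ?V"
    using shuffle_sum_eq_supertrace[OF hf, of k ?V] by simp
  finally have "f_tilde ?n ?m = Const (1 / 2 ^ (l - k + 1)) * (2 ^ l * hf ^ k * spin_trace k ?V - 2 ^ l * hf ^ k * supertrace k ?V)"
    using pf_list_eq[OF hf, of ?V k] by (simp add: f_tilde_def pf)
  also have "\<dots> = (Const (1 / 2 ^ (l - k + 1)) * 2 ^ l * hf ^ k * 2) * half_spin_trace k ?V"
    by (simp add: supertrace_def algebra_simps)
  also have "Const (1 / 2 ^ (l - k + 1)) * 2 ^ l * hf ^ k * 2 = Const ((1 / 2 ^ (l - k + 1)) * 2 ^ l * (1 / 2) ^ k * 2)"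
    unfolding hf_def two Const_power Const_mult ..
  also have "(1 / 2 ^ (l - k + 1)) * 2 ^ l * (1 / 2) ^ k * 2 = (1 :: rat)"
  proof -
    obtain d where "l = k + d" using assms le_Suc_ex by blast
    then show ?thesis by (simp add: power_add field_simps)
  qed
  finally show ?thesis by (simp add: Const_one)
qed

section \<open>Evaluation homomorphisms\<close>

definition monom_eval :: "('v \<Rightarrow> 'b::comm_ring_1) \<Rightarrow> ('v \<Rightarrow>\<^sub>0 nat) \<Rightarrow> 'b" where
  "monom_eval s t = (\<Prod>x\<in>Poly_Mapping.keys t. s x ^ Poly_Mapping.lookup t x)"

lemma monom_eval_superset:
  assumes "finite K" "Poly_Mapping.keys t \<subseteq> K"
  shows "monom_eval s t = (\<Prod>x\<in>K. s x ^ Poly_Mapping.lookup t x)"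
  unfolding monom_eval_def using assms
  by (intro prod.mono_neutral_left) (auto simp: in_keys_iff)

lemma monom_eval_add: "monom_eval s (t + u) = monom_eval s t * monom_eval s u"
proof -
  let ?K = "Poly_Mapping.keys t \<union> Poly_Mapping.keys u"
  have "Poly_Mapping.keys (t + u) \<subseteq> ?K" by (rule keys_add)
  then show ?thesis
    by (simp add: monom_eval_superset[of ?K] lookup_add power_add prod.distrib)
qed

lemma monom_eval_zero [simp]: "monom_eval s 0 = 1"
  by (simp add: monom_eval_def)

lemma poly_decomp: "p = (\<Sum>t\<in>Poly_Mapping.keys p. Poly_Mapping.single t (Poly_Mapping.lookup p t))"
proof (rule poly_mapping_eqI)
  fix k
  show "Poly_Mapping.lookup p k = Poly_Mapping.lookup (\<Sum>t\<in>Poly_Mapping.keys p. Poly_Mapping.single t (Poly_Mapping.lookup p t)) k"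
    by (auto simp: lookup_sum lookup_single when_def sum.delta in_keys_iff)
qed

lemma monom_eval_Var: "monom_eval Var t = Poly_Mapping.single t 1"
proof -
  have pw: "(Poly_Mapping.single w 1 :: ('v, 'b::comm_ring_1) mpoly) ^ j = Poly_Mapping.single (\<Sum>_<j. w) 1" for w j
    by (induction j) (simp_all add: mult_single add.commute)
  have sm: "(\<Sum>_<j. Poly_Mapping.single x 1) = Poly_Mapping.single x j" for j :: nat and x :: 'v
    by (induction j) (simp_all add: single_add[symmetric])
  have pr: "finite K \<Longrightarrow> (\<Prod>x\<in>K. Poly_Mapping.single (w x) 1 :: ('v, 'b::comm_ring_1) mpoly) = Poly_Mapping.single (\<Sum>x\<in>K. w x) 1" for K and w :: "'v \<Rightarrow> 'v \<Rightarrow>\<^sub>0 nat"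
    by (induction K rule: finite_induct) (simp_all add: mult_single)
  show ?thesis
    unfolding monom_eval_def Var_def pw sm by (simp add: pr poly_decomp[of t, symmetric])
qed

lemma single_Const: "Poly_Mapping.single t c = Const c * monom_eval Var t"
  by (simp add: monom_eval_Var Const_def mult_single)

context
  fixes h :: "'a::comm_ring_1 \<Rightarrow> 'b::comm_ring_1"
  assumes h: "comm_ring_hom h"
begin

interpretation h: comm_ring_hom h by (rule h)

lemma insertion_superset:
  assumes "finite X" "Poly_Mapping.keys p \<subseteq> X"
  shows "insertion h s p = (\<Sum>t\<in>X. h (Poly_Mapping.lookup p t) * monom_eval s t)"
  unfolding insertion_def monom_eval_def[symmetric] using assms
  by (intro sum.mono_neutral_left) (auto simp: in_keys_iff)

lemma insertion_single: "insertion h s (Poly_Mapping.single t c) = h c * monom_eval s t"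
  by (subst insertion_superset[of "{t}"]) auto

lemma insertion_add: "insertion h s (p + r) = insertion h s p + insertion h s r"
proof -
  let ?K = "Poly_Mapping.keys p \<union> Poly_Mapping.keys r"
  have "Poly_Mapping.keys (p + r) \<subseteq> ?K" by (rule keys_add)
  then show ?thesis
    by (simp add: insertion_superset[of ?K] lookup_add h.hom_add distrib_right sum.distrib)
qed

lemma insertion_zero: "insertion h s 0 = 0"
  by (simp add: insertion_def)

lemma insertion_sum: "insertion h s (\<Sum>x\<in>X. g x) = (\<Sum>x\<in>X. insertion h s (g x))"
  by (induction X rule: infinite_finite_induct) (simp_all add: insertion_zero insertion_add)

lemma insertion_mult: "insertion h s (p * r) = insertion h s p * insertion h s r"
proof -
  let ?P = "\<lambda>p t. Poly_Mapping.single t (Poly_Mapping.lookup p t)"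
  have "p * r = (\<Sum>t\<in>Poly_Mapping.keys p. ?P p t) * (\<Sum>u\<in>Poly_Mapping.keys r. ?P r u)"
    using poly_decomp[of p] poly_decomp[of r] by simp
  also have "\<dots> = (\<Sum>t\<in>Poly_Mapping.keys p. \<Sum>u\<in>Poly_Mapping.keys r. ?P p t * ?P r u)"
    by (rule sum_product)
  finally have "insertion h s (p * r) = (\<Sum>t\<in>Poly_Mapping.keys p. \<Sum>u\<in>Poly_Mapping.keys r. insertion h s (?P p t * ?P r u))"
    by (simp add: insertion_sum)
  also have "\<dots> = (\<Sum>t\<in>Poly_Mapping.keys p. \<Sum>u\<in>Poly_Mapping.keys r. insertion h s (?P p t) * insertion h s (?P r u))"
    by (intro sum.cong refl) (simp add: mult_single insertion_single monom_eval_add h.hom_mult mult_ac)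
  also have "\<dots> = insertion h s p * insertion h s r"
    by (simp add: insertion_sum[symmetric] sum_product[symmetric] poly_decomp[symmetric])
  finally show ?thesis .
qed

lemma insertion_Const: "insertion h s (Const c) = h c"
  unfolding Const_def by (simp add: insertion_single)

lemma insertion_hom: "comm_ring_hom (insertion h s)"
proof
  show "insertion h s 1 = 1"
    using insertion_Const[of s 1] by (simp add: Const_def)
qed (simp_all add: insertion_zero insertion_add insertion_mult)

lemma insertion_Var: "insertion h s (Var x) = s x"
  by (simp add: Var_def insertion_single monom_eval_def)

end

text \<open>A ring homomorphism on polynomials is determined by its values on constants and variables.\<close>

lemma hom_eq_insertion:
  assumes "comm_ring_hom \<phi>"
  shows "\<phi> p = insertion (\<lambda>c. \<phi> (Const c)) (\<lambda>x. \<phi> (Var x)) p"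
proof -
  interpret comm_ring_hom \<phi> by (rule assms)
  have "\<phi> p = (\<Sum>t\<in>Poly_Mapping.keys p. \<phi> (Const (Poly_Mapping.lookup p t) * monom_eval Var t))"
    by (subst poly_decomp[of p]) (simp add: hom_sum single_Const)
  then show ?thesis
    by (simp add: insertion_def monom_eval_def hom_mult hom_prod hom_power)
qed

lemma Const_hom: "comm_ring_hom Const"
  by (standard) (simp_all add: Const_def single_add mult_single)

lemma id_hom: "comm_ring_hom id"
  by standard simp_all

lemma map_of_int_hom: "(Poly_Mapping.map of_int p :: ('v, 'a::comm_ring_1) mpoly) = insertion (\<lambda>c. Const (of_int c)) Var p"
proof -
  have "(insertion (\<lambda>c. Const (of_int c)) Var p :: ('v, 'a) mpoly) = (\<Sum>t\<in>Poly_Mapping.keys p. Poly_Mapping.single t (of_int (Poly_Mapping.lookup p t)))"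
    unfolding insertion_def monom_eval_def[symmetric] single_Const[symmetric] ..
  also have "\<dots> = Poly_Mapping.map of_int p"
    by (rule poly_mapping_eqI) (auto simp: lookup_sum lookup_single when_def sum.delta in_keys_iff Poly_Mapping.map.rep_eq)
  finally show ?thesis by simp
qed

lemma of_int_Const_hom: "comm_ring_hom (\<lambda>c. Const (of_int c) :: ('v, 'a::comm_ring_1) mpoly)"
proof -
  interpret comm_ring_hom "Const :: 'a \<Rightarrow> ('v, 'a) mpoly" by (rule Const_hom)
  show ?thesis by standard (simp_all only: of_int_mult of_int_add of_int_1 of_int_0 hom_mult hom_add hom_one hom_zero)
qed

lemma map_of_int_half_spin_trace:
  "Poly_Mapping.map of_int (half_spin_trace k (map (\<lambda>i c. Var (i, c)) is)) = (half_spin_trace k (map (\<lambda>i c. Var (i, c)) is) :: 'a::comm_ring_1 vpoly)"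
proof -
  interpret comm_ring_hom "insertion (\<lambda>c. Const (of_int c)) Var :: int vpoly \<Rightarrow> 'a vpoly"
    by (rule insertion_hom[OF of_int_Const_hom])
  show ?thesis
    unfolding map_of_int_hom hom_half_spin_trace
    by (simp add: comp_def insertion_Var[OF of_int_Const_hom])
qed

section \<open>Multidegrees\<close>

definition multideg :: "nat \<Rightarrow> (nat \<times> nat \<Rightarrow>\<^sub>0 nat) \<Rightarrow> nat \<Rightarrow> nat" where
  "multideg n t i = (\<Sum>c<n. Poly_Mapping.lookup t (i, c))"

text \<open>The condition on coordinates is included so that a multidegree of 0 in some slot excludes all variables of this slot.\<close>

definition multihom :: "nat \<Rightarrow> (nat \<Rightarrow> nat) \<Rightarrow> 'a::comm_ring_1 vpoly set" where
  "multihom n d = {F. \<forall>t\<in>Poly_Mapping.keys F. Poly_Mapping.keys t \<subseteq> UNIV \<times> {..<n} \<and> multideg n t = d}"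

lemma multideg_add: "multideg n (t + u) = (\<lambda>i. multideg n t i + multideg n u i)"
  by (simp add: multideg_def lookup_add sum.distrib fun_eq_iff)

lemma multihom_zero [simp]: "0 \<in> multihom n d" by (simp add: multihom_def)

lemma multihom_add: "F \<in> multihom n d \<Longrightarrow> G \<in> multihom n d \<Longrightarrow> F + G \<in> multihom n d"
  using keys_add[of F G] by (auto simp: multihom_def)

lemma multihom_sum: "(\<And>x. x \<in> X \<Longrightarrow> g x \<in> multihom n d) \<Longrightarrow> (\<Sum>x\<in>X. g x) \<in> multihom n d"
  by (induction X rule: infinite_finite_induct) (simp_all add: multihom_add)

lemma multihom_mult:
  assumes "F \<in> multihom n d" "G \<in> multihom n e"
  shows "F * G \<in> multihom n (\<lambda>i. d i + e i)"
  unfolding multihom_def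
proof (intro CollectI ballI)
  fix w assume "w \<in> Poly_Mapping.keys (F * G)"
  then obtain t u where "w = t + u" "t \<in> Poly_Mapping.keys F" "u \<in> Poly_Mapping.keys G"
    using keys_mult[of F G] by blast
  moreover from this have "Poly_Mapping.keys t \<subseteq> UNIV \<times> {..<n}" "Poly_Mapping.keys u \<subseteq> UNIV \<times> {..<n}"
      "multideg n t = d" "multideg n u = e"
    using assms by (auto simp: multihom_def)
  ultimately show "Poly_Mapping.keys w \<subseteq> UNIV \<times> {..<n} \<and> multideg n w = (\<lambda>i. d i + e i)"
    using keys_add[of t u] by (intro conjI) (blast, simp add: multideg_add)
qed

lemma multihom_Const [simp]: "Const c \<in> multihom n (\<lambda>_. 0)"
  by (auto simp: multihom_def Const_def multideg_def)

lemma multihom_one [simp]: "1 \<in> multihom n (\<lambda>_. 0)"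
  using multihom_Const[of 1 n] by (simp add: Const_def)

lemma multihom_Var: "c < n \<Longrightarrow> Var (i, c) \<in> multihom n (\<lambda>j. if j = i then 1 else 0)"
  by (auto simp: multihom_def Var_def multideg_def lookup_single when_def fun_eq_iff)

lemma multihom_power: "F \<in> multihom n d \<Longrightarrow> F ^ j \<in> multihom n (\<lambda>i. j * d i)"
proof (induction j)
  case (Suc j)
  then show ?case using multihom_mult[of F n d "F ^ j"] by simp
qed simp

lemma multihom_prod: "finite X \<Longrightarrow> (\<And>x. x \<in> X \<Longrightarrow> g x \<in> multihom n (d x)) \<Longrightarrow> (\<Prod>x\<in>X. g x) \<in> multihom n (\<lambda>i. \<Sum>x\<in>X. d x i)"
  by (induction X rule: finite_induct) (auto intro: multihom_mult)

lemma vpoly_ringI: "F \<in> multihom n d \<Longrightarrow> (\<And>i. i \<ge> m \<Longrightarrow> d i = 0) \<Longrightarrow> F \<in> vpoly_ring n m"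
proof -
  assume F: "F \<in> multihom n d" and d: "\<And>i. i \<ge> m \<Longrightarrow> d i = 0"
  have "i < m \<and> c < n" if t: "t \<in> Poly_Mapping.keys F" and x: "(i, c) \<in> Poly_Mapping.keys t" for t i c
  proof -
    from F t have k: "Poly_Mapping.keys t \<subseteq> UNIV \<times> {..<n}" "multideg n t = d" by (auto simp: multihom_def)
    then have c: "c < n" using x by auto
    have "Poly_Mapping.lookup t (i, c) \<le> multideg n t i"
      unfolding multideg_def using c by (intro member_le_sum) auto
    then have "d i \<noteq> 0" using k x by (auto simp: in_keys_iff)
    then have "i < m" using d[of i] by (meson not_le)
    with c show ?thesis by simp
  qed
  then show ?thesis unfolding vpoly_ring_def mvars_def by auto
qed

lemma vpoly_ring_keys: "F \<in> vpoly_ring n m \<Longrightarrow> t \<in> Poly_Mapping.keys F \<Longrightarrow> Poly_Mapping.keys t \<subseteq> {..<m} \<times> {..<n}"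
  unfolding vpoly_ring_def mvars_def by blast

definition component :: "nat \<Rightarrow> (nat \<Rightarrow> nat) \<Rightarrow> 'a::comm_ring_1 vpoly \<Rightarrow> 'a vpoly" where
  "component n d F = (\<Sum>t\<in>{t\<in>Poly_Mapping.keys F. multideg n t = d}. Poly_Mapping.single t (Poly_Mapping.lookup F t))"

lemma lookup_component: "Poly_Mapping.lookup (component n d F) t = (if multideg n t = d then Poly_Mapping.lookup F t else 0)"
  by (auto simp: component_def lookup_sum lookup_single when_def sum.delta in_keys_iff)

lemma keys_component: "Poly_Mapping.keys (component n d F) = {t\<in>Poly_Mapping.keys F. multideg n t = d}"
  by (auto simp: in_keys_iff lookup_component split: if_splits)

lemma component_add: "component n d (F + G) = component n d F + component n d G"
  by (rule poly_mapping_eqI) (simp add: lookup_component lookup_add)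

lemma component_zero [simp]: "component n d 0 = 0"
  by (rule poly_mapping_eqI) (simp add: lookup_component)

lemma component_sum: "component n d (\<Sum>x\<in>X. g x) = (\<Sum>x\<in>X. component n d (g x))"
  by (induction X rule: infinite_finite_induct) (simp_all add: component_add)

lemma component_multihom: "F \<in> multihom n e \<Longrightarrow> component n d F = (if e = d then F else 0)"
  by (rule poly_mapping_eqI) (auto simp: lookup_component multihom_def in_keys_iff)

lemma component_single: "component n d (Poly_Mapping.single t c) = (if multideg n t = d then Poly_Mapping.single t c else 0)"
  by (rule poly_mapping_eqI) (auto simp: lookup_component lookup_single when_def)

lemma component_vpoly_ring: "F \<in> vpoly_ring n m \<Longrightarrow> component n d F \<in> vpoly_ring n m"
  unfolding vpoly_ring_def mvars_def by (auto simp: keys_component)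

lemma act_hom: "comm_ring_hom (act n g)"
  unfolding act_def by (rule insertion_hom[OF Const_hom])

lemma lookup_less:
  assumes "Poly_Mapping.keys t \<subseteq> UNIV \<times> {..<n}" "Poly_Mapping.lookup t (i, c) \<noteq> 0"
  shows "c < n"
proof -
  have "(i, c) \<in> Poly_Mapping.keys t" using assms(2) by (simp add: in_keys_iff)
  then show ?thesis using assms(1) by blast
qed

lemma multideg_keys:
  assumes "Poly_Mapping.keys t \<subseteq> UNIV \<times> {..<n}"
  shows "multideg n t = (\<lambda>i. \<Sum>x\<in>Poly_Mapping.keys t. Poly_Mapping.lookup t x * (if i = fst x then 1 else 0))"
proof
  fix i
  have "multideg n t i = (\<Sum>x\<in>(\<lambda>c. (i, c)) ` {..<n}. Poly_Mapping.lookup t x)"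
    unfolding multideg_def by (subst sum.reindex) (auto simp: inj_on_def)
  also have "\<dots> = (\<Sum>x\<in>{x\<in>Poly_Mapping.keys t. fst x = i}. Poly_Mapping.lookup t x)"
    using lookup_less[OF assms] by (intro sum.mono_neutral_right) (auto simp: in_keys_iff)
  also have "\<dots> = (\<Sum>x\<in>Poly_Mapping.keys t. if fst x = i then Poly_Mapping.lookup t x else 0)"
    by (rule sum.inter_filter) simp
  finally show "multideg n t i = (\<Sum>x\<in>Poly_Mapping.keys t. Poly_Mapping.lookup t x * (if i = fst x then 1 else 0))"
    by (simp add: if_distrib eq_commute cong: if_cong)
qed

lemma act_single_multihom:
  assumes "Poly_Mapping.keys t \<subseteq> UNIV \<times> {..<n}"
  shows "act n g (Poly_Mapping.single t c) \<in> multihom n (multideg n t)"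
proof -
  let ?s = "\<lambda>(i, c). \<Sum>d<n. Const (g $$ (c, d)) * Var (i, d) :: 'a vpoly"
  have "?s x \<in> multihom n (\<lambda>j. if j = fst x then 1 else 0)" for x
  proof -
    have "Const (g $$ (snd x, d)) * Var (fst x, d) \<in> multihom n (\<lambda>j. if j = fst x then 1 else 0)" if "d < n" for d
      using multihom_mult[OF multihom_Const multihom_Var[OF that], of "g $$ (snd x, d)" "fst x"] by simp
    then show ?thesis by (cases x) (auto intro: multihom_sum)
  qed
  then have "monom_eval ?s t \<in> multihom n (\<lambda>i. \<Sum>x\<in>Poly_Mapping.keys t. Poly_Mapping.lookup t x * (if i = fst x then 1 else 0))"
    unfolding monom_eval_def by (intro multihom_prod multihom_power) auto
  then have "Const c * monom_eval ?s t \<in> multihom n (multideg n t)"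
    using multihom_mult[OF multihom_Const, of "monom_eval ?s t" n _ c] unfolding multideg_keys[OF assms] by simp
  then show ?thesis unfolding act_def insertion_single[OF Const_hom] .
qed

lemma component_act:
  assumes "F \<in> vpoly_ring n m"
  shows "component n d (act n g F) = act n g (component n d F)"
proof -
  interpret a: comm_ring_hom "act n g" by (rule act_hom)
  let ?s = "\<lambda>t. Poly_Mapping.single t (Poly_Mapping.lookup F t)"
  have "component n d (act n g F) = (\<Sum>t\<in>Poly_Mapping.keys F. component n d (act n g (?s t)))"
    by (subst poly_decomp[of F]) (simp add: a.hom_sum component_sum)
  also have "\<dots> = (\<Sum>t\<in>Poly_Mapping.keys F. if multideg n t = d then act n g (?s t) else 0)"
  proof (intro sum.cong refl component_multihom act_single_multihom)
    fix t assume "t \<in> Poly_Mapping.keys F"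
    then show "Poly_Mapping.keys t \<subseteq> UNIV \<times> {..<n}" using vpoly_ring_keys[OF assms] by blast
  qed
  also have "\<dots> = (\<Sum>t\<in>{t\<in>Poly_Mapping.keys F. multideg n t = d}. act n g (?s t))"
    by (rule sum.inter_filter[symmetric]) simp
  also have "\<dots> = act n g (component n d F)"
    by (simp add: component_def a.hom_sum)
  finally show ?thesis .
qed

text \<open>The group acts on all vectors simultaneously and linearly, so it preserves multidegrees.\<close>

lemma component_invariant: "F \<in> invariants n m G \<Longrightarrow> component n d F \<in> invariants n m G"
  by (auto simp: invariants_def component_vpoly_ring component_act[symmetric])

definition unit_deg :: "nat set \<Rightarrow> nat \<Rightarrow> nat" where "unit_deg S i = (if i \<in> S then 1 else 0)"

text \<open>Two multidegrees add up to the indicator of \<open>M\<close> only if they are indicators of complementary subsets.\<close>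

lemma component_mult:
  assumes "finite M"
  shows "component n (unit_deg M) (F * G) = (\<Sum>S\<in>Pow M. component n (unit_deg S) F * component n (unit_deg (M - S)) G)"
proof -
  let ?P = "\<lambda>p t. Poly_Mapping.single t (Poly_Mapping.lookup p t)"
  let ?kF = "Poly_Mapping.keys F" and ?kG = "Poly_Mapping.keys G"
  have split: "(if multideg n (t + u) = unit_deg M then x else 0) =
      (\<Sum>S\<in>Pow M. if multideg n t = unit_deg S \<and> multideg n u = unit_deg (M - S) then x else 0)" for t u and x :: "'a vpoly"
  proof (cases "multideg n (t + u) = unit_deg M")
    case True
    define S where "S = {i. multideg n t i = 1}"
    have sum: "multideg n t i + multideg n u i = unit_deg M i" for i using True by (metis multideg_add)
    have t: "multideg n t = unit_deg S"
    proof
      fix i show "multideg n t i = unit_deg S i" using sum[of i] by (auto simp: unit_deg_def S_def split: if_splits)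
    qed
    have SM: "S \<subseteq> M"
    proof
      fix i assume "i \<in> S" then show "i \<in> M" using sum[of i] by (auto simp: S_def unit_deg_def split: if_splits)
    qed
    have u: "multideg n u = unit_deg (M - S)"
    proof
      fix i show "multideg n u i = unit_deg (M - S) i" using sum[of i] SM unfolding t by (auto simp: unit_deg_def split: if_splits)
    qed
    have inj: "unit_deg S = unit_deg S' \<longleftrightarrow> S = S'" for S' by (auto simp: unit_deg_def fun_eq_iff split: if_splits)
    have "(\<Sum>S'\<in>Pow M. if multideg n t = unit_deg S' \<and> multideg n u = unit_deg (M - S') then x else 0) = (\<Sum>S'\<in>Pow M. if S' = S then x else 0)"
      using t u inj by (intro sum.cong) auto
    also have "\<dots> = x" using SM assms by (simp add: sum.delta)
    finally show ?thesis using True by simp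
  next
    case False
    have "\<not> (multideg n t = unit_deg S \<and> multideg n u = unit_deg (M - S))" if "S \<in> Pow M" for S
    proof
      assume "multideg n t = unit_deg S \<and> multideg n u = unit_deg (M - S)"
      then have "multideg n (t + u) = unit_deg M" using that by (auto simp: multideg_add unit_deg_def fun_eq_iff)
      then show False using False by simp
    qed
    then have "(\<Sum>S\<in>Pow M. if multideg n t = unit_deg S \<and> multideg n u = unit_deg (M - S) then x else 0) = 0"
      by (intro sum.neutral) auto
    then show ?thesis using False by simp
  qed
  have "F * G = (\<Sum>t\<in>?kF. ?P F t) * (\<Sum>u\<in>?kG. ?P G u)"
    using poly_decomp[of F] poly_decomp[of G] by simp
  also have "\<dots> = (\<Sum>t\<in>?kF. \<Sum>u\<in>?kG. ?P F t * ?P G u)"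
    by (rule sum_product)
  finally have "component n (unit_deg M) (F * G) = (\<Sum>t\<in>?kF. \<Sum>u\<in>?kG. component n (unit_deg M) (?P F t * ?P G u))"
    by (simp add: component_sum)
  also have "\<dots> = (\<Sum>t\<in>?kF. \<Sum>u\<in>?kG. if multideg n (t + u) = unit_deg M then ?P F t * ?P G u else 0)"
    by (intro sum.cong refl) (simp add: mult_single component_single)
  also have "\<dots> = (\<Sum>t\<in>?kF. \<Sum>u\<in>?kG. \<Sum>S\<in>Pow M. if multideg n t = unit_deg S \<and> multideg n u = unit_deg (M - S) then ?P F t * ?P G u else 0)"
    unfolding split ..
  also have "\<dots> = (\<Sum>t\<in>?kF. \<Sum>S\<in>Pow M. \<Sum>u\<in>?kG. if multideg n t = unit_deg S \<and> multideg n u = unit_deg (M - S) then ?P F t * ?P G u else 0)"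
    by (intro sum.cong refl sum.swap)
  also have "\<dots> = (\<Sum>S\<in>Pow M. \<Sum>t\<in>?kF. \<Sum>u\<in>?kG. if multideg n t = unit_deg S \<and> multideg n u = unit_deg (M - S) then ?P F t * ?P G u else 0)"
    by (rule sum.swap)
  also have "\<dots> = (\<Sum>S\<in>Pow M. \<Sum>t\<in>?kF. \<Sum>u\<in>?kG. component n (unit_deg S) (?P F t) * component n (unit_deg (M - S)) (?P G u))"
    by (intro sum.cong refl) (simp add: component_single)
  also have "\<dots> = (\<Sum>S\<in>Pow M. component n (unit_deg S) F * component n (unit_deg (M - S)) G)"
    by (simp only: sum_product[symmetric] component_sum[symmetric] poly_decomp[symmetric])
  finally show ?thesis .
qed

section \<open>Multilinear components as functions\<close>

definition eval_at :: "(nat \<Rightarrow> nat \<Rightarrow> 'a) \<Rightarrow> 'a::comm_ring_1 vpoly \<Rightarrow> 'a" where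
  "eval_at v = insertion id (\<lambda>(i, c). v i c)"

text \<open>A function of tuples of vectors that is linear in the slots from \<open>S\<close> and does not depend on the other slots.\<close>

definition multilin :: "nat \<Rightarrow> nat set \<Rightarrow> ((nat \<Rightarrow> nat \<Rightarrow> 'a::comm_ring_1) \<Rightarrow> 'a) \<Rightarrow> bool" where
  "multilin n S \<beta> \<longleftrightarrow>
     (\<forall>v w. (\<forall>i\<in>S. \<forall>c<n. v i c = w i c) \<longrightarrow> \<beta> v = \<beta> w) \<and>
     (\<forall>i\<in>S. \<forall>v a b. \<beta> (v(i := \<lambda>c. a c + b c)) = \<beta> (v(i := a)) + \<beta> (v(i := b))) \<and>
     (\<forall>i\<in>S. \<forall>v a s. \<beta> (v(i := \<lambda>c. s * a c)) = s * \<beta> (v(i := a)))"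

lemma monom_eval_slot:
  assumes "Poly_Mapping.keys t \<subseteq> UNIV \<times> {..<n}" "multideg n t i = 1"
  obtains c R where "\<And>v a. monom_eval (\<lambda>(j, c). (v(i := a)) j c) t = a c * (R v :: 'a::comm_ring_1)"
proof -
  obtain c0 where c0: "c0 < n" "Poly_Mapping.lookup t (i, c0) = 1"
      "\<And>b. b < n \<Longrightarrow> b \<noteq> c0 \<Longrightarrow> Poly_Mapping.lookup t (i, b) = 0"
    using assms(2) unfolding multideg_def by (subst (asm) sum_eq_1_iff) auto
  let ?K = "{x\<in>Poly_Mapping.keys t. fst x \<noteq> i}"
  have K: "Poly_Mapping.keys t = insert (i, c0) ?K"
  proof (intro equalityI subsetI)
    fix x assume x: "x \<in> Poly_Mapping.keys t"
    show "x \<in> insert (i, c0) ?K"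
    proof (cases "fst x = i")
      case True
      then have nz: "Poly_Mapping.lookup t (i, snd x) \<noteq> 0" using x by (auto simp: in_keys_iff)
      then have "snd x < n" by (rule lookup_less[OF assms(1)])
      then have "snd x = c0" using c0(3)[of "snd x"] nz by (cases "snd x = c0") simp_all
      then show ?thesis using True by (metis insertI1 prod.collapse)
    qed (use x in simp)
  qed (use c0 in \<open>auto simp: in_keys_iff\<close>)
  have "monom_eval (\<lambda>(j, c). (v(i := a)) j c) t = a c0 * (\<Prod>x\<in>?K. v (fst x) (snd x) ^ Poly_Mapping.lookup t x)" for v :: "nat \<Rightarrow> nat \<Rightarrow> 'a" and a
  proof -
    have "monom_eval (\<lambda>(j, c). (v(i := a)) j c) t = a c0 * (\<Prod>x\<in>?K. (\<lambda>(j, c). (v(i := a)) j c) x ^ Poly_Mapping.lookup t x)"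
      unfolding monom_eval_def by (subst K, subst prod.insert) (auto simp: c0)
    also have "(\<Prod>x\<in>?K. (\<lambda>(j, c). (v(i := a)) j c) x ^ Poly_Mapping.lookup t x) = (\<Prod>x\<in>?K. v (fst x) (snd x) ^ Poly_Mapping.lookup t x)"
      by (intro prod.cong refl) (auto split: prod.splits)
    finally show ?thesis .
  qed
  then show ?thesis by (rule that)
qed

lemma multilin_component:
  assumes F: "F \<in> vpoly_ring n m"
  shows "multilin n S (\<lambda>v. eval_at v (component n (unit_deg S) F))"
proof -
  let ?C = "component n (unit_deg S) F"
  have eval_at: "eval_at v ?C = (\<Sum>t\<in>Poly_Mapping.keys ?C. Poly_Mapping.lookup ?C t * monom_eval (\<lambda>(j, c). v j c) t)" for v
    by (simp add: eval_at_def insertion_def monom_eval_def)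
  have t: "Poly_Mapping.keys t \<subseteq> UNIV \<times> {..<n}" "multideg n t = unit_deg S" if "t \<in> Poly_Mapping.keys ?C" for t
    using that vpoly_ring_keys[OF F, of t] by (auto simp: keys_component)
  have slot: "\<exists>c R. \<forall>v a. monom_eval (\<lambda>(j, c). (v(i := a)) j c) t = a c * (R v :: 'a)"
    if "t \<in> Poly_Mapping.keys ?C" "i \<in> S" for t i
    using monom_eval_slot[OF t(1)[OF that(1)], of i, where 'a = 'a] t(2)[OF that(1)] that(2) by (metis unit_deg_def)
  show ?thesis
    unfolding multilin_def
  proof (intro conjI allI ballI impI)
    fix v w :: "nat \<Rightarrow> nat \<Rightarrow> 'a" assume vw: "\<forall>i\<in>S. \<forall>c<n. v i c = w i c"
    show "eval_at v ?C = eval_at w ?C"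
      unfolding eval_at
    proof (intro sum.cong refl arg_cong2[where f = "(*)"])
      fix u assume u: "u \<in> Poly_Mapping.keys ?C"
      show "monom_eval (\<lambda>(j, c). v j c) u = monom_eval (\<lambda>(j, c). w j c) u"
        unfolding monom_eval_def
      proof (intro prod.cong refl)
        fix x assume x: "x \<in> Poly_Mapping.keys u"
        then have c: "snd x < n" using t(1)[OF u] by auto
        have "Poly_Mapping.lookup u (fst x, snd x) \<le> multideg n u (fst x)"
          unfolding multideg_def using c by (intro member_le_sum) auto
        then have "multideg n u (fst x) \<noteq> 0" using x by (auto simp: in_keys_iff)
        then have "fst x \<in> S" unfolding t(2)[OF u] by (auto simp: unit_deg_def split: if_splits)
        then show "(\<lambda>(j, c). v j c) x ^ Poly_Mapping.lookup u x = (\<lambda>(j, c). w j c) x ^ Poly_Mapping.lookup u x"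
          using vw c by (cases x) auto
      qed
    qed
  next
    fix i and v :: "nat \<Rightarrow> nat \<Rightarrow> 'a" and a b assume i: "i \<in> S"
    show "eval_at (v(i := \<lambda>c. a c + b c)) ?C = eval_at (v(i := a)) ?C + eval_at (v(i := b)) ?C"
      unfolding eval_at sum.distrib[symmetric]
    proof (intro sum.cong refl)
      fix u assume "u \<in> Poly_Mapping.keys ?C"
      from slot[OF this i] obtain c R where R: "\<And>v a. monom_eval (\<lambda>(j, c). (v(i := a)) j c) u = a c * (R v :: 'a)" by blast
      show "Poly_Mapping.lookup ?C u * monom_eval (\<lambda>(j, c). (v(i := \<lambda>c. a c + b c)) j c) u =
         Poly_Mapping.lookup ?C u * monom_eval (\<lambda>(j, c). (v(i := a)) j c) u + Poly_Mapping.lookup ?C u * monom_eval (\<lambda>(j, c). (v(i := b)) j c) u"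
        unfolding R by (simp add: algebra_simps)
    qed
  next
    fix i and v :: "nat \<Rightarrow> nat \<Rightarrow> 'a" and a s assume i: "i \<in> S"
    show "eval_at (v(i := \<lambda>c. s * a c)) ?C = s * eval_at (v(i := a)) ?C"
      unfolding eval_at sum_distrib_left
    proof (intro sum.cong refl)
      fix u assume "u \<in> Poly_Mapping.keys ?C"
      from slot[OF this i] obtain c R where R: "\<And>v a. monom_eval (\<lambda>(j, c). (v(i := a)) j c) u = a c * (R v :: 'a)" by blast
      show "Poly_Mapping.lookup ?C u * monom_eval (\<lambda>(j, c). (v(i := \<lambda>c. s * a c)) j c) u =
         s * (Poly_Mapping.lookup ?C u * monom_eval (\<lambda>(j, c). (v(i := a)) j c) u)"
        unfolding R by (simp add: algebra_simps)
    qed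
  qed
qed

lemma eval_at_act: "eval_at v (act n g F) = eval_at (\<lambda>i c. \<Sum>d<n. g $$ (c, d) * v i d) F"
proof -
  interpret e: comm_ring_hom "eval_at v" unfolding eval_at_def by (rule insertion_hom[OF id_hom])
  interpret a: comm_ring_hom "act n g" by (rule act_hom)
  have "comm_ring_hom (\<lambda>F. eval_at v (act n g F))"
    by standard (simp_all add: e.hom_add e.hom_mult a.hom_add a.hom_mult)
  from hom_eq_insertion[OF this, of F]
  have "eval_at v (act n g F) = insertion (\<lambda>c. c) (\<lambda>x. \<Sum>d<n. g $$ (snd x, d) * v (fst x) d) F"
    by (simp add: act_def insertion_Const[OF Const_hom] insertion_Var[OF Const_hom] e.hom_sum e.hom_mult
      case_prod_unfold) (simp add: eval_at_def insertion_Const[OF id_hom] insertion_Var[OF id_hom])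
  then show ?thesis unfolding eval_at_def id_def case_prod_unfold .
qed

section \<open>Isometries acting on spin traces in characteristic 2\<close>

lemma sum_square_split:
  fixes f :: "nat \<Rightarrow> nat \<Rightarrow> 'a::comm_ring_1"
  shows "(\<Sum>c<N. \<Sum>d<N. f c d) = (\<Sum>c<N. f c c) + (\<Sum>c<N. \<Sum>d<c. f c d + f d c)"
  by (induction N) (simp_all add: sum.distrib algebra_simps)

lemma sum_symmetric_char2:
  fixes f :: "nat \<Rightarrow> nat \<Rightarrow> 'a::comm_ring_1"
  assumes two: "(2::'a) = 0" and sym: "\<And>c d. c < N \<Longrightarrow> d < N \<Longrightarrow> f c d = f d c"
  shows "(\<Sum>c<N. \<Sum>d<N. f c d) = (\<Sum>c<N. f c c)"
proof -
  have "(\<Sum>c<N. \<Sum>d<c. f c d + f d c) = 0"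
  proof (intro sum.neutral ballI)
    fix c d assume "c \<in> {..<N}" "d \<in> {..<c}"
    then have "f c d + f d c = 2 * f c d" using sym[of d c] by (simp add: mult_2[symmetric])
    then show "f c d + f d c = 0" using two by simp
  qed
  then show ?thesis unfolding sum_square_split by simp
qed

lemma char2_minus: "(2::'a::comm_ring_1) = 0 \<Longrightarrow> - a = (a::'a)"
proof -
  assume "(2::'a) = 0"
  then have "a + a = 0" by (metis mult_2 mult_zero_left)
  then show "- a = a" by (rule minus_unique)
qed

lemma char2_add_eq_0: "(2::'a::comm_ring_1) = 0 \<Longrightarrow> a + b = 0 \<longleftrightarrow> a = (b::'a)"
  using char2_minus[of b] by (metis add_eq_0_iff2 )

lemma supertrace_char2: "(2::'a::comm_ring_1) = 0 \<Longrightarrow> supertrace k vs = (spin_trace k vs :: 'a)"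
  by (simp add: supertrace_def)

lemma spin_trace_exchange:
  fixes v :: "nat \<Rightarrow> 'a::comm_ring_1"
  shows "spin_trace k (as @ [v, w] @ bs) + spin_trace k (as @ [w, v] @ bs) = bform k v w * spin_trace k (as @ bs)"
  by (rule word_trace_exchange[OF one_carrier_mat])

lemma spin_trace_sq:
  fixes v :: "nat \<Rightarrow> 'a::comm_ring_1"
  shows "spin_trace k (as @ [v, v] @ bs) = qform k v * spin_trace k (as @ bs)"
  by (rule word_trace_sq[OF one_carrier_mat])

text \<open>In characteristic 2 the trace is the projection of the Clifford algebra to the top exterior power: it vanishes on words of
length less than \<open>2 k\<close>, and is therefore alternating on words of length \<open>2 k\<close>.\<close>

lemma spin_trace_eq_det:
  fixes vs :: "(nat \<Rightarrow> 'a::comm_ring_1) list"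
  assumes two: "(2::'a) = 0" and len: "length vs = 2 * k"
  shows "spin_trace k vs = det_list (2 * k) vs"
proof -
  define F where "F vs = spin_trace k vs - det_list (2 * k) vs" for vs :: "(nat \<Rightarrow> 'a) list"
  have slot: "slotwise (2 * k) F"
    unfolding slotwise_def
  proof (intro allI)
    fix as bs and v :: "nat \<Rightarrow> 'a"
    show "F (as @ [v] @ bs) = (\<Sum>c<2 * k. v c * F (as @ [basis_vec c] @ bs))"
      using slotwiseD[OF slotwise_spin_trace, of k as v bs] slotwiseD[OF slotwise_det_list, of "2 * k" as v bs]
      by (simp add: F_def right_diff_distrib sum_subtractf)
  qed
  have "F vs = 0"
  proof (rule slotwise_zero[OF slot])
    fix cs :: "nat list" assume cs: "set cs \<subseteq> {..<2 * k}" "length cs = length vs"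
    show "F (map basis_vec cs) = 0"
    proof (rule clifford_functional_zero[where n = "2 * k" and M = "2 * k" and \<phi> = "\<lambda>cs. F (map basis_vec cs)"
          and \<kappa> = "\<lambda>c d. bform k (basis_vec c) (basis_vec d)"])
      fix as bs c
      show "F (map basis_vec (as @ [c, c] @ bs)) = 0"
        using spin_trace_sq[where 'a = 'a, of k "map basis_vec as" "basis_vec c" "map basis_vec bs"]
          det_list_sq[where 'a = 'a, of "2 * k" "map basis_vec as" "basis_vec c" "map basis_vec bs"]
        by (simp add: qform_unit F_def)
    next
      fix as bs c d
      assume "length (as @ [c, d] @ bs :: nat list) \<le> 2 * k"
      then have "det_list (2 * k) (map basis_vec (as @ bs)) = (0::'a)" by (simp add: det_list_def)
      moreover have "det_list (2 * k) (map basis_vec (as @ [c, d] @ bs)) + det_list (2 * k) (map basis_vec (as @ [d, c] @ bs)) = (0::'a)"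
        using polarize[OF slotwise_det_list, of "2 * k" "map basis_vec as" "map basis_vec bs" 0 k "basis_vec c :: nat \<Rightarrow> 'a" "basis_vec d"]
          det_list_sq[where 'a = 'a, of "2 * k" "map basis_vec as" _ "map basis_vec bs"] by simp
      moreover have "spin_trace k (map basis_vec (as @ [c, d] @ bs)) + spin_trace k (map basis_vec (as @ [d, c] @ bs))
          = bform k (basis_vec c) (basis_vec d) * (spin_trace k (map basis_vec (as @ bs)) :: 'a)"
        using spin_trace_exchange[where 'a = 'a, of k "map basis_vec as" "basis_vec c" "basis_vec d" "map basis_vec bs"] by simp
      ultimately show "F (map basis_vec (as @ [c, d] @ bs)) + F (map basis_vec (as @ [d, c] @ bs)) =
          bform k (basis_vec c) (basis_vec d) * F (map basis_vec (as @ bs))"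
        unfolding F_def by (metis (no_types, lifting) add_diff_add diff_zero)
    next
      fix ds :: "nat list"
      assume ds: "distinct ds" "set ds \<subseteq> {..<2 * k}" "length ds < 2 * k"
      then show "F (map basis_vec ds) = 0"
        using supertrace_short[OF ds, where 'a = 'a] two by (simp add: F_def det_list_def supertrace_char2)
    next
      show "F (map basis_vec [0..<2 * k]) = 0"
        using supertrace_canonical[where 'a = 'a, of k] two by (simp add: F_def supertrace_char2 det_list_canonical)
    qed (use cs len in auto)
  qed
  then show ?thesis by (simp add: F_def)
qed

text \<open>The Dickson invariant: with \<open>2 \<times> 2\<close> blocks with respect to the \<open>x\<close>- and the \<open>y\<close>-coordinates it
is the trace of the product of the transposed lower left block with the upper right block.\<close>

definition dickson_form :: "nat \<Rightarrow> (nat \<Rightarrow> nat \<Rightarrow> 'a::comm_ring_1) \<Rightarrow> 'a" where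
  "dickson_form k G = (\<Sum>s<k. \<Sum>r<k. G (2 * s) (2 * r + 1) * G (2 * s + 1) (2 * r))"

text \<open>The isometry condition is stated by polynomial identities in the matrix entries, because the matrices that act on
generic vectors have their entries among the constants of a polynomial ring.\<close>

locale char2_orthogonal =
  fixes k :: nat and G :: "nat \<Rightarrow> nat \<Rightarrow> 'a::comm_ring_1"
  assumes two: "(2::'a) = 0"
    and col_q: "\<And>d. d < 2 * k \<Longrightarrow> qform k (\<lambda>c. G c d) = 0"
    and col_b: "\<And>d e. d < 2 * k \<Longrightarrow> e < 2 * k \<Longrightarrow> bform k (\<lambda>c. G c d) (\<lambda>c. G c e) = (if e = partner d then 1 else 0)"
    and row_b: "\<And>c d. c < 2 * k \<Longrightarrow> d < 2 * k \<Longrightarrow> bform k (G c) (G d) = (if d = partner c then 1 else 0)"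
    and det1: "det_list (2 * k) (map (\<lambda>d c. G c d) [0..<2 * k]) = 1"
begin

definition frame_map :: "(nat \<Rightarrow> 'a) \<Rightarrow> nat \<Rightarrow> 'a" where
  "frame_map v c = (\<Sum>d<2 * k. G c d * v d)"

lemma frame_map_unit: "d < 2 * k \<Longrightarrow> frame_map (basis_vec d) = (\<lambda>c. G c d)"
  by (rule ext) (simp add: frame_map_def basis_vec_def if_distrib[of "\<lambda>x. _ * x"] sum.delta cong: if_cong)

lemma slotwise_frame_map:
  assumes "slotwise (2 * k) F"
  shows "slotwise (2 * k) (\<lambda>vs. F (map frame_map vs))"
  unfolding slotwise_def
proof (intro allI)
  fix as v bs
  let ?F = "\<lambda>u. F (map frame_map as @ [u] @ map frame_map bs)"
  have "?F (frame_map v) = (\<Sum>c<2 * k. (\<Sum>d<2 * k. G c d * v d) * ?F (basis_vec c))"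
    unfolding slotwiseD[OF assms, of "map frame_map as" "frame_map v" "map frame_map bs"] frame_map_def ..
  also have "\<dots> = (\<Sum>c<2 * k. \<Sum>d<2 * k. v d * (G c d * ?F (basis_vec c)))"
    by (simp add: sum_distrib_right mult_ac)
  also have "\<dots> = (\<Sum>d<2 * k. \<Sum>c<2 * k. v d * (G c d * ?F (basis_vec c)))"
    by (rule sum.swap)
  also have "\<dots> = (\<Sum>d<2 * k. v d * ?F (frame_map (basis_vec d)))"
  proof (intro sum.cong refl)
    fix d assume "d \<in> {..<2 * k}"
    then have "frame_map (basis_vec d) = (\<lambda>c. G c d)" by (simp add: frame_map_unit)
    then show "(\<Sum>c<2 * k. v d * (G c d * ?F (basis_vec c))) = v d * ?F (frame_map (basis_vec d))"
      unfolding slotwiseD[OF assms, of "map frame_map as" "frame_map (basis_vec d)" "map frame_map bs"] by (simp add: sum_distrib_left)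
  qed
  finally show "F (map frame_map (as @ [v] @ bs)) = (\<Sum>c<2 * k. v c * F (map frame_map (as @ [basis_vec c] @ bs)))"
    by simp
qed

text \<open>Replacing each vector by its image preserves the Clifford relation, so the two traces only need to be compared on
short words, where both vanish, and on the word that lists the basis, where the image has the trace
\<open>det G = 1\<close>.\<close>

lemma spin_trace_frame_map: "spin_trace k (map frame_map vs) = spin_trace k vs"
proof -
  define F where "F vs = spin_trace k (map frame_map vs) - spin_trace k vs" for vs :: "(nat \<Rightarrow> 'a) list"
  have slot: "slotwise (2 * k) F"
    unfolding slotwise_def
  proof (intro allI)
    fix as bs and v :: "nat \<Rightarrow> 'a"
    show "F (as @ [v] @ bs) = (\<Sum>c<2 * k. v c * F (as @ [basis_vec c] @ bs))"
      using slotwiseD[OF slotwise_spin_trace, of k as v bs] slotwiseD[OF slotwise_frame_map[OF slotwise_spin_trace], of as v bs]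
      by (simp add: F_def right_diff_distrib sum_subtractf)
  qed
  have "F vs = 0"
  proof (rule slotwise_zero[OF slot])
    fix cs :: "nat list" assume cs: "set cs \<subseteq> {..<2 * k}" "length cs = length vs"
    show "F (map basis_vec cs) = 0"
    proof (rule clifford_functional_zero[where n = "2 * k" and M = "length cs" and \<phi> = "\<lambda>cs. F (map basis_vec cs)"
          and \<kappa> = "\<lambda>c d. bform k (basis_vec c) (basis_vec d)"])
      fix as bs c assume "set (as @ [c] @ bs) \<subseteq> {..<2 * k}"
      then have "qform k (frame_map (basis_vec c)) = 0" by (simp add: frame_map_unit col_q)
      then show "F (map basis_vec (as @ [c, c] @ bs)) = 0"
        using spin_trace_sq[where 'a = 'a, of k "map basis_vec as" "basis_vec c" "map basis_vec bs"]
          spin_trace_sq[of k "map frame_map (map basis_vec as)" "frame_map (basis_vec c)" "map frame_map (map basis_vec bs)"]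
        by (simp add: qform_unit F_def)
    next
      fix as bs c d assume "set (as @ [c, d] @ bs) \<subseteq> {..<2 * k}"
      then have "bform k (frame_map (basis_vec c)) (frame_map (basis_vec d)) = bform k (basis_vec c) (basis_vec d)"
        by (simp add: frame_map_unit col_b bform_unit)
      then show "F (map basis_vec (as @ [c, d] @ bs)) + F (map basis_vec (as @ [d, c] @ bs)) =
          bform k (basis_vec c) (basis_vec d) * F (map basis_vec (as @ bs))"
        using spin_trace_exchange[where 'a = 'a, of k "map basis_vec as" "basis_vec c" "basis_vec d" "map basis_vec bs"]
          spin_trace_exchange[of k "map frame_map (map basis_vec as)" "frame_map (basis_vec c)" "frame_map (basis_vec d)" "map frame_map (map basis_vec bs)"]
        unfolding F_def by (simp add: algebra_simps)
    next
      fix ds :: "nat list"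
      assume ds: "distinct ds" "set ds \<subseteq> {..<2 * k}" "length ds < 2 * k"
      obtain x where x: "x < 2 * k" "\<forall>c\<in>set ds. c \<noteq> partner x"
        using missing_partner[OF ds] .
      have "supertrace k (map frame_map (map basis_vec ds)) = 0"
        by (rule supertrace_perp[of k "frame_map (basis_vec x)" "frame_map (basis_vec (partner x))"])
          (use x ds two in \<open>auto simp: frame_map_unit col_b partner_less\<close>)
      then show "F (map basis_vec ds) = 0"
        using supertrace_short[OF ds, where 'a = 'a] two by (simp add: F_def supertrace_char2)
    next
      have frame: "map frame_map (map basis_vec [0..<2 * k]) = map (\<lambda>d c. G c d) [0..<2 * k]"
        by (simp add: frame_map_unit)
      have "spin_trace k (map frame_map (map basis_vec [0..<2 * k])) = 1"
        unfolding frame using spin_trace_eq_det[OF two, of "map (\<lambda>d c. G c d) [0..<2 * k]" k] det1 by simp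
      then show "F (map basis_vec [0..<2 * k]) = 0"
        using supertrace_canonical[where 'a = 'a, of k] two by (simp add: F_def supertrace_char2)
    qed (use cs in auto)
  qed
  then show ?thesis by (simp add: F_def)
qed

lemma partner_sum:
  fixes X :: "nat \<Rightarrow> nat \<Rightarrow> 'a"
  shows "(\<Sum>c<2 * l. \<Sum>d<c. (if d = partner c then 1 else 0) * X c d) = (\<Sum>s<l. X (2 * s + 1) (2 * s))"
proof (induction l)
  case (Suc l)
  have "(\<Sum>d<2 * l. (if d = partner (2 * l) then 1 else 0) * X (2 * l) d) = 0"
    by (intro sum.neutral) (auto simp: partner_def)
  moreover have "(\<Sum>d<2 * l. (if d = partner (Suc (2 * l)) then 1 else 0) * X (Suc (2 * l)) d) = 0"
    by (intro sum.neutral) (auto simp: partner_def)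
  ultimately show ?case using Suc by (simp add: partner_def)
qed simp

text \<open>The image of the projection \<open>\<Sum>r. y\<^sub>r x\<^sub>r\<close> under the isometry, expanded in the basis. Reordering the products of
two basis vectors by the exchange relation, the row relations give back the projection, and the contractions
that arise on the way add up to the Dickson invariant.\<close>

lemma half_spin_trace_frame:
  "(\<Sum>r<k. spin_trace k ((\<lambda>c. G c (Suc (2 * r))) # (\<lambda>c. G c (2 * r)) # vs)) = half_spin_trace k vs + dickson_form k G * spin_trace k vs"
proof -
  define T where "T c d = spin_trace k (basis_vec c # basis_vec d # vs)" for c d
  define M where "M c d = (\<Sum>r<k. G c (2 * r + 1) * G d (2 * r))" for c d
  have ex: "spin_trace k (u # w # vs) = (\<Sum>c<2 * k. \<Sum>d<2 * k. u c * w d * T c d)" for u w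
  proof -
    have "spin_trace k (u # w # vs) = (\<Sum>c<2 * k. u c * spin_trace k (basis_vec c # w # vs))"
      using slotwiseD[OF slotwise_spin_trace, of k "[]" u "w # vs"] by simp
    also have "\<dots> = (\<Sum>c<2 * k. u c * (\<Sum>d<2 * k. w d * T c d))"
      using slotwiseD[OF slotwise_spin_trace, of k "[basis_vec _]" w vs] by (simp add: T_def)
    finally show ?thesis by (simp add: sum_distrib_left mult_ac)
  qed
  have T0: "T c c = 0" for c
    using spin_trace_sq[of k "[]" "basis_vec c" vs] by (simp add: T_def qform_unit)
  have T1: "T d c = (if d = partner c then 1 else 0) * spin_trace k vs + T c d" if "c < 2 * k" for c d
  proof -
    have "T c d + T d c = (if d = partner c then 1 else 0) * spin_trace k vs"
      using spin_trace_exchange[of k "[]" "basis_vec c" "basis_vec d" vs] that by (simp add: T_def bform_unit)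
    then have "T d c = (if d = partner c then 1 else 0) * spin_trace k vs - T c d" by (simp add: algebra_simps)
    also have "\<dots> = (if d = partner c then 1 else 0) * spin_trace k vs + T c d"
      using char2_minus[OF two, of "T c d"] by (metis diff_conv_add_uminus)
    finally show ?thesis .
  qed
  have MM: "M c d + M d c = (if d = partner c then 1 else 0)" if "c < 2 * k" "d < 2 * k" for c d
    using row_b[OF that] by (simp add: M_def bform_def sum.distrib[symmetric] algebra_simps)
  have "(\<Sum>r<k. spin_trace k ((\<lambda>c. G c (Suc (2 * r))) # (\<lambda>c. G c (2 * r)) # vs)) =
      (\<Sum>r<k. \<Sum>c<2 * k. \<Sum>d<2 * k. G c (Suc (2 * r)) * G d (2 * r) * T c d)"
    unfolding ex ..
  also have "\<dots> = (\<Sum>c<2 * k. \<Sum>d<2 * k. M c d * T c d)"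
  proof -
    have "(\<Sum>r<k. \<Sum>c<2 * k. \<Sum>d<2 * k. G c (Suc (2 * r)) * G d (2 * r) * T c d) =
       (\<Sum>c<2 * k. \<Sum>r<k. \<Sum>d<2 * k. G c (Suc (2 * r)) * G d (2 * r) * T c d)"
      by (rule sum.swap)
    also have "\<dots> = (\<Sum>c<2 * k. \<Sum>d<2 * k. \<Sum>r<k. G c (Suc (2 * r)) * G d (2 * r) * T c d)"
      by (intro sum.cong refl sum.swap)
    finally show ?thesis by (simp add: M_def sum_distrib_right)
  qed
  also have "\<dots> = (\<Sum>c<2 * k. M c c * T c c) + (\<Sum>c<2 * k. \<Sum>d<c. M c d * T c d + M d c * T d c)"
    by (rule sum_square_split)
  also have "(\<Sum>c<2 * k. M c c * T c c) = 0" by (simp add: T0)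
  also have "(\<Sum>c<2 * k. \<Sum>d<c. M c d * T c d + M d c * T d c) =
      (\<Sum>c<2 * k. \<Sum>d<c. (if d = partner c then 1 else 0) * (T c d + M d c * spin_trace k vs))"
  proof (intro sum.cong refl)
    fix c d assume "c \<in> {..<2 * k}" "d \<in> {..<c}"
    then have cd: "c < 2 * k" "d < 2 * k" by auto
    have "M c d * T c d + M d c * T d c = (M c d + M d c) * T c d + (if d = partner c then 1 else 0) * M d c * spin_trace k vs"
      unfolding T1[OF cd(1), of d] by (simp add: algebra_simps)
    then show "M c d * T c d + M d c * T d c = (if d = partner c then 1 else 0) * (T c d + M d c * spin_trace k vs)"
      unfolding MM[OF cd] by (simp add: algebra_simps)
  qed
  also have "\<dots> = (\<Sum>s<k. T (2 * s + 1) (2 * s) + M (2 * s) (2 * s + 1) * spin_trace k vs)"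
    by (rule partner_sum)
  also have "\<dots> = half_spin_trace k vs + dickson_form k G * spin_trace k vs"
    unfolding half_spin_trace_char2[OF two] by (simp add: sum.distrib T_def M_def dickson_form_def sum_distrib_right)
  finally show ?thesis by simp
qed

lemma half_spin_trace_frame_map: "half_spin_trace k vs = half_spin_trace k (map frame_map vs) + dickson_form k G * spin_trace k vs"
proof -
  have "half_spin_trace k vs = (\<Sum>r<k. spin_trace k (basis_vec (Suc (2 * r)) # basis_vec (2 * r) # vs))"
    by (rule half_spin_trace_char2[OF two])
  also have "\<dots> = (\<Sum>r<k. spin_trace k ((\<lambda>c. G c (Suc (2 * r))) # (\<lambda>c. G c (2 * r)) # map frame_map vs))"
  proof (intro sum.cong refl)
    fix r assume "r \<in> {..<k}"
    then have "map frame_map (basis_vec (Suc (2 * r)) # basis_vec (2 * r) # vs) = (\<lambda>c. G c (Suc (2 * r))) # (\<lambda>c. G c (2 * r)) # map frame_map vs"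
      by (simp add: frame_map_unit)
    then show "spin_trace k (basis_vec (Suc (2 * r)) # basis_vec (2 * r) # vs) = spin_trace k ((\<lambda>c. G c (Suc (2 * r))) # (\<lambda>c. G c (2 * r)) # map frame_map vs)"
      using spin_trace_frame_map by metis
  qed
  also have "\<dots> = half_spin_trace k (map frame_map vs) + dickson_form k G * spin_trace k vs"
    unfolding half_spin_trace_frame spin_trace_frame_map ..
  finally show ?thesis .
qed

text \<open>With the blocks \<open>a\<close>, \<open>b\<close>, \<open>c\<close>, \<open>d\<close> of the matrix, \<open>X = c\<^sup>T b\<close> satisfies \<open>X X = X + Y W\<close>, where
\<open>Y = c\<^sup>T a\<close> and \<open>W = d\<^sup>T b\<close> are alternating. In characteristic 2 the trace of a product of two
alternating matrices is 0, and the trace of \<open>X X\<close> is the square of the trace of \<open>X\<close>. The matrix \<open>Z\<close> of the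
proof is the transpose of \<open>W\<close>.\<close>

lemma dickson_idem: "dickson_form k G * dickson_form k G = dickson_form k G"
proof -
  define a where "a s t = G (2 * s) (2 * t)" for s t
  define b where "b s t = G (2 * s) (2 * t + 1)" for s t
  define c where "c s t = G (2 * s + 1) (2 * t)" for s t
  define d where "d s t = G (2 * s + 1) (2 * t + 1)" for s t
  define X where "X r t = (\<Sum>s<k. c s r * b s t)" for r t
  define Y where "Y r t = (\<Sum>s<k. c s r * a s t)" for r t
  define Z where "Z r t = (\<Sum>s<k. b s r * d s t)" for r t
  have dX: "dickson_form k G = (\<Sum>r<k. X r r)"
    unfolding dickson_form_def X_def by (subst sum.swap) (simp add: b_def c_def mult_ac)
  have "dickson_form k G * dickson_form k G = (\<Sum>r<k. \<Sum>t<k. X r r * X t t)"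
    unfolding dX by (rule sum_product)
  also have "\<dots> = (\<Sum>r<k. X r r * X r r)"
    by (rule sum_symmetric_char2[OF two]) (simp add: mult_ac)
  also have "\<dots> = (\<Sum>r<k. \<Sum>t<k. X r t * X t r)"
    by (rule sum_symmetric_char2[OF two, symmetric]) (simp add: mult_ac)
  also have "\<dots> = (\<Sum>r<k. \<Sum>t<k. \<Sum>s<k. \<Sum>s'<k. c s r * b s' r * (b s t * c s' t))"
    unfolding X_def sum_product by (simp add: mult_ac)
  also have "\<dots> = (\<Sum>r<k. \<Sum>s<k. \<Sum>s'<k. \<Sum>t<k. c s r * b s' r * (b s t * c s' t))"
  proof (rule sum.cong[OF refl])
    fix r
    have "(\<Sum>t<k. \<Sum>s<k. \<Sum>s'<k. c s r * b s' r * (b s t * c s' t)) =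
        (\<Sum>s<k. \<Sum>t<k. \<Sum>s'<k. c s r * b s' r * (b s t * c s' t))" by (rule sum.swap)
    also have "\<dots> = (\<Sum>s<k. \<Sum>s'<k. \<Sum>t<k. c s r * b s' r * (b s t * c s' t))"
      by (intro sum.cong refl sum.swap)
    finally show "(\<Sum>t<k. \<Sum>s<k. \<Sum>s'<k. c s r * b s' r * (b s t * c s' t)) =
      (\<Sum>s<k. \<Sum>s'<k. \<Sum>t<k. c s r * b s' r * (b s t * c s' t))" .
  qed
  also have "\<dots> = (\<Sum>r<k. \<Sum>s<k. \<Sum>s'<k. c s r * b s' r * ((if s = s' then 1 else 0) + (\<Sum>t<k. a s t * d s' t)))"
  proof (intro sum.cong refl)
    fix r s s' assume s: "s \<in> {..<k}" "s' \<in> {..<k}"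
    have "bform k (G (2 * s)) (G (2 * s' + 1)) = (if 2 * s' + 1 = partner (2 * s) then 1 else 0)"
      using s by (intro row_b) auto
    then have "(\<Sum>t<k. a s t * d s' t) + (\<Sum>t<k. b s t * c s' t) = (if s = s' then 1 else 0)"
      by (simp add: bform_def sum.distrib a_def b_def c_def d_def partner_def)
    then have "(\<Sum>t<k. b s t * c s' t) = (if s = s' then 1 else 0) - (\<Sum>t<k. a s t * d s' t)"
      by (simp add: algebra_simps)
    also have "\<dots> = (if s = s' then 1 else 0) + (\<Sum>t<k. a s t * d s' t)"
      using char2_minus[OF two, of "\<Sum>t<k. a s t * d s' t"] by (metis diff_conv_add_uminus)
    finally show "(\<Sum>t<k. c s r * b s' r * (b s t * c s' t)) = c s r * b s' r * ((if s = s' then 1 else 0) + (\<Sum>t<k. a s t * d s' t))"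
      by (simp add: sum_distrib_left[symmetric])
  qed
  also have "\<dots> = (\<Sum>r<k. \<Sum>s<k. \<Sum>s'<k. c s r * b s' r * (if s = s' then 1 else 0)) +
     (\<Sum>r<k. \<Sum>s<k. \<Sum>s'<k. \<Sum>t<k. c s r * b s' r * (a s t * d s' t))"
    by (simp only: distrib_left sum.distrib sum_distrib_left)
  also have "(\<Sum>r<k. \<Sum>s<k. \<Sum>s'<k. c s r * b s' r * (if s = s' then 1 else 0)) = dickson_form k G"
    unfolding dX X_def by (simp add: if_distrib[of "\<lambda>x. _ * x"] sum.delta cong: if_cong)
  also have "(\<Sum>r<k. \<Sum>s<k. \<Sum>s'<k. \<Sum>t<k. c s r * b s' r * (a s t * d s' t)) = (\<Sum>r<k. \<Sum>t<k. Y r t * Z r t)"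
  proof (rule sum.cong[OF refl])
    fix r
    have "(\<Sum>s<k. \<Sum>s'<k. \<Sum>t<k. c s r * b s' r * (a s t * d s' t)) = (\<Sum>s<k. \<Sum>t<k. \<Sum>s'<k. c s r * b s' r * (a s t * d s' t))"
      by (intro sum.cong refl sum.swap)
    also have "\<dots> = (\<Sum>t<k. \<Sum>s<k. \<Sum>s'<k. c s r * b s' r * (a s t * d s' t))"
      by (rule sum.swap)
    also have "\<dots> = (\<Sum>t<k. Y r t * Z r t)"
      unfolding Y_def Z_def sum_product by (simp add: mult_ac)
    finally show "(\<Sum>s<k. \<Sum>s'<k. \<Sum>t<k. c s r * b s' r * (a s t * d s' t)) = (\<Sum>t<k. Y r t * Z r t)" .
  qed
  also have "(\<Sum>r<k. \<Sum>t<k. Y r t * Z r t) = (\<Sum>r<k. Y r r * Z r r)"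
  proof (rule sum_symmetric_char2[OF two])
    fix r t assume rt: "r < k" "t < k"
    have "2 * t \<noteq> partner (2 * r)" by (simp add: partner_def) presburger
    then have "bform k (\<lambda>c. G c (2 * r)) (\<lambda>c. G c (2 * t)) = 0" using col_b[of "2 * r" "2 * t"] rt by simp
    then have "Y r t + Y t r = 0"
      by (simp add: bform_def Y_def a_def c_def sum.distrib[symmetric] algebra_simps)
    moreover have "bform k (\<lambda>c. G c (2 * r + 1)) (\<lambda>c. G c (2 * t + 1)) = 0"
      using col_b[of "2 * r + 1" "2 * t + 1"] rt by (simp add: partner_def) presburger
    then have "Z r t + Z t r = 0"
      by (simp add: bform_def Z_def b_def d_def sum.distrib[symmetric] algebra_simps)
    ultimately show "Y r t * Z r t = Y t r * Z t r"
      by (simp add: char2_add_eq_0[OF two])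
  qed
  also have "\<dots> = 0"
  proof (intro sum.neutral ballI)
    fix r assume "r \<in> {..<k}"
    then have "qform k (\<lambda>c. G c (2 * r)) = 0" by (intro col_q) simp
    then have "Y r r = 0" by (simp add: qform_def Y_def a_def c_def mult_ac)
    then show "Y r r * Z r r = 0" by simp
  qed
  finally show ?thesis by simp
qed

end

section \<open>The orthogonal group and its identity component\<close>

lemma quad_form_qform: "quad_form (2 * k) v = qform k (\<lambda>c. v $ c)"
  by (simp add: quad_form_def qform_def)

lemma qform_cong: "(\<And>c. c < 2 * k \<Longrightarrow> v c = w c) \<Longrightarrow> qform k v = qform k w"
  unfolding qform_def by (intro sum.cong refl) auto

lemma bform_partner: "bform k v w = (\<Sum>c<2 * k. v c * w (partner c))"
  by (induction k) (simp_all add: bform_def partner_def algebra_simps)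

text \<open>Since the polar form is nondegenerate, a matrix that preserves the quadratic form is invertible, so these are the
matrices of the orthogonal group.\<close>

definition isometry_mat :: "nat \<Rightarrow> 'a::field mat \<Rightarrow> bool" where
  "isometry_mat k A \<longleftrightarrow> A \<in> carrier_mat (2 * k) (2 * k) \<and>
     (\<forall>v\<in>carrier_vec (2 * k). quad_form (2 * k) (A *\<^sub>v v) = quad_form (2 * k) v)"

definition J_mat :: "nat \<Rightarrow> 'a::field mat" where
  "J_mat k = mat (2 * k) (2 * k) (\<lambda>(c, d). if d = partner c then 1 else 0)"

lemma J_carrier [simp]: "J_mat k \<in> carrier_mat (2 * k) (2 * k)" by (simp add: J_mat_def)

lemma sum_if_mult:
  fixes f :: "nat \<Rightarrow> 'a::comm_ring_1"
  shows "a < N \<Longrightarrow> (\<Sum>c<N. (if c = a then 1 else 0) * f c) = f a"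
    and "a < N \<Longrightarrow> (\<Sum>c<N. (if a = c then 1 else 0) * f c) = f a"
  by (simp_all add: if_distrib[of "\<lambda>x. x * _"] sum.delta sum.delta' cong: if_cong)

lemma mult_index:
  assumes "A \<in> carrier_mat n n" "B \<in> carrier_mat n n" "i < n" "j < n"
  shows "(A * B) $$ (i, j) = (\<Sum>c<n. A $$ (i, c) * B $$ (c, j))"
  using assms by (auto simp: scalar_prod_def atLeast0LessThan intro!: sum.cong)

lemma J_mult_index:
  assumes "A \<in> carrier_mat (2 * k) (2 * k)" "c < 2 * k" "d < 2 * k"
  shows "(J_mat k * A) $$ (c, d) = A $$ (partner c, d)"
  using assms partner_less[OF assms(2)]
  by (simp add: J_mat_def scalar_prod_def atLeast0LessThan sum_if_mult)

lemma mult_J_index: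
  assumes "A \<in> carrier_mat (2 * k) (2 * k)" "c < 2 * k" "d < 2 * k"
  shows "(A * J_mat k) $$ (c, d) = A $$ (c, partner d)"
proof -
  have "(A * J_mat k) $$ (c, d) = (\<Sum>e<2 * k. (if e = partner d then 1 else 0) * A $$ (c, e))"
    using assms by (auto simp: J_mat_def scalar_prod_def atLeast0LessThan mult.commute intro!: sum.cong)
  then show ?thesis using partner_less[OF assms(3)] by (simp add: sum_if_mult)
qed

lemma J_J: "J_mat k * J_mat k = (1\<^sub>m (2 * k) :: 'a::field mat)"
proof (rule eq_matI)
  fix i j assume "i < dim_row (1\<^sub>m (2 * k) :: 'a mat)" "j < dim_col (1\<^sub>m (2 * k) :: 'a mat)"
  then have ij: "i < 2 * k" "j < 2 * k" by auto
  have "(J_mat k * J_mat k) $$ (i, j) = (J_mat k $$ (partner i, j) :: 'a)"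
    by (rule J_mult_index[OF J_carrier ij])
  then show "(J_mat k * J_mat k) $$ (i, j) = (1\<^sub>m (2 * k) :: 'a mat) $$ (i, j)"
    using ij partner_less[OF ij(1)] by (auto simp: J_mat_def)
qed (auto simp: J_mat_def)

context
  fixes k :: nat and A :: "'a::field mat"
  assumes iso: "isometry_mat k A"
begin

lemma isometry_carrier: "A \<in> carrier_mat (2 * k) (2 * k)"
  using iso by (simp add: isometry_mat_def)

lemma isometry_qform: "qform k (\<lambda>c. \<Sum>d<2 * k. A $$ (c, d) * v d) = qform k v"
proof -
  let ?v = "vec (2 * k) v"
  have "quad_form (2 * k) (A *\<^sub>v ?v) = quad_form (2 * k) ?v"
    using iso by (simp add: isometry_mat_def)
  moreover have "quad_form (2 * k) (A *\<^sub>v ?v) = qform k (\<lambda>c. \<Sum>d<2 * k. A $$ (c, d) * v d)"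
    unfolding quad_form_qform using isometry_carrier
    by (intro qform_cong) (auto simp: scalar_prod_def atLeast0LessThan intro!: sum.cong)
  moreover have "quad_form (2 * k) ?v = qform k v"
    unfolding quad_form_qform by (intro qform_cong) auto
  ultimately show ?thesis by simp
qed

lemma isometry_col_q: "d < 2 * k \<Longrightarrow> qform k (\<lambda>c. A $$ (c, d)) = 0"
  using isometry_qform[of "basis_vec d"]
  by (simp add: qform_unit basis_vec_def if_distrib[of "\<lambda>x. _ * x"] sum.delta cong: if_cong)

lemma isometry_col_b:
  assumes d: "d < 2 * k" and e: "e < 2 * k"
  shows "bform k (\<lambda>c. A $$ (c, d)) (\<lambda>c. A $$ (c, e)) = (if e = partner d then 1 else 0)"
proof -
  have "(\<Sum>j<2 * k. A $$ (c, j) * (basis_vec d j + basis_vec e j)) = A $$ (c, d) + A $$ (c, e)" for c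
    using d e by (simp add: distrib_left sum.distrib basis_vec_def if_distrib[of "\<lambda>x. _ * x"] sum.delta cong: if_cong)
  then have "qform k (\<lambda>c. A $$ (c, d) + A $$ (c, e)) = qform k (\<lambda>c. basis_vec d c + basis_vec e c)"
    using isometry_qform[of "\<lambda>c. basis_vec d c + basis_vec e c"] by simp
  then show ?thesis
    unfolding qform_add by (simp add: isometry_col_q d e qform_unit bform_unit)
qed

lemma isometry_left: "(J_mat k * A\<^sup>T * J_mat k) * A = 1\<^sub>m (2 * k)"
proof -
  let ?n = "2 * k"
  note A = isometry_carrier
  have c: "A\<^sup>T \<in> carrier_mat ?n ?n" "A\<^sup>T * J_mat k \<in> carrier_mat ?n ?n" "J_mat k * A\<^sup>T \<in> carrier_mat ?n ?n"
      "J_mat k * A \<in> carrier_mat ?n ?n" "A\<^sup>T * (J_mat k * A) \<in> carrier_mat ?n ?n"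
    using A by (auto intro!: mult_carrier_mat[of _ ?n ?n _ ?n])
  have "A\<^sup>T * (J_mat k * A) = J_mat k"
  proof (rule eq_matI)
    fix d e assume de: "d < dim_row (J_mat k :: 'a mat)" "e < dim_col (J_mat k :: 'a mat)"
    then have de: "d < ?n" "e < ?n" by (auto simp: J_mat_def)
    have "(A\<^sup>T * (J_mat k * A)) $$ (d, e) = (\<Sum>c<?n. A $$ (c, d) * (J_mat k * A) $$ (c, e))"
      unfolding mult_index[OF c(1,4) de] using de A by (intro sum.cong refl) simp
    also have "\<dots> = bform k (\<lambda>c. A $$ (c, d)) (\<lambda>c. A $$ (c, e))"
      unfolding bform_partner using de by (intro sum.cong refl) (simp add: J_mult_index[OF A])
    finally show "(A\<^sup>T * (J_mat k * A)) $$ (d, e) = J_mat k $$ (d, e)"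
      using de by (simp add: isometry_col_b J_mat_def)
  qed (use A in \<open>auto simp: J_mat_def\<close>)
  then have "J_mat k * (A\<^sup>T * (J_mat k * A)) = 1\<^sub>m ?n" by (simp add: J_J)
  moreover have "J_mat k * (A\<^sup>T * (J_mat k * A)) = (J_mat k * A\<^sup>T * J_mat k) * A"
    using assoc_mult_mat[OF J_carrier c(1) c(4)] assoc_mult_mat[OF c(3) J_carrier A] by simp
  ultimately show ?thesis by simp
qed

lemma isometry_inverse_carrier: "J_mat k * A\<^sup>T * J_mat k \<in> carrier_mat (2 * k) (2 * k)"
  using isometry_carrier by (auto intro!: mult_carrier_mat[of _ "2 * k" "2 * k" _ "2 * k"])

lemma isometry_right: "A * (J_mat k * A\<^sup>T * J_mat k) = 1\<^sub>m (2 * k)"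
  by (rule mat_mult_left_right_inverse[OF isometry_inverse_carrier isometry_carrier isometry_left])

lemma isometry_invertible: "invertible_mat A"
  unfolding invertible_mat_def inverts_mat_def
  using isometry_left isometry_right isometry_carrier isometry_inverse_carrier by (auto intro!: exI[of _ "J_mat k * A\<^sup>T * J_mat k"])

text \<open>The column relations give a left inverse; over a field it is also a right inverse, and this gives the row
relations.\<close>

lemma isometry_row_b:
  assumes c: "c < 2 * k" and d: "d < 2 * k"
  shows "bform k (\<lambda>j. A $$ (c, j)) (\<lambda>j. A $$ (d, j)) = (if d = partner c then 1 else 0)"
proof -
  let ?n = "2 * k"
  note A = isometry_carrier
  have AT: "A\<^sup>T \<in> carrier_mat ?n ?n" using A by simp
  have JA: "J_mat k * A\<^sup>T \<in> carrier_mat ?n ?n" using A by (auto intro!: mult_carrier_mat[of _ ?n ?n _ ?n])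
  have p: "partner d < ?n" using d by (rule partner_less)
  have "(A * (J_mat k * A\<^sup>T * J_mat k)) $$ (c, partner d) = (\<Sum>e<?n. A $$ (c, e) * (J_mat k * A\<^sup>T * J_mat k) $$ (e, partner d))"
    by (rule mult_index[OF A isometry_inverse_carrier c p])
  also have "\<dots> = (\<Sum>e<?n. A $$ (c, e) * A $$ (d, partner e))"
    using p d A by (intro sum.cong refl) (simp add: mult_J_index[OF JA] J_mult_index[OF AT] partner_less)
  also have "\<dots> = bform k (\<lambda>j. A $$ (c, j)) (\<lambda>j. A $$ (d, j))"
    unfolding bform_partner ..
  finally have "(1\<^sub>m ?n :: 'a mat) $$ (c, partner d) = bform k (\<lambda>j. A $$ (c, j)) (\<lambda>j. A $$ (d, j))"
    unfolding isometry_right .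
  moreover have "c = partner d \<longleftrightarrow> d = partner c" by (metis partner_partner)
  ultimately show ?thesis using c p by simp
qed

lemma isometry_det_sq: "det A * det A = 1"
proof -
  note A = isometry_carrier
  have AT: "A\<^sup>T \<in> carrier_mat (2 * k) (2 * k)" using A by simp
  have JA: "J_mat k * A\<^sup>T \<in> carrier_mat (2 * k) (2 * k)" using A by (auto intro!: mult_carrier_mat[of _ "2 * k" "2 * k" _ "2 * k"])
  have "det (J_mat k :: 'a mat) * det (J_mat k :: 'a mat) = 1"
    using det_mult[OF J_carrier J_carrier, of k] unfolding J_J by simp
  moreover have "det (J_mat k) * det A * det (J_mat k) * det A = 1"
    using det_mult[OF isometry_inverse_carrier A] unfolding isometry_left det_mult[OF JA J_carrier] det_mult[OF J_carrier AT] det_transpose[OF A]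
    by simp
  ultimately show ?thesis by (metis mult.assoc mult.commute mult_1)
qed

lemma isometry_det: "(2::'a) = 0 \<Longrightarrow> det A = 1"
proof -
  assume two: "(2::'a) = 0"
  have "(det A - 1) * (det A - 1) = det A * det A + 1 - 2 * det A" by (simp add: algebra_simps)
  also have "\<dots> = 2" using isometry_det_sq two by simp
  finally show ?thesis using two by simp
qed

lemma isometry_det_list: "(2::'a) = 0 \<Longrightarrow> det_list (2 * k) (map (\<lambda>d c. A $$ (c, d)) [0..<2 * k]) = 1"
proof -
  assume two: "(2::'a) = 0"
  have "mat (2 * k) (2 * k) (\<lambda>(c, j). (map (\<lambda>d c. A $$ (c, d)) [0..<2 * k] ! j) c) = A"
    using isometry_carrier by (intro eq_matI) auto
  then show ?thesis using isometry_det[OF two] by (simp add: det_list_def)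
qed

lemma isometry_char2: "(2::'a) = 0 \<Longrightarrow> char2_orthogonal k (\<lambda>c d. A $$ (c, d))"
  by unfold_locales (auto simp: isometry_col_q isometry_col_b isometry_row_b isometry_det_list)

lemma isometry_char2_Const:
  assumes two: "(2::'a) = 0"
  shows "char2_orthogonal k (\<lambda>c d. Const (A $$ (c, d)) :: 'a vpoly)"
proof -
  interpret c: comm_ring_hom "Const :: 'a \<Rightarrow> 'a vpoly" by (rule Const_hom)
  have q: "qform k (\<lambda>c. Const (v c) :: 'a vpoly) = Const (qform k v)" for v
    by (simp add: qform_def c.hom_sum c.hom_mult)
  have b: "bform k (\<lambda>c. Const (v c) :: 'a vpoly) (\<lambda>c. Const (w c)) = Const (bform k v w)" for v w
    by (simp add: bform_def c.hom_sum c.hom_mult c.hom_add)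
  have "(2 :: 'a vpoly) = Const 2" by (simp add: Const_numeral)
  then have two': "(2 :: 'a vpoly) = 0" by (simp add: two)
  have "mat (2 * k) (2 * k) (\<lambda>(c, j). (map (\<lambda>d c. Const (A $$ (c, d))) [0..<2 * k] ! j) c) = (map_mat Const A :: 'a vpoly mat)"
    using isometry_carrier by (intro eq_matI) auto
  then have "det_list (2 * k) (map (\<lambda>d c. Const (A $$ (c, d)) :: 'a vpoly) [0..<2 * k]) = Const (det A)"
    by (simp add: det_list_def)
  then show ?thesis
    using two' by unfold_locales (auto simp: q b isometry_col_q isometry_col_b isometry_row_b isometry_det[OF two])
qed

end

lemma orthogonal_isometry: "A \<in> orthogonal_group (2 * k) \<longleftrightarrow> isometry_mat k A"
  unfolding orthogonal_group_def isometry_mat_def using isometry_invertible[of k A] by (auto simp: isometry_mat_def)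

lemma act_half_spin_trace:
  assumes two: "(2::'a::field) = 0" and A: "isometry_mat k (A :: 'a mat)"
    and d: "dickson_form k (\<lambda>c d. A $$ (c, d)) = 0"
  shows "act (2 * k) A (half_spin_trace k (generic_vectors m)) = half_spin_trace k (generic_vectors m)"
proof -
  interpret o: char2_orthogonal k "\<lambda>c d. Const (A $$ (c, d)) :: 'a vpoly"
    by (rule isometry_char2_Const[OF A two])
  interpret c: comm_ring_hom "Const :: 'a \<Rightarrow> 'a vpoly" by (rule Const_hom)
  interpret a: comm_ring_hom "act (2 * k) A" by (rule act_hom)
  have "dickson_form k (\<lambda>c d. Const (A $$ (c, d)) :: 'a vpoly) = Const (dickson_form k (\<lambda>c d. A $$ (c, d)))"
    by (simp add: dickson_form_def c.hom_sum c.hom_mult)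
  then have "half_spin_trace k (generic_vectors m) = half_spin_trace k (map o.frame_map (generic_vectors m))"
    using o.half_spin_trace_frame_map[of "generic_vectors m"] d by simp
  also have "map o.frame_map (generic_vectors m) = map (\<lambda>v c. act (2 * k) A (v c)) (generic_vectors m)"
    by (auto simp: generic_vectors_def o.frame_map_def act_def insertion_Var[OF Const_hom] fun_eq_iff)
  finally show ?thesis unfolding a.hom_half_spin_trace by simp
qed

lemma mvars_add: "mvars (p + q) \<subseteq> mvars p \<union> mvars q"
  using keys_add[of p q] unfolding mvars_def by blast

lemma mvars_mult: "mvars (p * q) \<subseteq> mvars p \<union> mvars q"
proof
  fix x assume "x \<in> mvars (p * q)"
  then obtain t where "t \<in> Poly_Mapping.keys (p * q)" and x: "x \<in> Poly_Mapping.keys t" by (auto simp: mvars_def)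
  then obtain u w where "t = u + w" "u \<in> Poly_Mapping.keys p" "w \<in> Poly_Mapping.keys q"
    using keys_mult[of p q] by blast
  then show "x \<in> mvars p \<union> mvars q" using x keys_add[of u w] unfolding mvars_def by blast
qed

lemma mvars_sum: "(\<And>x. x \<in> X \<Longrightarrow> mvars (g x) \<subseteq> V) \<Longrightarrow> mvars (\<Sum>x\<in>X. g x) \<subseteq> V"
proof (induction X rule: infinite_finite_induct)
  case (insert x X)
  then show ?case using mvars_add[of "g x" "\<Sum>x\<in>X. g x"] by fastforce
qed (simp_all add: mvars_def)

lemma mvars_Var: "mvars (Var x) \<subseteq> {x}"
  by (auto simp: mvars_def Var_def)

lemma mvars_one: "mvars 1 = {}"
  by (auto simp: mvars_def)

lemma zariski_open:
  "mvars p \<subseteq> {..<n} \<times> {..<n} \<Longrightarrow> openin (zariski_mat n) {A \<in> carrier_mat n n. insertion id (\<lambda>ij. A $$ ij) p \<noteq> 0}"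
  unfolding zariski_mat_def by (rule topology_generated_by_Basis) auto

lemma special_orthogonal_sub: "special_orthogonal_group n \<subseteq> orthogonal_group n"
proof
  fix A :: "'a mat" assume "A \<in> special_orthogonal_group n"
  then have "A \<in> topspace (subtopology (zariski_mat n) (orthogonal_group n))"
    unfolding special_orthogonal_group_def by (rule subsetD[OF connected_component_of_subset_topspace])
  then show "A \<in> orthogonal_group n" by simp
qed

lemma special_orthogonal_connected:
  fixes A :: "'a::field mat"
  assumes "A \<in> special_orthogonal_group n"
  obtains T where "connectedin (subtopology (zariski_mat n) (orthogonal_group n)) T" "1\<^sub>m n \<in> T" "A \<in> T"
proof -
  have "connected_component_of (subtopology (zariski_mat n) (orthogonal_group n)) (1\<^sub>m n) A"
    using assms unfolding special_orthogonal_group_def by simp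
  then show thesis using that unfolding connected_component_of_def by metis
qed

text \<open>The Dickson invariant is a polynomial function with values in \<open>{0, 1}\<close> on the orthogonal group, so its two fibres are
open, and a connected set that contains 1 lies in the fibre of 0.\<close>

lemma special_orthogonal_dickson:
  assumes two: "(2::'a::field) = 0" and A: "(A :: 'a mat) \<in> special_orthogonal_group (2 * k)"
  shows "dickson_form k (\<lambda>c d. A $$ (c, d)) = 0"
proof (rule ccontr)
  assume nz: "dickson_form k (\<lambda>c d. A $$ (c, d)) \<noteq> 0"
  let ?n = "2 * k"
  let ?\<delta> = "\<lambda>A :: 'a mat. dickson_form k (\<lambda>c d. A $$ (c, d))"
  let ?P = "dickson_form k (\<lambda>c d. Var (c, d)) :: 'a vpoly"
  interpret i: comm_ring_hom "insertion id (\<lambda>ij. B $$ ij)" for B :: "'a mat"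
    by (rule insertion_hom[OF id_hom])
  have ins: "insertion id (\<lambda>ij. A $$ ij) ?P = ?\<delta> A" for A
    by (simp add: dickson_form_def i.hom_sum i.hom_mult insertion_Var[OF id_hom])
  have mv: "mvars ?P \<subseteq> {..<?n} \<times> {..<?n}"
    unfolding dickson_form_def
  proof (intro mvars_sum)
    fix s r assume "s \<in> {..<k}" "r \<in> {..<k}"
    then show "mvars (Var (2 * s, 2 * r + 1) * Var (2 * s + 1, 2 * r) :: 'a vpoly) \<subseteq> {..<?n} \<times> {..<?n}"
      using mvars_mult[of "Var (2 * s, 2 * r + 1) :: 'a vpoly" "Var (2 * s + 1, 2 * r)"]
        mvars_Var[of "(2 * s, 2 * r + 1)", where 'b = 'a] mvars_Var[of "(2 * s + 1, 2 * r)", where 'b = 'a] by fastforce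
  qed
  have mv': "mvars (?P + 1) \<subseteq> {..<?n} \<times> {..<?n}"
    using mvars_add[of ?P 1] mv mvars_one by fastforce
  let ?U = "{A \<in> carrier_mat ?n ?n. ?\<delta> A \<noteq> 0}" and ?V = "{A \<in> carrier_mat ?n ?n. ?\<delta> A + 1 \<noteq> 0}"
  have oU: "openin (zariski_mat ?n) ?U" using zariski_open[OF mv] unfolding ins .
  have oV: "openin (zariski_mat ?n) ?V" using zariski_open[OF mv'] unfolding i.hom_add ins i.hom_one .
  have idem: "?\<delta> A = 0 \<or> ?\<delta> A = 1" if "A \<in> orthogonal_group ?n" for A
  proof -
    interpret o: char2_orthogonal k "\<lambda>c d. A $$ (c, d)"
      using isometry_char2[OF _ two] that by (simp add: orthogonal_isometry)
    have "?\<delta> A * ?\<delta> A = ?\<delta> A" by (rule o.dickson_idem)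
    then show ?thesis by (metis mult_cancel_left2)
  qed
  obtain T where T: "connectedin (subtopology (zariski_mat ?n) (orthogonal_group ?n)) T" "1\<^sub>m ?n \<in> T" "A \<in> T"
    using special_orthogonal_connected[OF A] .
  then have T': "connectedin (zariski_mat ?n) T" "T \<subseteq> orthogonal_group ?n"
    by (auto simp: connectedin_subtopology)
  have carr: "T \<subseteq> carrier_mat ?n ?n" using T'(2) by (auto simp: orthogonal_group_def)
  have one: "?\<delta> (1\<^sub>m ?n) = 0"
    unfolding dickson_form_def by (intro sum.neutral ballI) (auto; presburger)
  have "T \<subseteq> ?U \<union> ?V" using carr by auto
  moreover have "?U \<inter> ?V \<inter> T = {}"
  proof -
    have "False" if "B \<in> T" "?\<delta> B \<noteq> 0" "?\<delta> B + 1 \<noteq> 0" for B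
    proof -
      have "?\<delta> B = 1" using idem[of B] that T'(2) by auto
      then show False using that(3) two by simp
    qed
    then show ?thesis by auto
  qed
  moreover have "?U \<inter> T \<noteq> {}" using nz T(3) carr by auto
  moreover have "?V \<inter> T \<noteq> {}" using one T(2) carr by auto
  ultimately show False using T'(1) oU oV unfolding connectedin by blast
qed

lemma half_spin_trace_invariant:
  assumes two: "(2::'a::field) = 0" and g: "(g :: 'a mat) \<in> special_orthogonal_group (2 * k)"
  shows "act (2 * k) g (half_spin_trace k (generic_vectors m)) = half_spin_trace k (generic_vectors m)"
proof -
  have "isometry_mat k g" using special_orthogonal_sub[of "2 * k"] g by (auto simp: orthogonal_isometry)
  then show ?thesis
    using special_orthogonal_dickson[OF two g] by (rule act_half_spin_trace[OF two])
qed

section \<open>Root elements\<close>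

lemma alg_closed_infinite: "infinite (UNIV :: 'a::alg_closed_field set)"
proof
  assume fin: "finite (UNIV :: 'a set)"
  \<comment> \<open>The polynomial \<open>q + 1\<close> has the constant value 1.\<close>
  define q where "q = (\<Prod>a\<in>(UNIV :: 'a set). [:- a, 1:])"
  have q0: "poly q a = 0" for a using fin by (simp add: q_def poly_prod)
  have "q \<noteq> 0" using fin by (simp add: q_def)
  have "degree (q + 1) > 0"
  proof (rule ccontr)
    assume "\<not> degree (q + 1) > 0"
    then obtain c where "q + 1 = [:c:]" by (auto elim: degree_eq_zeroE)
    then have "q = [:c - 1:]" by (metis add_diff_cancel_right' diff_pCons diff_zero one_pCons)
    then show False using q0[of 0] \<open>q \<noteq> 0\<close> by simp
  qed
  then obtain x where "poly (q + 1) x = 0" by (rule alg_closed_imp_poly_has_root[THEN exE])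
  then show False using q0[of x] by simp
qed

lemma poly_path:
  fixes p :: "'a::field vpoly"
  obtains Q where "\<And>s. insertion id (\<lambda>(c, d). a c d + s * b c d) p = poly Q s"
proof -
  have ch: "comm_ring_hom (\<lambda>c::'a. [:c:])" by standard (simp_all add: one_pCons)
  define Q where "Q = insertion (\<lambda>c. [:c:]) (\<lambda>(c, d). [:a c d, b c d:]) p"
  interpret i: comm_ring_hom "insertion (\<lambda>c::'a. [:c:]) (\<lambda>(c, d). [:a c d, b c d:])"
    by (rule insertion_hom[OF ch])
  have "insertion id (\<lambda>(c, d). a c d + s * b c d) p = poly Q s" for s
  proof -
    have h: "comm_ring_hom (\<lambda>p. poly (insertion (\<lambda>c. [:c:]) (\<lambda>(c, d). [:a c d, b c d:]) p) s)"
      by standard (simp_all add: i.hom_add i.hom_mult)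
    have "poly Q s = insertion (\<lambda>c. c) (\<lambda>x. poly [:a (fst x) (snd x), b (fst x) (snd x):] s) p"
      unfolding Q_def hom_eq_insertion[OF h, of p] insertion_Const[OF ch] insertion_Var[OF ch] by (simp add: case_prod_unfold)
    then show ?thesis by (simp add: id_def case_prod_unfold)
  qed
  then show ?thesis by (rule that)
qed

text \<open>Restricted to a line, a polynomial function is a polynomial in one variable, which has finitely many zeros unless it
is 0. So a line with the induced topology is irreducible.\<close>

lemma cofinite_on_line:
  fixes a b :: "nat \<Rightarrow> nat \<Rightarrow> 'a::field"
  assumes "openin (zariski_mat n) U"
  shows "{s. mat n n (\<lambda>(c, d). a c d + s * b c d) \<in> U} = {} \<or> finite {s. mat n n (\<lambda>(c, d). a c d + s * b c d) \<notin> U}"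
proof -
  let ?g = "\<lambda>s. mat n n (\<lambda>(c, d). a c d + s * b c d)"
  have "generate_topology_on {{A \<in> carrier_mat n n. insertion id (\<lambda>ij. A $$ ij) p \<noteq> 0} | p.
        mvars p \<subseteq> {..<n} \<times> {..<n}} U"
    using assms unfolding zariski_mat_def by (rule openin_topology_generated_by)
  then show ?thesis
  proof induction
    case (Int U V)
    have "{s. ?g s \<notin> U \<inter> V} = {s. ?g s \<notin> U} \<union> {s. ?g s \<notin> V}" by auto
    then show ?case using Int.IH by auto
  next
    case (UN K)
    show ?case
    proof (cases "{s. ?g s \<in> \<Union>K} = {}")
      case False
      then obtain s W where W: "W \<in> K" "?g s \<in> W" by auto
      then have "{s. ?g s \<in> W} \<noteq> {}" by blast
      then have "finite {s. ?g s \<notin> W}" using UN.IH[OF W(1)] by (elim disjE) blast+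
      moreover have "{s. ?g s \<notin> \<Union>K} \<subseteq> {s. ?g s \<notin> W}" using W by auto
      ultimately show ?thesis using finite_subset by blast
    qed simp
  next
    case (Basis W)
    then obtain p where W: "W = {A \<in> carrier_mat n n. insertion id (\<lambda>ij. A $$ ij) p \<noteq> 0}"
      and mv: "mvars p \<subseteq> {..<n} \<times> {..<n}" by auto
    obtain Q where Q: "\<And>s. insertion id (\<lambda>(c, d). a c d + s * b c d) p = poly Q s"
      using poly_path[where p = p and a = a and b = b] by metis
    have "insertion id (\<lambda>ij. ?g s $$ ij) p = poly Q s" for s
      unfolding Q[symmetric] insertion_def
      using mv by (intro sum.cong arg_cong2[where f = "(*)"] prod.cong refl) (auto simp: mvars_def; fastforce)
    then have "{s. ?g s \<in> W} = {s. poly Q s \<noteq> 0}" "{s. ?g s \<notin> W} = {s. poly Q s = 0}" by (auto simp: W)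
    then show ?case using poly_roots_finite[of Q] by (cases "Q = 0") auto
  qed simp
qed

lemma line_in_special_orthogonal:
  fixes b :: "nat \<Rightarrow> nat \<Rightarrow> 'a::alg_closed_field"
  assumes "\<And>s. mat n n (\<lambda>(c, d). (if c = d then 1 else 0) + s * b c d) \<in> orthogonal_group n"
  shows "mat n n (\<lambda>(c, d). (if c = d then 1 else 0) + s * b c d) \<in> special_orthogonal_group n"
proof -
  let ?a = "\<lambda>c d. if c = d then 1 else (0::'a)"
  let ?g = "\<lambda>s. mat n n (\<lambda>(c, d). ?a c d + s * b c d)"
  have "connectedin (zariski_mat n) (range ?g)"
    unfolding connectedin topspace_zariski_mat
  proof (intro conjI notI)
    show "range ?g \<subseteq> carrier_mat n n" by auto
  next
    assume "\<exists>E1 E2. openin (zariski_mat n) E1 \<and> openin (zariski_mat n) E2 \<and> range ?g \<subseteq> E1 \<union> E2 \<and>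
      E1 \<inter> E2 \<inter> range ?g = {} \<and> E1 \<inter> range ?g \<noteq> {} \<and> E2 \<inter> range ?g \<noteq> {}"
    then obtain E1 E2 where E: "openin (zariski_mat n) E1" "openin (zariski_mat n) E2"
      "E1 \<inter> E2 \<inter> range ?g = {}" "E1 \<inter> range ?g \<noteq> {}" "E2 \<inter> range ?g \<noteq> {}" by blast
    have "finite {s. ?g s \<notin> E1}" using cofinite_on_line[OF E(1), of ?a b] E(4) by blast
    moreover have "finite {s. ?g s \<notin> E2}" using cofinite_on_line[OF E(2), of ?a b] E(5) by blast
    ultimately have "finite ({s. ?g s \<notin> E1} \<union> {s. ?g s \<notin> E2})" by simp
    moreover have "{s. ?g s \<notin> E1} \<union> {s. ?g s \<notin> E2} = UNIV" using E(3) by blast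
    ultimately show False using alg_closed_infinite by metis
  qed
  moreover have "range ?g \<subseteq> orthogonal_group n" using assms by auto
  ultimately have "connectedin (subtopology (zariski_mat n) (orthogonal_group n)) (range ?g)"
    by (simp add: connectedin_subtopology)
  moreover have "1\<^sub>m n = ?g 0" by (rule eq_matI) auto
  then have "1\<^sub>m n \<in> range ?g" by blast
  ultimately show ?thesis
    unfolding special_orthogonal_group_def connected_component_of_def by blast
qed

text \<open>The action of a root element on a vector: \<open>v\<^sub>i\<close> is increased by \<open>s v\<^sub>j\<close>, and the coordinate dual to \<open>v\<^sub>j\<close> is
corrected by the coordinate dual to \<open>v\<^sub>i\<close>. The sign of the correction is immaterial in characteristic 2.\<close>

definition root_map :: "nat \<Rightarrow> nat \<Rightarrow> 'a::comm_ring_1 \<Rightarrow> (nat \<Rightarrow> 'a) \<Rightarrow> nat \<Rightarrow> 'a" where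
  "root_map i j s v c = v c + (if c = i then s * v j else 0) + (if c = partner j then s * v (partner i) else 0)"

definition root_mat :: "nat \<Rightarrow> nat \<Rightarrow> nat \<Rightarrow> 'a::comm_ring_1 \<Rightarrow> 'a mat" where
  "root_mat n i j s = mat n n (\<lambda>(c, d). (if c = d then 1 else 0) +
     s * ((if c = i \<and> d = j then 1 else 0) + (if c = partner j \<and> d = partner i then 1 else 0)))"

lemma root_mat_apply:
  assumes "i < 2 * k" "j < 2 * k" "c < 2 * k"
  shows "(\<Sum>d<2 * k. root_mat (2 * k) i j s $$ (c, d) * v d) = root_map i j s v c"
proof -
  have "(\<Sum>d<2 * k. root_mat (2 * k) i j s $$ (c, d) * v d) =
    (\<Sum>d<2 * k. (if c = d then 1 else 0) * v d) + (if c = i then s * (\<Sum>d<2 * k. (if d = j then 1 else 0) * v d) else 0) +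
      (if c = partner j then s * (\<Sum>d<2 * k. (if d = partner i then 1 else 0) * v d) else 0)"
    using assms by (auto simp: root_mat_def sum.distrib[symmetric] sum_distrib_left algebra_simps intro!: sum.cong)
  then show ?thesis using assms by (simp add: sum_if_mult partner_less root_map_def)
qed

lemma root_q:
  assumes two: "(2::'a::comm_ring_1) = 0" and ij: "i < 2 * k" "j < 2 * k" "i \<noteq> j" "i \<noteq> partner j"
  shows "qform k (root_map i j s v) = (qform k v :: 'a)"
proof -
  define a where "a c = s * v j * basis_vec i c" for c
  define b where "b c = s * v (partner i) * basis_vec (partner j) c" for c
  have r: "root_map i j s v = (\<lambda>c. v c + (a c + b c))"
    by (auto simp: fun_eq_iff root_map_def a_def b_def basis_vec_def)
  have sm: "qform k (\<lambda>c. x * basis_vec d c) = 0" for x :: 'a and d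
  proof -
    have "qform k (\<lambda>c. x * basis_vec d c) = x * x * qform k (basis_vec d)"
      by (simp add: qform_def sum_distrib_left mult_ac)
    then show ?thesis by (simp add: qform_unit)
  qed
  have bsm: "bform k w (\<lambda>c. x * u c) = x * bform k w u" for x :: 'a and w u
    by (simp add: bform_def sum_distrib_left algebra_simps)
  have badd: "bform k w (\<lambda>c. x c + u c) = bform k w x + bform k w u" for x w u :: "nat \<Rightarrow> 'a"
    by (simp add: bform_def sum.distrib algebra_simps)
  have bu: "bform k w (basis_vec d) = w (partner d)" if "d < 2 * k" for w :: "nat \<Rightarrow> 'a" and d
    using bform_unit_left[OF that, of w] by (simp add: bform_sym)
  have "qform k a = 0" "qform k b = 0" unfolding a_def b_def by (rule sm)+
  moreover have "bform k a b = 0"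
    unfolding b_def bsm bu[OF partner_less[OF ij(2)]] using ij by (simp add: a_def basis_vec_def)
  moreover have "bform k v a + bform k v b = 2 * (s * v j * v (partner i))"
    unfolding a_def b_def bsm using ij by (simp add: bu partner_less)
  ultimately show ?thesis unfolding r qform_add badd using two by simp
qed

lemma root_special_orthogonal:
  assumes two: "(2::'a::alg_closed_field) = 0" and ij: "i < 2 * k" "j < 2 * k" "i \<noteq> j" "i \<noteq> partner j"
  shows "root_mat (2 * k) i j (s :: 'a) \<in> special_orthogonal_group (2 * k)"
  unfolding root_mat_def
proof (rule line_in_special_orthogonal)
  fix s :: 'a
  have "isometry_mat k (root_mat (2 * k) i j s)"
    unfolding isometry_mat_def
  proof (intro conjI ballI)
    fix v :: "'a vec" assume v: "v \<in> carrier_vec (2 * k)"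
    have "quad_form (2 * k) (root_mat (2 * k) i j s *\<^sub>v v) = qform k (root_map i j s (\<lambda>c. v $ c))"
      unfolding quad_form_qform
    proof (rule qform_cong)
      fix c assume c: "c < 2 * k"
      have "(root_mat (2 * k) i j s *\<^sub>v v) $ c = (\<Sum>d<2 * k. root_mat (2 * k) i j s $$ (c, d) * v $ d)"
        using v c by (auto simp: root_mat_def scalar_prod_def atLeast0LessThan intro!: sum.cong)
      then show "(root_mat (2 * k) i j s *\<^sub>v v) $ c = root_map i j s (\<lambda>c. v $ c) c"
        unfolding root_mat_apply[OF ij(1,2) c] .
    qed
    then show "quad_form (2 * k) (root_mat (2 * k) i j s *\<^sub>v v) = quad_form (2 * k) v"
      unfolding root_q[OF two ij] quad_form_qform .
  qed (simp add: root_mat_def)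
  then show "mat (2 * k) (2 * k) (\<lambda>(c, d). (if c = d then 1 else 0) +
     s * ((if c = i \<and> d = j then 1 else 0) + (if c = partner j \<and> d = partner i then 1 else 0))) \<in> orthogonal_group (2 * k)"
    by (simp add: orthogonal_isometry root_mat_def)
qed

section \<open>Consequences of invariance under root elements\<close>

definition root_invariant :: "nat \<Rightarrow> ((nat \<Rightarrow> nat \<Rightarrow> 'a::comm_ring_1) \<Rightarrow> 'a) \<Rightarrow> bool" where
  "root_invariant k \<beta> \<longleftrightarrow> (\<forall>i j s v. i < 2 * k \<longrightarrow> j < 2 * k \<longrightarrow> i \<noteq> j \<longrightarrow> i \<noteq> partner j \<longrightarrow> \<beta> (\<lambda>l. root_map i j s (v l)) = \<beta> v)"

lemma multilin_dep_less: "multilin n S \<beta> \<Longrightarrow> (\<And>i c. i \<in> S \<Longrightarrow> c < n \<Longrightarrow> v i c = w i c) \<Longrightarrow> \<beta> v = \<beta> w"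
  unfolding multilin_def by blast

lemma root_invariant_component:
  assumes two: "(2::'a::alg_closed_field) = 0"
    and F: "F \<in> invariants (2 * k) m (special_orthogonal_group (2 * k) :: 'a mat set)"
  shows "root_invariant k (\<lambda>v. eval_at v (component (2 * k) (unit_deg S) F))"
  unfolding root_invariant_def
proof (intro allI impI)
  fix i j and s :: 'a and v :: "nat \<Rightarrow> nat \<Rightarrow> 'a"
  assume ij: "i < 2 * k" "j < 2 * k" "i \<noteq> j" "i \<noteq> partner j"
  let ?C = "component (2 * k) (unit_deg S) F"
  let ?g = "root_mat (2 * k) i j s"
  have "?C \<in> invariants (2 * k) m (special_orthogonal_group (2 * k))"
    by (rule component_invariant[OF F])
  then have "act (2 * k) ?g ?C = ?C"
    using root_special_orthogonal[OF two ij] by (auto simp: invariants_def)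
  then have "eval_at v ?C = eval_at (\<lambda>l c. \<Sum>d<2 * k. ?g $$ (c, d) * v l d) ?C"
    using eval_at_act[of v "2 * k" ?g ?C] by simp
  also have "\<dots> = eval_at (\<lambda>l. root_map i j s (v l)) ?C"
    by (rule multilin_dep_less[OF multilin_component]) (use F root_mat_apply[OF ij(1,2)] in \<open>auto simp: invariants_def\<close>)
  finally show "eval_at (\<lambda>l. root_map i j s (v l)) ?C = eval_at v ?C" ..
qed

text \<open>The usual product of three root elements that represents a Weyl group reflection.\<close>

definition weyl_map :: "nat \<Rightarrow> nat \<Rightarrow> 'a::field \<Rightarrow> (nat \<Rightarrow> 'a) \<Rightarrow> nat \<Rightarrow> 'a" where
  "weyl_map i j t v c = (if c = i then t * v j else if c = j then v i / t
     else if c = partner i then v (partner j) / t else if c = partner j then t * v (partner i) else v c)"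

lemma partner_neq: "partner c \<noteq> c"
  by (auto simp: partner_def elim!: oddE)

lemma char2_double: "(2::'a::comm_ring_1) = 0 \<Longrightarrow> a + a = (0::'a)"
  by (metis mult_2 mult_zero_left)

lemma root_weyl:
  assumes two: "(2::'a::field) = 0" and ij: "i \<noteq> j" "i \<noteq> partner j" and t: "(t :: 'a) \<noteq> 0"
  shows "root_map i j t (root_map j i (1 / t) (root_map i j t v)) = weyl_map i j t v"
proof
  fix c
  note d = char2_double[OF two]
  have ne: "j \<noteq> partner i" "partner i \<noteq> partner j" "j \<noteq> i" "partner j \<noteq> i" "partner i \<noteq> i" "partner j \<noteq> j" "i \<noteq> partner i" "j \<noteq> partner j"
     "partner j \<noteq> partner i" "partner i \<noteq> j"
    using ij partner_inj[of i j] partner_neq partner_partner by metis+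
  have e: "a + (b + a) = b" "a + (a + b) = b" for a b :: 'a
    using d[of a] by (simp_all add: algebra_simps)
  show "root_map i j t (root_map j i (1 / t) (root_map i j t v)) c = weyl_map i j t v c"
    using t ij ne e two
    by (auto simp: root_map_def weyl_map_def distrib_left add_divide_distrib add.assoc)
qed

lemma root_invariant_weyl:
  assumes "root_invariant k \<beta>" and two: "(2::'a::field) = 0" and ij: "i < 2 * k" "j < 2 * k" "i \<noteq> j" "i \<noteq> partner j" and t: "(t :: 'a) \<noteq> 0"
  shows "\<beta> (\<lambda>l. weyl_map i j t (v l)) = \<beta> v"
proof -
  have ji: "j \<noteq> i" "j \<noteq> partner i" using ij partner_partner by metis+
  have r: "\<beta> (\<lambda>l. root_map i j s (v l)) = \<beta> v" "\<beta> (\<lambda>l. root_map j i s (v l)) = \<beta> v" for s v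
    using assms(1) ij ji unfolding root_invariant_def by blast+
  show ?thesis unfolding root_weyl[OF two ij(3,4) t, symmetric] r ..
qed

definition torus_map :: "nat \<Rightarrow> nat \<Rightarrow> 'a::field \<Rightarrow> (nat \<Rightarrow> 'a) \<Rightarrow> nat \<Rightarrow> 'a" where
  "torus_map i j t v c = (if c = i \<or> c = partner j then t * v c else if c = j \<or> c = partner i then v c / t else v c)"

lemma root_invariant_torus:
  assumes "root_invariant k \<beta>" and two: "(2::'a::field) = 0" and ij: "i < 2 * k" "j < 2 * k" "i \<noteq> j" "i \<noteq> partner j" and t: "(t :: 'a) \<noteq> 0"
  shows "\<beta> (\<lambda>l. torus_map i j t (v l)) = \<beta> v"
proof -
  have ne: "j \<noteq> partner i" "partner i \<noteq> partner j" "j \<noteq> i" "partner j \<noteq> i" "partner i \<noteq> i" "partner j \<noteq> j" "i \<noteq> partner i" "j \<noteq> partner j"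
     "partner j \<noteq> partner i" "partner i \<noteq> j"
    using ij partner_inj[of i j] partner_neq partner_partner by metis+
  have "torus_map i j t v = weyl_map i j t (weyl_map i j 1 v)" for v
    using ij ne by (auto simp: fun_eq_iff torus_map_def weyl_map_def)
  then show ?thesis using root_invariant_weyl[OF assms(1) two ij] t by simp
qed

text \<open>The simultaneous exchange of \<open>x\<close> and \<open>y\<close> in the first plane and in plane \<open>r\<close>. The exchange in a single plane has
Dickson invariant 1 and does not lie in the identity component.\<close>

definition double_swap :: "nat \<Rightarrow> (nat \<Rightarrow> 'a) \<Rightarrow> nat \<Rightarrow> 'a" where
  "double_swap r v c = (if c div 2 = 0 \<or> c div 2 = r then v (partner c) else v c)"

lemma root_invariant_double_swap:
  assumes "root_invariant k \<beta>" and two: "(2::'a::field) = 0" and r: "0 < r" "r < k"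
  shows "\<beta> (\<lambda>l. double_swap r (v l)) = \<beta> (v :: nat \<Rightarrow> nat \<Rightarrow> 'a)"
proof -
  have p: "partner 0 = 1" "partner (Suc 0) = 0" "partner (2 * r) = Suc (2 * r)" "partner (Suc (2 * r)) = 2 * r"
    by (simp_all add: partner_def)
  have "double_swap r v = weyl_map 0 (2 * r) 1 (weyl_map 0 (Suc (2 * r)) 1 v)" for v :: "nat \<Rightarrow> 'a"
  proof
    fix c
    have "c div 2 = 0 \<longleftrightarrow> c = 0 \<or> c = Suc 0" "c div 2 = r \<longleftrightarrow> c = 2 * r \<or> c = Suc (2 * r)" by auto
    then show "double_swap r v c = weyl_map 0 (2 * r) 1 (weyl_map 0 (Suc (2 * r)) 1 v) c"
      using r by (auto simp: double_swap_def weyl_map_def p)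
  qed
  then show ?thesis
    using root_invariant_weyl[OF assms(1) two, of 0 "2 * r" 1] root_invariant_weyl[OF assms(1) two, of 0 "Suc (2 * r)" 1] r by (simp add: p)
qed

lemma partner_div2: "partner c div 2 = c div 2"
  by (auto simp: partner_def elim!: oddE)

lemma div2_eq_cases: "a div 2 = b div 2 \<Longrightarrow> a = b \<or> a = partner b"
  by (cases "even a"; cases "even b") (auto simp: partner_def elim!: evenE oddE)

lemma double_swap_unit: "double_swap r (basis_vec c) = basis_vec (if c div 2 = 0 \<or> c div 2 = r then partner c else c)"
proof
  fix d
  have "partner d = c \<longleftrightarrow> d = partner c" by (metis partner_partner)
  moreover have "d = partner c \<Longrightarrow> d div 2 = c div 2" by (simp add: partner_div2)
  ultimately show "double_swap r (basis_vec c) d = basis_vec (if c div 2 = 0 \<or> c div 2 = r then partner c else c) d"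
    by (auto simp: double_swap_def basis_vec_def)
qed

lemma double_swap_add: "double_swap r (\<lambda>c. u c + v c) = (\<lambda>c. double_swap r u c + double_swap r v c)"
  by (auto simp: double_swap_def fun_eq_iff)

lemma multilin_dep: "multilin n S \<beta> \<Longrightarrow> (\<And>i c. i \<in> S \<Longrightarrow> v i c = w i c) \<Longrightarrow> \<beta> v = \<beta> w"
  unfolding multilin_def by blast

lemma multilin_add: "multilin n S \<beta> \<Longrightarrow> i \<in> S \<Longrightarrow> \<beta> (v(i := \<lambda>c. a c + b c)) = \<beta> (v(i := a)) + \<beta> (v(i := b))"
  unfolding multilin_def by blast

lemma multilin_scale: "multilin n S \<beta> \<Longrightarrow> i \<in> S \<Longrightarrow> \<beta> (v(i := \<lambda>c. s * a c)) = s * \<beta> (v(i := a))"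
  unfolding multilin_def by blast

lemma multilin_scale_all:
  assumes "multilin n S \<beta>" "finite S"
  shows "\<beta> (\<lambda>i c. s i * v i c) = (\<Prod>i\<in>S. s i) * \<beta> v"
proof -
  have "\<beta> (\<lambda>i. if i \<in> U then (\<lambda>c. s i * v i c) else v i) = (\<Prod>i\<in>U. s i) * \<beta> v" if "U \<subseteq> S" for U
    using finite_subset[OF that assms(2)] that
  proof (induction U rule: finite_induct)
    case (insert x U)
    let ?v = "\<lambda>i. if i \<in> U then (\<lambda>c. s i * v i c) else v i"
    have "(\<lambda>i. if i \<in> insert x U then (\<lambda>c. s i * v i c) else v i) = ?v(x := \<lambda>c. s x * v x c)"
      by (auto simp: fun_eq_iff)
    moreover have "?v(x := v x) = ?v" using insert by (auto simp: fun_eq_iff)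
    ultimately show ?case
      using insert multilin_scale[OF assms(1), of x ?v "s x" "v x"] by (simp add: mult_ac)
  qed simp
  from this[of S] have "\<beta> (\<lambda>i. if i \<in> S then (\<lambda>c. s i * v i c) else v i) = (\<Prod>i\<in>S. s i) * \<beta> v" by simp
  moreover have "\<beta> (\<lambda>i. if i \<in> S then (\<lambda>c. s i * v i c) else v i) = \<beta> (\<lambda>i c. s i * v i c)"
    by (rule multilin_dep[OF assms(1)]) simp
  ultimately show ?thesis by simp
qed

section \<open>Vanishing of products of invariants\<close>

definition zvec :: "nat \<Rightarrow> 'a::comm_ring_1" where "zvec c = basis_vec 2 c + basis_vec 3 c"

text \<open>Planes are numbered from 0, and plane \<open>r\<close> is spanned by the basis vectors \<open>2 r\<close> and \<open>2 r + 1\<close>. The vectors with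
numbers from \<open>h\<close> on run through the bases of the planes from 2 on, and plane 0 is not used.\<close>

definition witness :: "nat \<Rightarrow> nat \<Rightarrow> nat \<Rightarrow> 'a::comm_ring_1" where
  "witness h l = (if l = 0 then basis_vec 2 else if l < h then zvec else basis_vec (l - h + 4))"

context
  fixes k m h :: nat and S :: "nat set" and \<beta> :: "(nat \<Rightarrow> nat \<Rightarrow> 'a::alg_closed_field) \<Rightarrow> 'a"
  assumes two: "(2::'a) = 0" and k: "2 \<le> k" and h: "even h" "4 \<le> h" and m: "m + 4 = h + 2 * k"
    and S: "S \<subseteq> {..<m}" and ml: "multilin (2 * k) S \<beta>" and ri: "root_invariant k \<beta>"
begin

lemma exists_not_root_of_unity: "0 < N \<Longrightarrow> \<exists>t::'a. t \<noteq> 0 \<and> t ^ N \<noteq> 1"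
proof -
  assume N: "0 < N"
  have "infinite (UNIV - {0, 1 :: 'a})" using alg_closed_infinite by simp
  then have "UNIV - {0, 1 :: 'a} \<noteq> {}" by (metis finite.emptyI)
  then obtain c :: 'a where c: "c \<noteq> 0" "c \<noteq> 1" by blast
  obtain t where "t ^ N = c" using nth_root_exists[OF N] by blast
  then show ?thesis using c N by (auto intro!: exI[of _ t])
qed

text \<open>The torus that scales the basis vector in slot \<open>l\<close> by \<open>t\<close> scales its partner by \<open>1 / t\<close>; if the partner is not
seen by \<open>\<beta>\<close>, nothing compensates the factor \<open>t\<close>. The torus also acts on plane 0, which does not occur.\<close>

lemma vanish_unpaired:
  assumes l: "l \<in> S" "h \<le> l" and l': "\<And>q. h \<le> q \<Longrightarrow> q - h + 4 = partner (l - h + 4) \<Longrightarrow> q \<notin> S"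
  shows "\<beta> (witness h) = 0"
proof -
  obtain t :: 'a where t: "t \<noteq> 0" "t \<noteq> 1" using exists_not_root_of_unity[of 1] by auto
  let ?c = "l - h + 4"
  have "l < m" using l S by auto
  then have c: "?c < 2 * k" "4 \<le> ?c" using l m by auto
  have p0: "partner 0 = 1" by (simp add: partner_def)
  have "2 \<le> partner ?c div 2" unfolding partner_div2 using c(2) by simp
  then have pc: "partner ?c \<ge> 4" by linarith
  have "\<beta> (witness h) = \<beta> (\<lambda>q. torus_map ?c 0 t (witness h q))"
    by (rule root_invariant_torus[OF ri two, symmetric]) (use c t p0 in auto)
  also have "\<dots> = \<beta> ((witness h)(l := \<lambda>c. t * witness h l c))"
  proof (rule multilin_dep[OF ml])
    fix q d assume q: "q \<in> S"
    show "torus_map ?c 0 t (witness h q) d = ((witness h)(l := \<lambda>c. t * witness h l c)) q d"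
    proof (cases "q < h")
      case True
      then show ?thesis using l h c pc p0 by (auto simp: torus_map_def witness_def zvec_def basis_vec_def)
    next
      case False
      then have "q - h + 4 \<noteq> partner ?c" using l'[of q] q by auto
      moreover have "q - h + 4 = ?c \<longleftrightarrow> q = l" using False l by auto
      ultimately show ?thesis using False l h p0 by (auto simp: torus_map_def witness_def basis_vec_def)
    qed
  qed
  also have "\<dots> = t * \<beta> ((witness h)(l := witness h l))" by (rule multilin_scale[OF ml l(1)])
  finally have "\<beta> (witness h) = t * \<beta> (witness h)" by simp
  then show ?thesis using t by (metis mult_cancel_right1)
qed

text \<open>The double swap of planes 0 and 1 fixes \<open>zvec\<close> and exchanges its two summands. It moves the vector in slot 0, and
therefore this slot must not be among those that \<open>\<beta>\<close> depends on.\<close>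

lemma vanish_without_first:
  assumes l: "l \<in> S" "0 < l" "l < h" and 0: "0 \<notin> S"
  shows "\<beta> (witness h) = 0"
proof -
  have "witness h = (witness h)(l := \<lambda>c. basis_vec 2 c + basis_vec 3 c)"
    using l by (auto simp: fun_eq_iff witness_def zvec_def)
  then have "\<beta> (witness h) = \<beta> ((witness h)(l := basis_vec 2)) + \<beta> ((witness h)(l := basis_vec 3))"
    using multilin_add[OF ml l(1), of "witness h" "basis_vec 2" "basis_vec 3"] by metis
  also have "\<beta> ((witness h)(l := basis_vec 2)) = \<beta> (\<lambda>q. double_swap 1 (((witness h)(l := basis_vec 2)) q))"
    by (rule root_invariant_double_swap[OF ri two, symmetric]) (use k in auto)
  also have "\<dots> = \<beta> ((witness h)(l := basis_vec 3))"
  proof (rule multilin_dep[OF ml])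
    fix q d assume q: "q \<in> S"
    have p: "partner 2 = 3" "partner 3 = 2" by (simp_all add: partner_def)
    have z: "double_swap 1 (zvec :: nat \<Rightarrow> 'a) = zvec"
      unfolding zvec_def[abs_def] double_swap_add double_swap_unit by (auto simp: p fun_eq_iff)
    have u: "double_swap 1 (basis_vec c :: nat \<Rightarrow> 'a) = basis_vec c" if "4 \<le> c" for c
      using that by (auto simp: double_swap_unit)
    have u2: "double_swap 1 (basis_vec 2 :: nat \<Rightarrow> 'a) = basis_vec 3" by (simp add: double_swap_unit p)
    have q0: "q \<noteq> 0" using q 0 by metis
    consider "q = l" | "q \<noteq> l" "q < h" | "q \<noteq> l" "\<not> q < h" by blast
    then have "double_swap 1 (((witness h)(l := basis_vec 2)) q) = (((witness h)(l := basis_vec 3)) q :: nat \<Rightarrow> 'a)"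
    proof cases
      case 1
      then show ?thesis using u2 by (simp only: fun_upd_same)
    next
      case 2
      then have "witness h q = (zvec :: nat \<Rightarrow> 'a)" using q0 by (simp add: witness_def)
      then show ?thesis using z 2 by simp
    next
      case 3
      then have "witness h q = (basis_vec (q - h + 4) :: nat \<Rightarrow> 'a)" using q0 by (simp add: witness_def)
      then show ?thesis using u[of "q - h + 4"] 3 by simp
    qed
    then show "double_swap 1 (((witness h)(l := basis_vec 2)) q) d = (((witness h)(l := basis_vec 3)) q d :: 'a)"
      by (rule fun_cong)
  qed
  finally have "\<beta> (witness h) = \<beta> ((witness h)(l := basis_vec 3)) + \<beta> ((witness h)(l := basis_vec 3))" .
  then show ?thesis unfolding char2_double[OF two] .
qed

definition wvec :: "nat \<Rightarrow> 'a" where "wvec c = zvec c + (basis_vec 0 c + basis_vec 1 c)"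

text \<open>As long as plane \<open>r\<close> is not seen, the double swap of planes 0 and \<open>r\<close> acts as a swap of plane 0 alone, and adding
\<open>x + y\<close> of plane 0 to any slot does not change the value. This replaces \<open>zvec\<close> by the isotropic vector
\<open>wvec\<close>, which is conjugate to the isotropic basis vector 3 under the stabilizer of the basis vector 2.\<close>

lemma vanish_missing_plane:
  assumes head: "{..<h} \<subseteq> S" and r: "2 \<le> r" "r < k"
    and miss: "\<And>q. h \<le> q \<Longrightarrow> (q - h + 4) div 2 = r \<Longrightarrow> q \<notin> S"
  shows "\<beta> (witness h) = 0"
proof -
  define P where "P U q = (if q \<in> U then wvec else witness h q)" for U q
  have step: "\<beta> (P (insert l U)) = \<beta> (P U)" if U: "l \<notin> U" "0 < l" "l < h" "U \<subseteq> {0<..<h}" for l U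
  proof -
    have lS: "l \<in> S" using U head by auto
    have "P (insert l U) = (P U)(l := \<lambda>c. zvec c + (basis_vec 0 c + basis_vec 1 c))"
      by (auto simp: fun_eq_iff P_def wvec_def)
    then have "\<beta> (P (insert l U)) = \<beta> ((P U)(l := zvec)) + \<beta> ((P U)(l := \<lambda>c. basis_vec 0 c + basis_vec 1 c))"
      using multilin_add[OF ml lS] by metis
    also have "(P U)(l := zvec) = P U"
      using U by (auto simp: fun_eq_iff P_def witness_def)
    also have "\<beta> ((P U)(l := \<lambda>c. basis_vec 0 c + basis_vec 1 c)) = \<beta> ((P U)(l := basis_vec 0)) + \<beta> ((P U)(l := basis_vec 1))"
      by (rule multilin_add[OF ml lS])
    also have "\<beta> ((P U)(l := basis_vec 0)) = \<beta> (\<lambda>q. double_swap r (((P U)(l := basis_vec 0)) q))"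
      by (rule root_invariant_double_swap[OF ri two, symmetric]) (use r in auto)
    also have "\<dots> = \<beta> ((P U)(l := basis_vec 1))"
    proof (rule multilin_dep[OF ml])
      fix q d assume q: "q \<in> S"
      have p: "partner 0 = 1" "partner (Suc 0) = 0" by (simp_all add: partner_def)
      have fix_unit: "double_swap r (basis_vec c :: nat \<Rightarrow> 'a) = basis_vec c" if "2 \<le> c" "c div 2 \<noteq> r" for c
        using that by (auto simp: double_swap_unit)
      have z: "double_swap r (zvec :: nat \<Rightarrow> 'a) = zvec"
        unfolding zvec_def[abs_def] double_swap_add using r by (simp add: fix_unit)
      moreover have "double_swap r wvec = wvec"
        unfolding wvec_def[abs_def] double_swap_add z by (auto simp: double_swap_unit p fun_eq_iff)
      moreover have "double_swap r (basis_vec 0 :: nat \<Rightarrow> 'a) = basis_vec 1" by (simp add: double_swap_unit p)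
      moreover have "double_swap r (basis_vec 2 :: nat \<Rightarrow> 'a) = basis_vec 2" using r by (simp add: fix_unit)
      moreover have "double_swap r (basis_vec (q - h + 4) :: nat \<Rightarrow> 'a) = basis_vec (q - h + 4)" if "\<not> q < h"
        using miss[of q] q that by (intro fix_unit) auto
      ultimately show "double_swap r (((P U)(l := basis_vec 0)) q) d = ((P U)(l := basis_vec 1)) q d"
        by (simp add: P_def witness_def)
    qed
    finally have "\<beta> (P (insert l U)) = \<beta> (P U) + (\<beta> ((P U)(l := basis_vec 1)) + \<beta> ((P U)(l := basis_vec 1)))" .
    then show ?thesis unfolding char2_double[OF two] by simp
  qed
  have "\<beta> (P U) = \<beta> (witness h)" if "U \<subseteq> {0<..<h}" for U
  proof -
    have "finite U" using that finite_subset by blast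
    then show ?thesis using that
    proof (induction U rule: finite_induct)
      case empty
      have "P {} = witness h" by (auto simp: P_def fun_eq_iff)
      then show ?case by simp
    next
      case (insert l U)
      then show ?case using step[of l U] by simp
    qed
  qed
  then have 1: "\<beta> (witness h) = \<beta> (P {0<..<h})" by simp
  define p' :: "nat \<Rightarrow> nat \<Rightarrow> 'a" where "p' q = (if q = 0 then basis_vec 2 else if q < h then basis_vec 3 else basis_vec (q - h + 4))" for q
  \<comment> \<open>This product of two root elements is the Siegel transformation that fixes the basis vector 2 and maps
    the basis vector 3 to \<open>wvec\<close>.\<close>
  have "root_map 1 3 1 (root_map 0 3 1 (p' q)) = P {0<..<h} q" for q
  proof
    fix d
    have pp: "partner 3 = 2" "partner 0 = 1" "partner (Suc 0) = 0" by (simp_all add: partner_def)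
    have u: "root_map (Suc 0) 3 1 (root_map 0 3 1 u) d = u d + (if d = 0 then u 3 else 0) + (if d = 1 then u 3 else 0)
        + (if d = 2 then u 1 + (u 0 + u 3) else 0)" for u :: "nat \<Rightarrow> 'a"
      by (simp add: root_map_def pp)
    consider "q = 0" | "0 < q" "q < h" | "\<not> q < h" by linarith
    then show "root_map 1 3 1 (root_map 0 3 1 (p' q)) d = P {0<..<h} q d"
    proof cases
      case 1
      then have "p' q = basis_vec 2" "P {0<..<h} q = basis_vec 2" using h by (simp_all add: p'_def P_def witness_def)
      then show ?thesis by (simp add: u basis_vec_def)
    next
      case 2
      then have "p' q = basis_vec 3" "P {0<..<h} q = wvec" by (simp_all add: p'_def P_def)
      then show ?thesis by (simp add: u wvec_def zvec_def basis_vec_def)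
    next
      case 3
      then have "p' q = basis_vec (q - h + 4)" "P {0<..<h} q = basis_vec (q - h + 4)"
        using h by (auto simp: p'_def P_def witness_def)
      then show ?thesis by (simp add: u) (simp add: basis_vec_def)
    qed
  qed
  then have "\<beta> (P {0<..<h}) = \<beta> (\<lambda>q. root_map 1 3 1 (root_map 0 3 1 (p' q)))" by simp
  also have "\<dots> = \<beta> p'"
  proof -
    have "partner 3 = 2" by (simp add: partner_def)
    then have "\<beta> (\<lambda>q. root_map 1 3 1 (v q)) = \<beta> v" "\<beta> (\<lambda>q. root_map 0 3 1 (v q)) = \<beta> v" for v
      using ri k unfolding root_invariant_def by simp_all
    then show ?thesis by simp
  qed
  finally have 2: "\<beta> (P {0<..<h}) = \<beta> p'" .
  obtain t :: 'a where t: "t \<noteq> 0" "t ^ (h - 2) \<noteq> 1" using exists_not_root_of_unity[of "h - 2"] h by auto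
  \<comment> \<open>The torus of plane 1 acts on the tuple by the scalars \<open>s\<close>, with the product \<open>t ^ (2 - h)\<close>.\<close>
  define s where "s q = (if q = 0 then t else if q < h then 1 / t else 1)" for q
  have "\<beta> p' = \<beta> (\<lambda>q. torus_map 2 0 t (p' q))"
    by (rule root_invariant_torus[OF ri two, symmetric]) (use k t in \<open>auto simp: partner_def\<close>)
  also have "(\<lambda>q. torus_map 2 0 t (p' q)) = (\<lambda>q d. s q * p' q d)"
    by (auto simp: fun_eq_iff torus_map_def p'_def s_def basis_vec_def partner_def)
  also have "\<beta> \<dots> = (\<Prod>q\<in>S. s q) * \<beta> p'"
    by (rule multilin_scale_all[OF ml]) (use S finite_subset in blast)
  also have "(\<Prod>q\<in>S. s q) = (\<Prod>q<h. s q)"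
    by (rule prod.mono_neutral_right) (use head S finite_subset h in \<open>auto simp: s_def\<close>)
  also have "(\<Prod>q<h. s q) = t * (1 / t) ^ (h - 1)"
  proof -
    obtain h' where h': "h = Suc h'" using h by (cases h) auto
    have "(\<Prod>q<h'. s (Suc q)) = (\<Prod>q<h'. 1 / t)" by (rule prod.cong) (auto simp: s_def h')
    then show ?thesis unfolding h' by (subst prod.lessThan_Suc_shift) (simp add: s_def)
  qed
  finally have 3: "\<beta> p' = t * (1 / t) ^ (h - 1) * \<beta> p'" .
  have "h - 1 = Suc (h - 2)" using h by simp
  then have "t * (1 / t) ^ (h - 1) = (1 / t) ^ (h - 2)" using t by simp
  also have "\<dots> \<noteq> 1" using t by (simp add: power_divide)
  finally have "\<beta> p' = 0" using 3 by (metis mult_cancel_right1)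
  then show ?thesis using 1 2 by simp
qed

end

lemma product_vanishes:
  fixes \<beta> \<gamma> :: "(nat \<Rightarrow> nat \<Rightarrow> 'a::alg_closed_field) \<Rightarrow> 'a"
  assumes two: "(2::'a) = 0" and k: "2 \<le> k" and h: "even h" "4 \<le> h" and m: "m + 4 = h + 2 * k"
    and S: "S \<subseteq> {..<m}" "0 \<in> S" "S \<noteq> {..<m}"
    and b: "multilin (2 * k) S \<beta>" "root_invariant k \<beta>" and c: "multilin (2 * k) ({..<m} - S) \<gamma>" "root_invariant k \<gamma>"
  shows "\<beta> (witness h) * \<gamma> (witness h) = 0"
proof -
  let ?T = "{..<m} - S"
  note C = two k h m
  have T: "?T \<subseteq> {..<m}" by auto
  show ?thesis
  proof (cases "\<exists>l\<in>?T. l < h")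
    case True
    then obtain l where l: "l \<in> ?T" "l < h" by blast
    then have "0 < l" using S by (cases l) auto
    then have "\<gamma> (witness h) = 0"
      using vanish_without_first[OF C T c l(1)] l S by auto
    then show ?thesis by simp
  next
    case False
    have hm: "h \<le> m" using m k by auto
    have head: "{..<h} \<subseteq> S"
    proof
      fix q assume "q \<in> {..<h}"
      then have "q \<in> {..<m}" "\<not> q \<in> ?T" using hm False by auto
      then show "q \<in> S" by auto
    qed
    from S obtain l where l: "l \<in> ?T" by blast
    with False have lh: "h \<le> l" by (meson not_le)
    let ?c = "l - h + 4"
    have c4: "4 \<le> ?c" "?c < 2 * k" using lh l m by auto
    have pd: "partner d div 2 = d div 2" for d by (auto simp: partner_def elim!: oddE)
    show ?thesis
    proof (cases "\<exists>q\<in>?T. h \<le> q \<and> q - h + 4 = partner ?c")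
      case True
      have "\<beta> (witness h) = 0"
      proof (rule vanish_missing_plane[OF C S(1) b head, of "?c div 2"])
        show "2 \<le> ?c div 2" "?c div 2 < k" using c4 by auto
        fix q assume q: "h \<le> q" "(q - h + 4) div 2 = ?c div 2"
        then have "q - h + 4 = ?c \<or> q - h + 4 = partner ?c" by (intro div2_eq_cases)
        then show "q \<notin> S"
        proof
          assume "q - h + 4 = ?c"
          then have "q = l" using q lh by auto
          then show ?thesis using l by auto
        next
          assume e: "q - h + 4 = partner ?c"
          from True obtain q' where q': "q' \<in> ?T" "h \<le> q'" "q' - h + 4 = partner ?c" by blast
          then have "q - h + 4 = q' - h + 4" using e by simp
          then have "q = q'" using q q' by linarith
          then show ?thesis using q' by auto
        qed
      qed
      then show ?thesis by simp
    next
      case False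
      have "\<gamma> (witness h) = 0"
        using vanish_unpaired[OF C T c l lh] False by blast
      then show ?thesis by simp
    qed
  qed
qed

section \<open>Indecomposability\<close>

lemma half_spin_trace_lower_planes:
  assumes lo: "\<And>v c. v \<in> set vs \<Longrightarrow> 2 * j \<le> c \<Longrightarrow> v c = 0" and even_len: "even (length vs)" and jk: "j \<le> k"
  shows "half_spin_trace k (vs @ map basis_vec [2 * j..<2 * k]) = half_spin_trace j vs"
  using jk
proof (induction k rule: dec_induct)
  case base
  show ?case by simp
next
  case (step k)
  have "[2 * j..<2 * Suc k] = [2 * j..<2 * k] @ [2 * k, Suc (2 * k)]"
    using step by simp
  then have e: "vs @ map basis_vec [2 * j..<2 * Suc k] = (vs @ map basis_vec [2 * j..<2 * k]) @ [basis_vec (2 * k), basis_vec (Suc (2 * k))]"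
    by simp
  have "half_spin_trace (Suc k) ((vs @ map basis_vec [2 * j..<2 * k]) @ [basis_vec (2 * k), basis_vec (Suc (2 * k))]) = half_spin_trace k (vs @ map basis_vec [2 * j..<2 * k])"
    by (rule last_pair(2)) (use lo step even_len in \<open>auto simp: basis_vec_def\<close>)
  then show ?case unfolding e step.IH .
qed

text \<open>Pairs of equal letters \<open>zvec\<close> cancel since \<open>q(zvec) = 1\<close>, and one letter \<open>zvec\<close> next to the basis vector 2 may be
replaced by the basis vector 3. There remains the product of both basis vectors in all planes except plane 0, and its
trace on the half-spin space is that of the projection for the single plane 0.\<close>

lemma half_spin_trace_witness:
  assumes h: "even h" "4 \<le> h" and k: "2 \<le> k" and m: "m + 4 = h + 2 * k"
  shows "half_spin_trace k (map (witness h) [0..<m]) = (1 :: 'a::comm_ring_1)"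
proof -
  obtain b where b: "h = 2 * b" using h(1) by (auto elim!: evenE)
  define a where "a = b - 1"
  have a: "h = Suc (Suc (2 * a))" using b h(2) by (simp add: a_def)
  have "h \<le> m" using m k by simp
  then have "[0..<m] = [0..<h] @ [h..<m]" by (metis le_add_diff_inverse upt_add_eq_append zero_le)
  moreover have "map (witness h) [0..<h] = (basis_vec 2 :: nat \<Rightarrow> 'a) # replicate (Suc (2 * a)) zvec"
    by (rule nth_equalityI) (auto simp: a witness_def nth_Cons' simp del: upt_Suc)
  moreover have "map (witness h) [h..<m] = (map basis_vec [4..<2 * k] :: (nat \<Rightarrow> 'a) list)"
    by (rule nth_equalityI) (use m h in \<open>auto simp: witness_def add.commute\<close>)
  ultimately have "half_spin_trace k (map (witness h) [0..<m]) = half_spin_trace k (((basis_vec 2 :: nat \<Rightarrow> 'a) # replicate (Suc (2 * a)) zvec) @ map basis_vec [2 * 2..<2 * k])"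
    by simp
  also have "\<dots> = half_spin_trace 2 ((basis_vec 2 :: nat \<Rightarrow> 'a) # replicate (Suc (2 * a)) zvec)"
    by (rule half_spin_trace_lower_planes) (use k in \<open>auto simp: basis_vec_def zvec_def\<close>)
  also have "\<dots> = half_spin_trace 2 [basis_vec 2 :: nat \<Rightarrow> 'a, zvec]"
  proof (induction a)
    case (Suc a)
    have q: "qform 2 zvec = (1 :: 'a)" by (simp add: qform_def zvec_def basis_vec_def numeral_2_eq_2)
    show ?case
      using word_trace_sq[OF half_proj_carrier, of 2 "[basis_vec 2]" "zvec :: nat \<Rightarrow> 'a" "replicate (Suc (2 * a)) zvec"] Suc q by simp
  qed simp
  also have "\<dots> = half_spin_trace 2 ([] @ [basis_vec 2, basis_vec 2] @ []) + half_spin_trace 2 [basis_vec 2 :: nat \<Rightarrow> 'a, basis_vec 3]"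
  proof -
    have "slotwise (2 * 2) (half_spin_trace 2 :: (nat \<Rightarrow> 'a) list \<Rightarrow> 'a)"
      unfolding slotwise_def using word_trace_expand[OF half_proj_carrier] by blast
    from slotwise_add[OF this, of "[basis_vec 2]" "basis_vec 2" "basis_vec 3" "[]"]
    show ?thesis by (simp add: zvec_def[abs_def])
  qed
  also have "half_spin_trace 2 ([] @ [basis_vec 2, basis_vec 2] @ []) = (0 :: 'a)"
    unfolding word_trace_sq[OF half_proj_carrier] by (simp add: qform_unit)
  also have "half_spin_trace 2 [basis_vec 2 :: nat \<Rightarrow> 'a, basis_vec 3] = half_spin_trace 1 []"
    using last_pair(2)[of "[]" 1] by (simp add: numeral_2_eq_2 numeral_3_eq_3 del: half_proj.simps)
  also have "half_spin_trace 1 [] = (1 :: 'a)"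
    by (simp add: word_trace_def mtrace_def)
  finally show ?thesis by simp
qed

lemma map_of_int_inj: "Poly_Mapping.map (of_int :: int \<Rightarrow> rat) F = Poly_Mapping.map of_int G \<Longrightarrow> F = G"
proof (rule poly_mapping_eqI)
  fix t assume "Poly_Mapping.map (of_int :: int \<Rightarrow> rat) F = Poly_Mapping.map of_int G"
  then have "Poly_Mapping.lookup (Poly_Mapping.map (of_int :: int \<Rightarrow> rat) F) t = Poly_Mapping.lookup (Poly_Mapping.map of_int G) t" by simp
  then show "Poly_Mapping.lookup F t = Poly_Mapping.lookup G t"
    by (simp add: Poly_Mapping.map.rep_eq when_def split: if_splits)
qed

lemma f_poly_half_spin_trace:
  assumes "k \<le> l"
  shows "f_poly (2 * k) (2 * l) = (half_spin_trace k (generic_vectors (2 * l)) :: 'a::comm_ring_1 vpoly)"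
proof -
  have "f_int (2 * k) (2 * l) = half_spin_trace k (generic_vectors (2 * l))"
    unfolding f_int_def f_tilde_half_spin_trace[OF assms]
  proof (rule the_equality)
    show e: "Poly_Mapping.map of_int (half_spin_trace k (generic_vectors (2 * l)) :: int vpoly) = (half_spin_trace k (generic_vectors (2 * l)) :: rat vpoly)"
      unfolding generic_vectors_def by (rule map_of_int_half_spin_trace)
    fix F :: "int vpoly" assume "Poly_Mapping.map of_int F = (half_spin_trace k (generic_vectors (2 * l)) :: rat vpoly)"
    then show "F = half_spin_trace k (generic_vectors (2 * l))" using e by (intro map_of_int_inj) simp
  qed
  then show ?thesis unfolding f_poly_def generic_vectors_def by (simp only: map_of_int_half_spin_trace)
qed

text \<open>The entries of the matrix of a generic vector are linear in the variables of this vector.\<close>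

lemma half_spin_trace_multihom:
  assumes n: "n = 2 * k"
  shows "(half_spin_trace k (generic_vectors m) :: 'a::comm_ring_1 vpoly) \<in> multihom n (unit_deg {..<m})"
proof -
  interpret c: comm_ring_hom "Const :: 'a \<Rightarrow> 'a vpoly" by (rule Const_hom)
  have sp: "(spin k (\<lambda>c. Var (i, c)) :: 'a vpoly mat) $$ (a, b) \<in> multihom n (\<lambda>j. if j = i then 1 else 0)"
    if "a < 2 ^ k" "b < 2 ^ k" for i a b
  proof -
    have u: "(spin k (basis_vec c) :: 'a vpoly mat) $$ (a, b) = Const (spin k (basis_vec c) $$ (a, b))" for c
    proof -
      have "(\<lambda>d. Const (basis_vec c d) :: 'a vpoly) = basis_vec c" by (auto simp: basis_vec_def fun_eq_iff)
      then have "(spin k (basis_vec c) :: 'a vpoly mat) = map_mat Const (spin k (basis_vec c))"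
        using c.hom_spin[of k "basis_vec c"] by simp
      then show ?thesis using that by simp
    qed
    have "Var (i, c) * (spin k (basis_vec c) :: 'a vpoly mat) $$ (a, b) \<in> multihom n (\<lambda>j. if j = i then 1 else 0)" if "c < 2 * k" for c
      unfolding u using multihom_mult[OF multihom_Var[of c n i] multihom_Const] that n by fastforce
    then show ?thesis unfolding spin_expand[OF that, of "\<lambda>c. Var (i, c)"] by (intro multihom_sum) auto
  qed
  have wd: "(clifford_word k (map (\<lambda>i c. Var (i, c)) is) :: 'a vpoly mat) $$ (a, b) \<in> multihom n (\<lambda>j. if j \<in> set is then 1 else 0)"
    if "distinct is" "a < 2 ^ k" "b < 2 ^ k" for "is" a b
    using that
  proof (induction "is" arbitrary: a b)
    case Nil
    then show ?case by simp
  next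
    case (Cons i "is")
    have d: "(\<lambda>j. (if j = i then 1 else 0) + (if j \<in> set is then 1 else 0)) = (\<lambda>j. if j \<in> set (i # is) then 1 else (0::nat))"
      using Cons.prems by (auto simp: fun_eq_iff)
    have "(clifford_word k (map (\<lambda>i c. Var (i, c)) (i # is)) :: 'a vpoly mat) $$ (a, b) =
       (\<Sum>q<2 ^ k. spin k (\<lambda>c. Var (i, c)) $$ (a, q) * clifford_word k (map (\<lambda>i c. Var (i, c)) is) $$ (q, b))"
      unfolding list.map clifford_word_simps by (rule mult_index) (use Cons.prems in auto)
    also have "\<dots> \<in> multihom n (\<lambda>j. if j \<in> set (i # is) then 1 else 0)"
      unfolding d[symmetric] using Cons by (intro multihom_sum multihom_mult sp Cons.IH) auto
    finally show ?case .
  qed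
  have ch: "(half_proj k :: 'a vpoly mat) $$ (a, b) \<in> multihom n (\<lambda>_. 0)" if "a < 2 ^ k" "b < 2 ^ k" for a b
    using that by (subst c.hom_half_proj[symmetric]) simp
  have "half_spin_trace k (generic_vectors m) = (\<Sum>a<2 ^ k. \<Sum>b<2 ^ k. (half_proj k :: 'a vpoly mat) $$ (a, b) * clifford_word k (generic_vectors m) $$ (b, a))"
    unfolding word_trace_def by (rule mtrace_mult) auto
  moreover have "(half_proj k :: 'a vpoly mat) $$ (a, b) * clifford_word k (generic_vectors m) $$ (b, a) \<in> multihom n (unit_deg {..<m})" if "a < 2 ^ k" "b < 2 ^ k" for a b
    using multihom_mult[OF ch[OF that] wd[of "[0..<m]" b a]] that by (simp add: generic_vectors_def unit_deg_def[abs_def])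
  ultimately show ?thesis by (auto intro!: multihom_sum)
qed

lemma total_multideg:
  assumes "Poly_Mapping.keys t \<subseteq> {..<m} \<times> {..<n}"
  shows "(\<Sum>x\<in>Poly_Mapping.keys t. Poly_Mapping.lookup t x) = (\<Sum>i<m. multideg n t i)"
proof -
  have "(\<Sum>x\<in>Poly_Mapping.keys t. Poly_Mapping.lookup t x) = (\<Sum>x\<in>{..<m} \<times> {..<n}. Poly_Mapping.lookup t x)"
    using assms by (intro sum.mono_neutral_left) (auto simp: in_keys_iff)
  then show ?thesis unfolding multideg_def by (simp add: sum.cartesian_product)
qed

lemma total_degree_le: "(\<And>t. t \<in> Poly_Mapping.keys p \<Longrightarrow> (\<Sum>x\<in>Poly_Mapping.keys t. Poly_Mapping.lookup t x) \<le> d) \<Longrightarrow> total_degree p \<le> d"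
  unfolding total_degree_def by (subst Max_le_iff) auto

lemma total_degree_ge: "t \<in> Poly_Mapping.keys p \<Longrightarrow> (\<Sum>x\<in>Poly_Mapping.keys t. Poly_Mapping.lookup t x) \<le> total_degree p"
  unfolding total_degree_def by (intro Max_ge) auto

theorem theorem7:
  fixes n m :: nat
  assumes "CHAR('k::alg_closed_field) = 2"
    and "even n" and "even m" and "4 \<le> n" and "n \<le> m"
  shows "multilinear n m (f_poly n m :: 'k vpoly) \<and>
    indecomposable_in (invariants n m (special_orthogonal_group n)) (f_poly n m :: 'k vpoly)"
proof
  have two: "(2::'k) = 0" using of_nat_CHAR[where 'a = 'k] assms(1) by simp
  obtain k l where n: "n = 2 * k" and ml: "m = 2 * l" using assms(2,3) by (auto elim!: evenE)
  define h where "h = m + 4 - n"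
  have h: "even h" "4 \<le> h" "m + 4 = h + 2 * k" and k: "2 \<le> k" using assms n by (auto simp: h_def)
  let ?f = "f_poly n m :: 'k vpoly" and ?M = "{..<m}" and ?A = "invariants n m (special_orthogonal_group n) :: 'k vpoly set"
  have f: "?f = half_spin_trace k (generic_vectors m)" using f_poly_half_spin_trace[of k l] assms n ml by simp
  have fh: "?f \<in> multihom n (unit_deg ?M)" unfolding f by (rule half_spin_trace_multihom[OF n])
  then have fR: "?f \<in> vpoly_ring n m" by (rule vpoly_ringI) (simp add: unit_deg_def)
  show "multilinear n m ?f"
    unfolding multilinear_def
  proof (intro conjI ballI allI impI fR)
    fix t i assume "t \<in> Poly_Mapping.keys ?f" "i < m"
    then have "multideg n t i = unit_deg ?M i" using fh by (auto simp: multihom_def)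
    then show "(\<Sum>c<n. Poly_Mapping.lookup t (i, c)) = 1" using \<open>i < m\<close> by (simp add: multideg_def unit_deg_def)
  qed
  have fA: "?f \<in> ?A"
    using fR half_spin_trace_invariant[OF two, of _ k m] unfolding invariants_def f[unfolded n] n by auto
  \<comment> \<open>The value at the witness of the component that is linear in all \<open>m\<close> vectors. Invariants on which it vanishes
    are closed under products, because all terms of the product formula vanish.\<close>
  let ?L = "\<lambda>F. eval_at (witness h) (component n (unit_deg ?M) F) :: 'k"
  interpret e: comm_ring_hom "eval_at (witness h :: nat \<Rightarrow> nat \<Rightarrow> 'k)" unfolding eval_at_def by (rule insertion_hom[OF id_hom])
  have Lmult: "?L (F * G) = 0" if F: "F \<in> ?A" "?L F = 0" and G: "G \<in> ?A" "?L G = 0" for F G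
  proof -
    have FR: "F \<in> vpoly_ring n m" "G \<in> vpoly_ring n m" using F G by (auto simp: invariants_def)
    let ?t = "\<lambda>F S. eval_at (witness h) (component n (unit_deg S) F) :: 'k"
    have mm: "multilin (2 * k) S (\<lambda>v. eval_at v (component n (unit_deg S) H))" "root_invariant k (\<lambda>v. eval_at v (component n (unit_deg S) H))"
      if "H \<in> ?A" for H S
      using that multilin_component[of H n m S] root_invariant_component[OF two, of H k m S] unfolding n by (auto simp: invariants_def)
    have z: "?t F S * ?t G (?M - S) = 0" if S: "S \<subseteq> ?M" for S
    proof -
      consider "S = ?M" | "S = {}" | "0 \<in> S" "S \<noteq> ?M" | "0 \<notin> S" "S \<noteq> {}" by blast
      then show ?thesis
      proof cases
        case 3
        show ?thesis
          using product_vanishes[OF two k h S 3 mm[OF F(1)] mm[OF G(1)]] .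
      next
        case 4
        let ?S' = "?M - S"
        have e: "?M - ?S' = S" using S by auto
        have S': "?S' \<subseteq> ?M" "0 \<in> ?S'" "?S' \<noteq> ?M" using S 4 assms by auto
        have "?t G ?S' * ?t F (?M - ?S') = 0"
          using product_vanishes[OF two k h S' mm[OF G(1)] mm[OF F(1)]] .
        then show ?thesis unfolding e by (simp add: mult.commute)
      qed (use F G in auto)
    qed
    have "?L (F * G) = (\<Sum>S\<in>Pow ?M. ?t F S * ?t G (?M - S))"
      by (simp add: component_mult e.hom_sum e.hom_mult)
    also have "\<dots> = 0" using z by (intro sum.neutral) auto
    finally show ?thesis .
  qed
  interpret a: comm_ring_hom "act n g" for g :: "'k mat" by (rule act_hom)
  have "?f \<notin> subalgebra_generated {r \<in> ?A. total_degree r < total_degree ?f}"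
  proof
    assume "?f \<in> subalgebra_generated {r \<in> ?A. total_degree r < total_degree ?f}"
    then have "?f \<in> ?A \<and> ?L ?f = 0"
    proof induction
      case (Const c)
      have "component n (unit_deg ?M) (Const c :: 'k vpoly) = 0"
      proof -
        have "unit_deg ?M 0 \<noteq> 0" using assms by (simp add: unit_deg_def)
        then have "(\<lambda>_. 0) \<noteq> unit_deg ?M" by metis
        then show ?thesis using component_multihom[OF multihom_Const, of n "unit_deg ?M" c] by simp
      qed
      moreover have "Const c \<in> vpoly_ring n m" by (rule vpoly_ringI[OF multihom_Const]) simp
      ultimately show ?case by (simp add: invariants_def act_def insertion_Const[OF Const_hom])
    next
      case (gen r)
      then have rA: "r \<in> ?A" and d: "total_degree r < total_degree ?f" by auto
      then have rR: "r \<in> vpoly_ring n m" by (auto simp: invariants_def)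
      have tot: "(\<Sum>x\<in>Poly_Mapping.keys t. Poly_Mapping.lookup t x) = m"
        if "p \<in> vpoly_ring n m" "t \<in> Poly_Mapping.keys p" "multideg n t = unit_deg ?M" for p :: "'k vpoly" and t
        unfolding total_multideg[OF vpoly_ring_keys[OF that(1,2)]] that(3) by (simp add: unit_deg_def)
      have "total_degree ?f \<le> m"
        using fh tot[OF fR] by (intro total_degree_le) (auto simp: multihom_def)
      moreover have "m \<le> total_degree r" if "t \<in> Poly_Mapping.keys r" "multideg n t = unit_deg ?M" for t
        using total_degree_ge[OF that(1)] tot[OF rR that] by simp
      ultimately have "Poly_Mapping.keys (component n (unit_deg ?M) r) = {}" using d unfolding keys_component by fastforce
      then have "component n (unit_deg ?M) r = 0" by simp
      then show ?case using rA by simp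
    next
      case (add p r)
      then have "p + r \<in> ?A" using mvars_add[of p r] by (auto simp: invariants_def vpoly_ring_def a.hom_add)
      then show ?case using add by (simp add: component_add e.hom_add)
    next
      case (mult p r)
      then have "p * r \<in> ?A" using mvars_mult[of p r] by (auto simp: invariants_def vpoly_ring_def a.hom_mult)
      then show ?case using mult Lmult by simp
    qed
    moreover have "?L ?f = 1"
    proof -
      have "?L ?f = eval_at (witness h) ?f" using component_multihom[OF fh] by simp
      also have "\<dots> = half_spin_trace k (map (\<lambda>v c. eval_at (witness h) (v c)) (generic_vectors m))"
        unfolding f by (rule e.hom_half_spin_trace)
      also have "map (\<lambda>v c. eval_at (witness h) (v c)) (generic_vectors m) = map (witness h) [0..<m]"
        by (simp add: generic_vectors_def eval_at_def insertion_Var[OF id_hom])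
      also have "half_spin_trace k (map (witness h) [0..<m]) = (1 :: 'k)"
        by (rule half_spin_trace_witness[OF h(1,2) k h(3)])
      finally show ?thesis .
    qed
    ultimately show False by simp
  qed
  with fA show "indecomposable_in ?A ?f" unfolding indecomposable_in_def by simp
qed

end
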